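(* Let $D$ be a non-split $k$-almost alternating link diagram without a nugatory crossing. Then $D$ is $H$-$(k,k)$-thick and $TH$-$(k,k-1)$-thick.
   Context: Diagrams: $D$ is a diagram in the plane (disc) of an unoriented framed link, with ordered crossings. A diagram is $k$-almost alternating if it becomes alternating after changing $k$ of its crossings. A diagram is non-split if it is connected (as a planar graph). A crossing is nugatory if there is a simple closed curve in the plane (sphere) meeting the diagram only at that crossing, transversally, with parts of the diagram on both sides. At each crossing there are two smoothings: the positive-marker smoothing ($A$-smoothing) joins the two local regions swept out when the overcrossing arc is rotated counterclockwise until it meets the undercrossing arc; the negative-marker smoothing joins the other two regions. A Kauffman state $s$ assigns $+1$ or $-1$ (a positive or negative marker) to each crossing; $D_s$ is the system of circles obtained by smoothing all crossings according to $s$, $|s|$ is the number of circles of $D_s$, and $\sigma(s)$ is the number of positive minus the number of negative markers. $s_+$ (resp. $s_-$) is the state with all markers positive (resp. negative). Khovanov homology: an enhanced state $S$ is a Kauffman state $s$ with a sign $+$ or $-$ on each circle of $D_s$; put $\sigma(S)=\sigma(s)$ and $\tau(S)=\#\{\text{positive circles}\}-\#\{\text{negative circles}\}$. $\mathcal{C}_{i,j}(D)$ is the free abelian group on enhanced states with $\sigma(S)=i$ and $\sigma(S)+2\tau(S)=j$. The differential $d_{i,j}:\mathcal{C}_{i,j}(D)\to\mathcal{C}_{i-2,j}(D)$ is $d(S)=\sum_{S'}(-1)^{t(S:S')}[S:S']S'$, the sum over enhanced states $S'$ generating $\mathcal C_{i-2,j}(D)$, where $[S:S']=1$ if the markers of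 $S$ and $S'$ differ at exactly one crossing $v$ and all circles not touching $v$ have the same sign in $S$ and $S'$, and $[S:S']=0$ otherwise; $t(S:S')$ is the number of negative markers of $S$ at crossings bigger than $v$ in the ordering. $H_{i,j}(D)=\ker(d_{i,j})/\mathrm{im}(d_{i+2,j})$, and $T_{i,j}(D)$ is the torsion subgroup of $H_{i,j}(D)$. Thickness: a diagram $D$ with $N$ crossings is $H$-$(k_1,k_2)$-thick (resp. $TH$-$(k_1,k_2)$-thick) if $H_{i,j}(D)=0$ (resp. $T_{i,j}(D)=0$) with a possible exception of $i,j$ satisfying $N-2|s_-|-4k_2\le j-2i\le 2|s_+|-N+4k_1$. *)

theory Defs
  imports "HOL-Algebra.Free_Abelian_Groups" "HOL-Library.FuncSet"
begin

text \<open>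
  A link diagram is encoded by its underlying plane 4-valent graph, given as a rotation system, and
  the over/under information.  The crossings are \<open>0, ..., N - 1\<close>, in this order.  The dart
  \<open>(c, p)\<close> with \<open>p < 4\<close> is the \<open>p\<close>-th half-edge leaving the crossing \<open>c\<close>, counted counterclockwise,
  so \<open>(c, p)\<close> and \<open>(c, p + 2)\<close> belong to the same strand at \<open>c\<close>.  Every edge consists of two darts,
  exchanged by \<open>mate\<close>.  Components of the link without any crossing are not visible in
  the graph and are only counted, by \<open>loops\<close>.  The over-strand at \<open>c\<close> is the one through the
  positions 0 and 2 if \<open>over c\<close> holds, and the one through 1 and 3 otherwise.

  For a disconnected diagram, this does not record in which region of one piece another piece lies;
  none of the notions below depends on that, nor on the choice of the unbounded region.
\<close>

type_synonym dart = "nat \<times> nat"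

record diagram =
  ncross :: nat
  mate :: "dart \<Rightarrow> dart"
  loops :: nat
  over :: "nat \<Rightarrow> bool"

definition darts :: "diagram \<Rightarrow> dart set" where
  "darts D = {..<ncross D} \<times> {..<4}"

text \<open>The classes of the equivalence relation on \<open>A\<close> generated by \<open>R\<close>.\<close>

definition generated_classes :: "'a set \<Rightarrow> ('a \<times> 'a) set \<Rightarrow> 'a set set" where
  "generated_classes A R = A // ((R \<inter> A \<times> A) \<union> (R \<inter> A \<times> A)\<inverse>)\<^sup>*"

definition graph_components :: "diagram \<Rightarrow> nat set set" where
  "graph_components D = generated_classes {..<ncross D} {(fst d, fst (mate D d)) | d. d \<in> darts D}"

text \<open>
  The dart \<open>(c, p)\<close> also stands for the corner at \<open>c\<close> between the darts \<open>(c, p)\<close> and \<open>(c, p + 1)\<close>,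
  which lies to the left of \<open>(c, p)\<close>.  Walking along \<open>(c, p)\<close> with the region on the left,
  one arrives at \<open>mate D (c, p) = (c', q)\<close>, and the next corner is the one between the darts \<open>q - 1\<close>
  and \<open>q\<close> of \<open>c'\<close>.
\<close>

definition next_corner :: "diagram \<Rightarrow> dart \<Rightarrow> dart" where
  "next_corner D d = (case mate D d of (c, q) \<Rightarrow> (c, (q + 3) mod 4))"

definition faces :: "diagram \<Rightarrow> dart set set" where
  "faces D = generated_classes (darts D) {(d, next_corner D d) | d. d \<in> darts D}"

text \<open>
  The last condition is planarity: there are \<open>N\<close> vertices and \<open>2 N\<close> edges, and
  each connected component of the graph has Euler characteristic at most 2, so equality holds
  in total iff every component is embedded in a sphere.
\<close>

definition link_diagram :: "diagram \<Rightarrow> bool" where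
  "link_diagram D \<longleftrightarrow>
     (\<forall>d \<in> darts D. mate D d \<in> darts D \<and> mate D d \<noteq> d \<and> mate D (mate D d) = d) \<and>
     int (ncross D) - 2 * int (ncross D) + int (card (faces D)) = 2 * int (card (graph_components D))"

definition non_split :: "diagram \<Rightarrow> bool" where
  "non_split D \<longleftrightarrow> card (graph_components D) + loops D = 1"

text \<open>
  A closed curve meeting the diagram only at \<open>c\<close>, and transversally there, otherwise stays in
  one region, which it leaves and re-enters at \<open>c\<close> through two opposite corners.  It separates
  the darts \<open>p + 1, p + 2\<close> at \<open>c\<close> from \<open>p + 3, p\<close>, so there are parts of the diagram on both sides.
  Two opposite corners of \<open>c\<close> lie in the same region of the plane iff they are in the same boundary
  walk, because they belong to the same component of the graph.
\<close>

definition nugatory :: "diagram \<Rightarrow> nat \<Rightarrow> bool" where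
  "nugatory D c \<longleftrightarrow> c < ncross D \<and> (\<exists>F \<in> faces D. \<exists>p < 2. (c, p) \<in> F \<and> (c, p + 2) \<in> F)"

definition over_dart :: "diagram \<Rightarrow> dart \<Rightarrow> bool" where
  "over_dart D d \<longleftrightarrow> (even (snd d) \<longleftrightarrow> over D (fst d))"

definition alternating :: "diagram \<Rightarrow> bool" where
  "alternating D \<longleftrightarrow> (\<forall>d \<in> darts D. over_dart D (mate D d) \<noteq> over_dart D d)"

definition change_crossings :: "nat set \<Rightarrow> diagram \<Rightarrow> diagram" where
  "change_crossings K D = D\<lparr>over := (\<lambda>c. if c \<in> K then \<not> over D c else over D c)\<rparr>"

definition almost_alternating :: "nat \<Rightarrow> diagram \<Rightarrow> bool" where
  "almost_alternating k D \<longleftrightarrow>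
     (\<exists>K \<subseteq> {..<ncross D}. card K = k \<and> alternating (change_crossings K D))"


section \<open>Kauffman states\<close>

type_synonym state = "nat \<Rightarrow> int"

definition states :: "diagram \<Rightarrow> state set" where
  "states D = {..<ncross D} \<rightarrow>\<^sub>E {1, -1}"

definition s_plus :: "diagram \<Rightarrow> state" where
  "s_plus D = (\<lambda>c \<in> {..<ncross D}. 1)"

definition s_minus :: "diagram \<Rightarrow> state" where
  "s_minus D = (\<lambda>c \<in> {..<ncross D}. -1)"

definition sigma :: "diagram \<Rightarrow> state \<Rightarrow> int" where
  "sigma D s = (\<Sum>c < ncross D. s c)"

text \<open>
  The dart joined to \<open>(c, p)\<close> at \<open>c\<close> after smoothing.  If the over-strand passes through 0 and 2, its
  counterclockwise rotation sweeps out the corners \<open>01\<close> and \<open>23\<close>; joining them (positive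
  marker) leaves the two arcs \<open>12\<close> and \<open>30\<close>.  The negative marker leaves the arcs \<open>01\<close> and \<open>23\<close>, and
  the roles are exchanged if the over-strand passes through 1 and 3.
\<close>

definition smooth :: "diagram \<Rightarrow> state \<Rightarrow> dart \<Rightarrow> dart" where
  "smooth D s d = (case d of (c, p) \<Rightarrow>
     (c, if (s c = 1) = over D c then 3 - p
         else if even p then p + 1 else p - 1))"

text \<open>
  A circle is given by the set of darts it runs through, or by the number of a crossingless component.
\<close>

type_synonym circle = "dart set + nat"

definition circles :: "diagram \<Rightarrow> state \<Rightarrow> circle set" where
  "circles D s =
     Inl ` generated_classes (darts D) ({(d, mate D d) | d. d \<in> darts D} \<union> {(d, smooth D s d) | d. d \<in> darts D})
     \<union> Inr ` {..<loops D}"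

definition touches :: "circle \<Rightarrow> nat \<Rightarrow> bool" where
  "touches C v \<longleftrightarrow> (\<exists>X p. C = Inl X \<and> (v, p) \<in> X)"


section \<open>Khovanov homology\<close>

type_synonym enhanced_state = "state \<times> (circle \<Rightarrow> int)"

definition enhanced_states :: "diagram \<Rightarrow> enhanced_state set" where
  "enhanced_states D = (SIGMA s : states D. circles D s \<rightarrow>\<^sub>E {1, -1})"

definition tau :: "diagram \<Rightarrow> enhanced_state \<Rightarrow> int" where
  "tau D S = (\<Sum>C \<in> circles D (fst S). snd S C)"

definition generators :: "diagram \<Rightarrow> int \<Rightarrow> int \<Rightarrow> enhanced_state set" where
  "generators D i j =
     {S \<in> enhanced_states D. sigma D (fst S) = i \<and> sigma D (fst S) + 2 * tau D S = j}"

definition chain_group :: "diagram \<Rightarrow> int \<Rightarrow> int \<Rightarrow> (enhanced_state \<Rightarrow>\<^sub>0 int) monoid" where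
  "chain_group D i j = free_Abelian_group (generators D i j)"

definition incident_at :: "diagram \<Rightarrow> nat \<Rightarrow> enhanced_state \<Rightarrow> enhanced_state \<Rightarrow> bool" where
  "incident_at D v S S' \<longleftrightarrow>
     {w. w < ncross D \<and> fst S w \<noteq> fst S' w} = {v} \<and>
     (\<forall>C \<in> circles D (fst S). \<not> touches C v \<longrightarrow> snd S C = snd S' C)"

definition neg_after :: "diagram \<Rightarrow> nat \<Rightarrow> enhanced_state \<Rightarrow> nat" where
  "neg_after D v S = card {w. v < w \<and> w < ncross D \<and> fst S w = -1}"

text \<open>At most one summand is nonzero, since \<open>v\<close> is determined by \<open>S\<close> and \<open>S'\<close>.\<close>

definition coefficient :: "diagram \<Rightarrow> enhanced_state \<Rightarrow> enhanced_state \<Rightarrow> int" where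
  "coefficient D S S' =
     (\<Sum>v < ncross D. if incident_at D v S S' then (-1) ^ neg_after D v S else 0)"

definition differential ::
  "diagram \<Rightarrow> int \<Rightarrow> int \<Rightarrow> (enhanced_state \<Rightarrow>\<^sub>0 int) \<Rightarrow> (enhanced_state \<Rightarrow>\<^sub>0 int)" where
  "differential D i j =
     frag_extend (\<lambda>S. \<Sum>S' \<in> generators D (i - 2) j. frag_cmul (coefficient D S S') (frag_of S'))"

definition homology :: "diagram \<Rightarrow> int \<Rightarrow> int \<Rightarrow> (enhanced_state \<Rightarrow>\<^sub>0 int) set monoid" where
  "homology D i j =
     subgroup_generated (chain_group D i j)
       (kernel (chain_group D i j) (chain_group D (i - 2) j) (differential D i j))
     Mod (differential D (i + 2) j ` carrier (chain_group D (i + 2) j))"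

definition torsion_subgroup :: "('a, 'b) monoid_scheme \<Rightarrow> 'a set" where
  "torsion_subgroup G = {x \<in> carrier G. \<exists>n::nat. n > 0 \<and> x [^]\<^bsub>G\<^esub> n = \<one>\<^bsub>G\<^esub>}"

definition in_band :: "diagram \<Rightarrow> int \<Rightarrow> int \<Rightarrow> int \<Rightarrow> int \<Rightarrow> bool" where
  "in_band D k1 k2 i j \<longleftrightarrow>
     int (ncross D) - 2 * int (card (circles D (s_minus D))) - 4 * k2 \<le> j - 2 * i \<and>
     j - 2 * i \<le> 2 * int (card (circles D (s_plus D))) - int (ncross D) + 4 * k1"

definition H_thick :: "diagram \<Rightarrow> int \<Rightarrow> int \<Rightarrow> bool" where
  "H_thick D k1 k2 \<longleftrightarrow> (\<forall>i j. \<not> in_band D k1 k2 i j \<longrightarrow> trivial_group (homology D i j))"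

definition TH_thick :: "diagram \<Rightarrow> int \<Rightarrow> int \<Rightarrow> bool" where
  "TH_thick D k1 k2 \<longleftrightarrow>
     (\<forall>i j. \<not> in_band D k1 k2 i j \<longrightarrow> torsion_subgroup (homology D i j) = {\<one>\<^bsub>homology D i j\<^esub>})"

end

(*
  Let E be the alternating diagram obtained by changing the crossings in K.  Its planarity says that
  the ribbon surface whose discs are the circles of s_+(E) and whose bands are the crossings has genus
  0, and then so has every ribbon subsurface.  Hence changing one marker always merges two circles or
  splits one, and away from K a marker change that splits goes on to split when further markers
  become negative.

  Both inequalities are proved with coefficients Z/m, for every m, by induction on the number of free
  crossings of a subcube of the cube of resolutions.  A free crossing in K, or one at which
  the change of marker merges circles, is resolved in both ways, and the bounds for the two halves
  suffice.  Otherwise all free crossings split, so that the circles of the opposite extreme state and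
  the free crossings form a forest.  The circle q at a leaf of it is separated by a single
  crossing v: one sign of q gives a matching with the other resolution of v, and what remains is a
  smaller subcube in which the sign of q is frozen.  Smoothings that disconnect the diagram need no special
  treatment.

  Vanishing with all coefficients Z/m below the lower bound also shows that the homology on the lowest
  diagonal is torsion free.
*)
theory Submission
  imports Defs
begin

section \<open>Based complexes\<close>

text \<open>A generator in bidegree \<open>(i, j)\<close> has
  \<open>j - 2 * i = 2 * tau - sigma\<close>. Over one Kauffman state, the largest value of
  \<open>e * (j - 2 * i)\<close> is therefore twice the number of circles minus
  \<open>e * sigma\<close>. Turning one marker from \<open>e\<close> to \<open>-e\<close> raises
  this maximum by 0 if two circles merge and by 4 if one circle splits. A free crossing in
  \<open>K\<close> carries an allowance of 4 that pays for a possible split; this is the origin of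
  \<open>4 * k\<close>. A splitting crossing outside \<open>K\<close> has no allowance. There the
  surplus of 4 is recovered at the leaf circle, which survives the cancellation only with the sign
  \<open>-e\<close> instead of the optimal \<open>e\<close>. Hence the induction has to carry
  circles with prescribed signs.

  The cancellation requires the leaf crossing to split in every state of the subcube, whereas the
  case distinction only looks at the extreme state. Monotonicity of splitting bridges this gap, but
  only between states with the same markers in \<open>K\<close>; so a leaf is sought only when no
  crossing of \<open>K\<close> is free any more.\<close>

locale graded_complex =
  fixes G :: "int \<Rightarrow> 'a set" and c :: "'a \<Rightarrow> 'a \<Rightarrow> int"
  assumes finite_grade: "finite (G i)"
    and square_zero: "S \<in> G i \<Longrightarrow> S'' \<in> G (i - 4) \<Longrightarrow> (\<Sum>S' \<in> G (i - 2). c S S' * c S' S'') = 0"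
begin

definition bd :: "'a set \<Rightarrow> int \<Rightarrow> ('a \<Rightarrow> int) \<Rightarrow> 'a \<Rightarrow> int" where
  "bd X i z S' = (\<Sum>S \<in> X \<inter> G i. z S * c S S')"

text \<open>The homology of the subquotient spanned by \<open>X\<close> vanishes in degree \<open>i\<close> with coefficients
  \<open>\<int>/m\<close> (with coefficients \<open>\<int>\<close> for \<open>m = 0\<close>).\<close>

definition exact_at :: "int \<Rightarrow> 'a set \<Rightarrow> int \<Rightarrow> bool" where
  "exact_at m X i \<longleftrightarrow>
     (\<forall>z. (\<forall>S' \<in> X \<inter> G (i - 2). m dvd bd X i z S') \<longrightarrow>
          (\<exists>y. \<forall>S \<in> X \<inter> G i. m dvd z S - bd X (i + 2) y S))"

text \<open>This is what makes the span of \<open>X\<close> a subquotient complex: no two-step path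
  between members of \<open>X\<close> leaves \<open>X\<close>, so the restricted boundary map still
  squares to zero.\<close>

definition convex_set :: "'a set \<Rightarrow> bool" where
  "convex_set X \<longleftrightarrow> (\<forall>i S S' S''. S \<in> X \<inter> G i \<longrightarrow> S' \<in> G (i - 2) \<longrightarrow> S'' \<in> X \<inter> G (i - 4) \<longrightarrow>
     c S S' \<noteq> 0 \<longrightarrow> c S' S'' \<noteq> 0 \<longrightarrow> S' \<in> X)"

lemma bd_add: "bd X i (\<lambda>S. y S + z S) S' = bd X i y S' + bd X i z S'"
  by (simp add: bd_def sum.distrib ring_distribs)

lemma bd_diff: "bd X i (\<lambda>S. y S - z S) S' = bd X i y S' - bd X i z S'"
  by (simp add: bd_def sum_subtractf ring_distribs)

lemma bd_cong: "(\<And>S. S \<in> X \<inter> G i \<Longrightarrow> y S = z S) \<Longrightarrow> bd X i y S' = bd X i z S'"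
  by (simp add: bd_def)

lemma bd_dvd: "(\<And>S. S \<in> X \<inter> G i \<Longrightarrow> m dvd z S) \<Longrightarrow> m dvd bd X i z S'"
  unfolding bd_def by (intro dvd_sum) auto

lemma bd_bd:
  assumes "convex_set X" "S'' \<in> X \<inter> G (i - 2)"
  shows "bd X i (bd X (i + 2) y) S'' = 0"
proof -
  have *: "(\<Sum>S' \<in> X \<inter> G i. c S S' * c S' S'') = 0" if S: "S \<in> X \<inter> G (i + 2)" for S
  proof -
    have "(\<Sum>S' \<in> X \<inter> G i. c S S' * c S' S'') = (\<Sum>S' \<in> G i. c S S' * c S' S'')"
    proof (rule sum.mono_neutral_left)
      show "\<forall>S' \<in> G i - X \<inter> G i. c S S' * c S' S'' = 0"
      proof
        fix S' assume S': "S' \<in> G i - X \<inter> G i"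
        then have "c S S' = 0 \<or> c S' S'' = 0"
          using assms(1)[unfolded convex_set_def, rule_format, of S "i + 2" S' S''] S assms(2)
          by auto
        then show "c S S' * c S' S'' = 0" by auto
      qed
    qed (auto simp: finite_grade)
    also have "\<dots> = 0"
      using square_zero[of S "i + 2" S''] S assms(2) by simp
    finally show ?thesis .
  qed
  have "bd X i (bd X (i + 2) y) S'' = (\<Sum>S' \<in> X \<inter> G i. \<Sum>S \<in> X \<inter> G (i + 2). y S * (c S S' * c S' S''))"
    by (simp add: bd_def sum_distrib_right mult.assoc)
  also have "\<dots> = (\<Sum>S \<in> X \<inter> G (i + 2). y S * (\<Sum>S' \<in> X \<inter> G i. c S S' * c S' S''))"
    by (subst sum.swap) (simp add: sum_distrib_left)
  also have "\<dots> = 0" using * by simp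
  finally show ?thesis .
qed

lemma bd_Un:
  assumes "A \<inter> B = {}"
  shows "bd (A \<union> B) i z S' = bd A i z S' + bd B i z S'"
  unfolding bd_def Int_Un_distrib2 using assms
  by (intro sum.union_disjoint) (auto simp: finite_grade)

lemma bd_zero: "(\<And>S. S \<in> A \<inter> G i \<Longrightarrow> z S * c S S' = 0) \<Longrightarrow> bd A i z S' = 0"
  unfolding bd_def by (rule sum.neutral) auto

text \<open>\<open>B\<close> spans a subcomplex and \<open>A\<close> the corresponding quotient. A
  path that starts and ends in one part and passes through the other would have to use a coefficient
  from \<open>B\<close> to \<open>A\<close>.\<close>

lemma convex_set_parts:
  assumes "convex_set (A \<union> B)" "A \<inter> B = {}"
    and BA: "\<And>i S S'. S \<in> B \<inter> G i \<Longrightarrow> S' \<in> A \<inter> G (i - 2) \<Longrightarrow> c S S' = 0"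
  shows "convex_set A" "convex_set B"
proof -
  have step: "S' \<in> A \<union> B" if "S \<in> (A \<union> B) \<inter> G i" "S' \<in> G (i - 2)" "S'' \<in> (A \<union> B) \<inter> G (i - 4)"
      "c S S' \<noteq> 0" "c S' S'' \<noteq> 0" for i S S' S''
    using assms(1) that unfolding convex_set_def by blast
  show "convex_set A"
    unfolding convex_set_def
  proof (intro allI impI)
    fix i S S' S''
    assume a: "S \<in> A \<inter> G i" "S' \<in> G (i - 2)" "S'' \<in> A \<inter> G (i - 4)" "c S S' \<noteq> 0" "c S' S'' \<noteq> 0"
    moreover have "i - 2 - 2 = i - 4" by simp
    ultimately have "S' \<notin> B" using BA[of S' "i - 2" S''] by auto
    moreover have "S' \<in> A \<union> B" using step[of S i S' S''] a by blast
    ultimately show "S' \<in> A" by blast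
  qed
  show "convex_set B"
    unfolding convex_set_def
  proof (intro allI impI)
    fix i S S' S''
    assume a: "S \<in> B \<inter> G i" "S' \<in> G (i - 2)" "S'' \<in> B \<inter> G (i - 4)" "c S S' \<noteq> 0" "c S' S'' \<noteq> 0"
    then have "S' \<notin> A" using BA[of S i S'] by auto
    moreover have "S' \<in> A \<union> B" using step[of S i S' S''] a by blast
    ultimately show "S' \<in> B" by blast
  qed
qed

text \<open>This is exactness at the middle term of the long exact sequence of the subcomplex
  \<open>B\<close> and the quotient \<open>A\<close>, carried out on chains.\<close>

lemma exact_at_Un:
  assumes conv: "convex_set (A \<union> B)" and disj: "A \<inter> B = {}"
    and BA: "\<And>i S S'. S \<in> B \<inter> G i \<Longrightarrow> S' \<in> A \<inter> G (i - 2) \<Longrightarrow> c S S' = 0"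
    and A: "exact_at m A i" and B: "exact_at m B i"
  shows "exact_at m (A \<union> B) i"
  unfolding exact_at_def
proof (intro allI impI)
  fix z assume z: "\<forall>S' \<in> (A \<union> B) \<inter> G (i - 2). m dvd bd (A \<union> B) i z S'"
  have bdA: "bd (A \<union> B) i z S' = bd A i z S'" if "S' \<in> A \<inter> G (i - 2)" for i z S'
    using bd_zero[of B i z S'] BA[of _ i S'] that by (simp add: bd_Un[OF disj])
  obtain y where y: "\<forall>S \<in> A \<inter> G i. m dvd z S - bd A (i + 2) y S"
    using A z bdA unfolding exact_at_def by (metis IntE IntI UnCI)
  define y1 where "y1 S = (if S \<in> A then y S else 0)" for S
  \<comment> \<open>A primitive of the \<open>A\<close>-part, extended by 0, is subtracted. The
    difference is still a cycle mod \<open>m\<close> and vanishes mod \<open>m\<close> on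
    \<open>A\<close>, so its \<open>B\<close>-part is a cycle by itself.\<close>
  define u where "u S = z S - bd (A \<union> B) (i + 2) y1 S" for S
  have uA: "m dvd u S" if "S \<in> A \<inter> G i" for S
  proof -
    have "bd (A \<union> B) (i + 2) y1 S = bd A (i + 2) y1 S" using bdA[of S "i + 2" y1] that by simp
    also have "\<dots> = bd A (i + 2) y S" by (rule bd_cong) (simp add: y1_def)
    finally show ?thesis using y that by (simp add: u_def)
  qed
  have uB: "m dvd bd B i u S'" if S': "S' \<in> B \<inter> G (i - 2)" for S'
  proof -
    have "bd (A \<union> B) i u S' = bd (A \<union> B) i z S' - bd (A \<union> B) i (bd (A \<union> B) (i + 2) y1) S'"
      unfolding u_def by (rule bd_diff)
    also have "\<dots> = bd (A \<union> B) i z S'"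
      using bd_bd[OF conv] S' by simp
    finally have "m dvd bd (A \<union> B) i u S'" using z S' by simp
    moreover have "m dvd bd A i u S'" using uA by (rule bd_dvd)
    ultimately show ?thesis by (simp add: bd_Un[OF disj] dvd_add_right_iff)
  qed
  obtain y' where y': "\<forall>S \<in> B \<inter> G i. m dvd u S - bd B (i + 2) y' S"
    using B uB unfolding exact_at_def by blast
  define y2 where "y2 S = (if S \<in> B then y' S else 0)" for S
  show "\<exists>y. \<forall>S \<in> (A \<union> B) \<inter> G i. m dvd z S - bd (A \<union> B) (i + 2) y S"
  proof (intro exI[of _ "\<lambda>S. y1 S + y2 S"] ballI)
    fix S assume S: "S \<in> (A \<union> B) \<inter> G i"
    have eq: "z S - bd (A \<union> B) (i + 2) (\<lambda>S. y1 S + y2 S) S = u S - bd (A \<union> B) (i + 2) y2 S"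
      by (simp add: bd_add u_def)
    have y2A: "bd A (i + 2) y2 S = 0" using disj by (intro bd_zero) (auto simp: y2_def)
    have y2B: "bd B (i + 2) y2 S = bd B (i + 2) y' S" by (rule bd_cong) (simp add: y2_def)
    show "m dvd z S - bd (A \<union> B) (i + 2) (\<lambda>S. y1 S + y2 S) S"
    proof (cases "S \<in> A")
      case True
      have "bd B (i + 2) y2 S = 0" using BA[of _ "i + 2" S] True S by (intro bd_zero) auto
      then show ?thesis unfolding eq using uA True S by (simp add: bd_Un[OF disj] y2A)
    next
      case False
      then show ?thesis unfolding eq using y' S by (simp add: bd_Un[OF disj] y2A y2B)
    qed
  qed
qed

text \<open>The part of the boundary map leading from \<open>A\<close> to \<open>B\<close> is a
  signed permutation matrix. The complex is thus the cone of an isomorphism and acyclic over every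
  coefficient ring, although neither \<open>A\<close> nor \<open>B\<close> need be.\<close>

lemma exact_at_matching:
  assumes conv: "convex_set (A \<union> B)" and disj: "A \<inter> B = {}"
    and BA: "\<And>i S S'. S \<in> B \<inter> G i \<Longrightarrow> S' \<in> A \<inter> G (i - 2) \<Longrightarrow> c S S' = 0"
    and AB: "\<And>i S. S \<in> A \<inter> G i \<Longrightarrow> \<exists>!S'. S' \<in> B \<inter> G (i - 2) \<and> c S S' \<noteq> 0"
    and BA': "\<And>i S'. S' \<in> B \<inter> G (i - 2) \<Longrightarrow> \<exists>!S. S \<in> A \<inter> G i \<and> c S S' \<noteq> 0"
    and unit: "\<And>i S S'. S \<in> A \<inter> G i \<Longrightarrow> S' \<in> B \<inter> G (i - 2) \<Longrightarrow> c S S' \<noteq> 0 \<Longrightarrow> \<bar>c S S'\<bar> = 1"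
  shows "exact_at m (A \<union> B) i"
  unfolding exact_at_def
proof (intro allI impI)
  fix z assume z: "\<forall>S' \<in> (A \<union> B) \<inter> G (i - 2). m dvd bd (A \<union> B) i z S'"
  have bd_match: "bd A i z b = z a * c a b"
    if "a \<in> A \<inter> G i" "b \<in> B \<inter> G (i - 2)" "c a b \<noteq> 0" for a b i z
  proof -
    have "bd A i z b = (\<Sum>S \<in> {a}. z S * c S b)"
      unfolding bd_def using that BA'[of b i]
      by (intro sum.mono_neutral_right) (auto simp: finite_grade)
    then show ?thesis by simp
  qed
  define \<phi> where "\<phi> a = (THE b. b \<in> B \<inter> G i \<and> c a b \<noteq> 0)" for a
  have \<phi>: "\<phi> a = b" if "a \<in> A \<inter> G (i + 2)" "b \<in> B \<inter> G i" "c a b \<noteq> 0" for a b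
    unfolding \<phi>_def using AB[of a "i + 2"] that by (intro the1_equality) auto
  \<comment> \<open>A sign is its own inverse, so the boundary of this chain on \<open>A\<close>
    agrees with \<open>z\<close> on all of \<open>B\<close>. After subtracting it, a cycle supported
    on \<open>A\<close> remains, and the matching makes its coefficients vanish mod \<open>m\<close>
    one by one.\<close>
  define y where "y S = (if S \<in> A then c S (\<phi> S) * z (\<phi> S) else 0)" for S
  define u where "u S = z S - bd (A \<union> B) (i + 2) y S" for S
  have y: "bd B (i + 2) y S = 0" for S using disj by (intro bd_zero) (auto simp: y_def)
  have uB: "u b = 0" if b: "b \<in> B \<inter> G i" for b
  proof -
    obtain a where a: "a \<in> A \<inter> G (i + 2)" "c a b \<noteq> 0" using BA'[of b "i + 2"] b by auto
    have "bd A (i + 2) y b = y a * c a b" using bd_match[of a "i + 2" b] a b by simp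
    also have "\<dots> = z b * (c a b * c a b)" using \<phi>[of a b] a b by (simp add: y_def)
    also have "c a b * c a b = 1"
      using unit[of a "i + 2" b] a b by (auto simp: abs_if split: if_splits)
    finally show ?thesis by (simp add: u_def bd_Un[OF disj] y)
  qed
  have uA: "m dvd u a" if a: "a \<in> A \<inter> G i" for a
  proof -
    obtain b where b: "b \<in> B \<inter> G (i - 2)" "c a b \<noteq> 0" using AB[of a i] a by auto
    have "bd (A \<union> B) i u b = bd (A \<union> B) i z b - bd (A \<union> B) i (bd (A \<union> B) (i + 2) y) b"
      unfolding u_def by (rule bd_diff)
    also have "\<dots> = bd (A \<union> B) i z b"
      using bd_bd[OF conv] b by simp
    finally have "m dvd bd (A \<union> B) i u b" using z b by simp
    moreover have "bd B i u b = 0" using uB by (intro bd_zero) auto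
    ultimately have "m dvd u a * c a b" using bd_match[of a i b u] a b by (simp add: bd_Un[OF disj])
    then show ?thesis using unit[of a i b] a b by (auto simp: abs_if split: if_splits)
  qed
  show "\<exists>y. \<forall>S \<in> (A \<union> B) \<inter> G i. m dvd z S - bd (A \<union> B) (i + 2) y S"
    using uA uB by (intro exI[of _ y]) (auto simp: u_def[symmetric])
qed

lemma exact_at_empty: "X \<inter> G i = {} \<Longrightarrow> exact_at m X i"
  by (simp add: exact_at_def)

end

section \<open>Generated equivalence relations\<close>

definition generated_equiv :: "'a set \<Rightarrow> ('a \<times> 'a) set \<Rightarrow> ('a \<times> 'a) set" where
  "generated_equiv A R = ((R \<inter> A \<times> A) \<union> (R \<inter> A \<times> A)\<inverse>)\<^sup>*"

lemma generated_classes_eq: "generated_classes A R = A // generated_equiv A R"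
  by (simp add: generated_classes_def generated_equiv_def)

lemma generated_equiv_refl [simp]: "(x, x) \<in> generated_equiv A R"
  by (simp add: generated_equiv_def)

lemma generated_equiv_sym: "(x, y) \<in> generated_equiv A R \<Longrightarrow> (y, x) \<in> generated_equiv A R"
  unfolding generated_equiv_def by (rule symD[OF sym_rtrancl]) (auto simp: sym_def)

lemma generated_equiv_trans:
  "(x, y) \<in> generated_equiv A R \<Longrightarrow> (y, z) \<in> generated_equiv A R \<Longrightarrow> (x, z) \<in> generated_equiv A R"
  unfolding generated_equiv_def by (rule rtrancl_trans)

lemma generated_equiv_base:
  "(x, y) \<in> R \<Longrightarrow> x \<in> A \<Longrightarrow> y \<in> A \<Longrightarrow> (x, y) \<in> generated_equiv A R"
  unfolding generated_equiv_def by blast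

lemma generated_equiv_induct [consumes 1, case_names refl step]:
  assumes "(x, y) \<in> generated_equiv A R" "P x"
    and "\<And>a b. P a \<Longrightarrow> a \<in> A \<Longrightarrow> b \<in> A \<Longrightarrow> (a, b) \<in> R \<or> (b, a) \<in> R \<Longrightarrow> (x, a) \<in> generated_equiv A R \<Longrightarrow> P b"
  shows "P y"
  using assms(1) unfolding generated_equiv_def
proof (induction rule: rtrancl_induct)
  case base
  then show ?case by (rule assms(2))
next
  case (step a b)
  then show ?case using assms(3)[of a b] unfolding generated_equiv_def by blast
qed

lemma generated_equiv_closed: "(x, y) \<in> generated_equiv A R \<Longrightarrow> x \<in> A \<Longrightarrow> y \<in> A"
  by (induction rule: generated_equiv_induct) auto

lemma generated_equiv_invariant:
  assumes "(x, y) \<in> generated_equiv A R"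
    and "\<And>a b. (a, b) \<in> R \<Longrightarrow> a \<in> A \<Longrightarrow> b \<in> A \<Longrightarrow> h a = h b"
  shows "h x = h y"
  using assms(1) by (induction rule: generated_equiv_induct) (auto dest: assms(2))

lemma generated_equiv_le:
  assumes "(x, y) \<in> generated_equiv A R"
    and "\<And>a b. (a, b) \<in> R \<Longrightarrow> a \<in> A \<Longrightarrow> b \<in> A \<Longrightarrow> (a, b) \<in> generated_equiv A R'"
  shows "(x, y) \<in> generated_equiv A R'"
  using assms(1)
proof (induction rule: generated_equiv_induct)
  case (step a b)
  then have "(a, b) \<in> generated_equiv A R'"
    using assms(2) generated_equiv_sym by metis
  then show ?case using step(1) generated_equiv_trans by metis
qed simp

lemma generated_equiv_mono:
  "(x, y) \<in> generated_equiv A R \<Longrightarrow> R \<subseteq> R' \<Longrightarrow> (x, y) \<in> generated_equiv A R'"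
  by (erule generated_equiv_le) (auto intro: generated_equiv_base)

abbreviation generated_class :: "'a set \<Rightarrow> ('a \<times> 'a) set \<Rightarrow> 'a \<Rightarrow> 'a set" where
  "generated_class A R x \<equiv> generated_equiv A R `` {x}"

lemma generated_class_eq_iff: "generated_class A R x = generated_class A R y \<longleftrightarrow> (x, y) \<in> generated_equiv A R"
proof
  assume "generated_class A R x = generated_class A R y"
  then have "y \<in> generated_class A R x" by simp
  then show "(x, y) \<in> generated_equiv A R" by blast
next
  assume xy: "(x, y) \<in> generated_equiv A R"
  have "(x, z) \<in> generated_equiv A R \<longleftrightarrow> (y, z) \<in> generated_equiv A R" for z
    using generated_equiv_trans[OF xy] generated_equiv_trans[OF generated_equiv_sym[OF xy]] by blast
  then show "generated_class A R x = generated_class A R y" by auto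
qed

lemma generated_class_eqI: "y \<in> generated_class A R x \<Longrightarrow> generated_class A R x = generated_class A R y"
  unfolding generated_class_eq_iff by simp

lemma generated_classes_image: "generated_classes A R = generated_class A R ` A"
  by (auto simp: generated_classes_eq quotient_def)

lemma finite_generated_classes: "finite A \<Longrightarrow> finite (generated_classes A R)"
  by (simp add: generated_classes_image)

lemma card_generated_classes:
  assumes "\<And>x y. x \<in> A \<Longrightarrow> y \<in> A \<Longrightarrow> (x, y) \<in> generated_equiv A R \<longleftrightarrow> h x = h y"
  shows "card (generated_classes A R) = card (h ` A)"
proof -
  define g where "g X = h (SOME x. x \<in> A \<and> generated_class A R x = X)" for X
  have g: "g (generated_class A R x) = h x" if "x \<in> A" for x
  proof -
    define y where "y = (SOME y. y \<in> A \<and> generated_class A R y = generated_class A R x)"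
    have "y \<in> A \<and> generated_class A R y = generated_class A R x"
      unfolding y_def by (rule someI[of _ x]) (use that in blast)
    then have "h y = h x" using assms[of y x] that generated_class_eq_iff[of A R y x] by simp
    then show ?thesis by (simp add: g_def y_def)
  qed
  have "bij_betw g (generated_class A R ` A) (h ` A)"
    unfolding bij_betw_def
  proof
    show "inj_on g (generated_class A R ` A)"
    proof (rule inj_onI)
      fix X Y assume XY: "X \<in> generated_class A R ` A" "Y \<in> generated_class A R ` A" "g X = g Y"
      obtain x where x: "x \<in> A" "X = generated_class A R x" using XY(1) by blast
      obtain y where y: "y \<in> A" "Y = generated_class A R y" using XY(2) by blast
      have "h x = h y" using XY(3) g x y by metis
      then show "X = Y" using assms[of x y] generated_class_eq_iff[of A R x y] x y by simp
    qed
    show "g ` generated_class A R ` A = h ` A"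
      using g by (auto simp: image_image)
  qed
  then show ?thesis unfolding generated_classes_image by (rule bij_betw_same_card)
qed

lemma card_generated_classes_insert:
  assumes "finite A" "a \<in> A" "b \<in> A"
  shows "card (generated_classes A R) = card (generated_classes A (insert (a, b) R)) +
    (if (a, b) \<in> generated_equiv A R then 0 else 1)"
proof -
  define R' where "R' = insert (a, b) R"
  \<comment> \<open>A complete invariant of the enlarged relation: the class of \<open>b\<close> is
    renamed to the class of \<open>a\<close>. Its image lacks exactly one old class if the two were
    different.\<close>
  define h where "h x = (if (x, b) \<in> generated_equiv A R then generated_class A R a else generated_class A R x)" for x
  have RR': "(x, y) \<in> generated_equiv A R'" if "(x, y) \<in> generated_equiv A R" for x y
    using that by (rule generated_equiv_mono) (auto simp: R'_def)
  have ab: "(a, b) \<in> generated_equiv A R'"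
    using assms by (intro generated_equiv_base) (auto simp: R'_def)
  have hx: "\<exists>x'. (x, x') \<in> generated_equiv A R' \<and> h x = generated_class A R x'" for x
  proof (cases "(x, b) \<in> generated_equiv A R")
    case True
    then have "(x, a) \<in> generated_equiv A R'"
      using RR' ab generated_equiv_sym generated_equiv_trans by metis
    then show ?thesis using True by (auto simp: h_def)
  next
    case False
    then show ?thesis by (intro exI[of _ x]) (simp add: h_def)
  qed
  have h: "(x, y) \<in> generated_equiv A R' \<longleftrightarrow> h x = h y" for x y
  proof
    assume "(x, y) \<in> generated_equiv A R'"
    then show "h x = h y"
    proof (rule generated_equiv_invariant)
      fix u v assume uv: "(u, v) \<in> R'" "u \<in> A" "v \<in> A"
      show "h u = h v"
      proof (cases "(u, v) \<in> R")
        case True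
        then have "(u, v) \<in> generated_equiv A R" using uv by (intro generated_equiv_base)
        then show ?thesis unfolding h_def
          by (metis generated_class_eq_iff generated_equiv_sym generated_equiv_trans)
      next
        case False
        then show ?thesis using uv by (auto simp: R'_def h_def)
      qed
    qed
  next
    assume "h x = h y"
    then show "(x, y) \<in> generated_equiv A R'"
      using hx[of x] hx[of y] by (metis RR' generated_class_eq_iff generated_equiv_sym generated_equiv_trans)
  qed
  have "card (generated_classes A R') = card (h ` A)"
    by (rule card_generated_classes) (use h in auto)
  also have "h ` A = (if (a, b) \<in> generated_equiv A R then generated_class A R ` A
      else generated_class A R ` A - {generated_class A R b})"
  proof (cases "(a, b) \<in> generated_equiv A R")
    case True
    then have "h x = generated_class A R x" for x
      unfolding h_def by (metis generated_class_eq_iff generated_equiv_sym generated_equiv_trans)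
    then show ?thesis using True by simp
  next
    case False
    have "h ` A = generated_class A R ` A - {generated_class A R b}"
    proof
      show "h ` A \<subseteq> generated_class A R ` A - {generated_class A R b}"
      proof
        fix X assume "X \<in> h ` A"
        then obtain x where x: "x \<in> A" "X = h x" by blast
        show "X \<in> generated_class A R ` A - {generated_class A R b}"
        proof (cases "(x, b) \<in> generated_equiv A R")
          case True
          then have "X = generated_class A R a" using x by (simp add: h_def)
          then show ?thesis using False assms generated_class_eq_iff[of A R a b] by blast
        next
          case xb: False
          then have "X = generated_class A R x" using x by (simp add: h_def)
          then show ?thesis using x xb generated_class_eq_iff[of A R x b] by blast
        qed
      qed
      show "generated_class A R ` A - {generated_class A R b} \<subseteq> h ` A"
      proof
        fix X assume "X \<in> generated_class A R ` A - {generated_class A R b}"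
        then obtain x where x: "x \<in> A" "X = generated_class A R x" "generated_class A R x \<noteq> generated_class A R b" by auto
        then have "h x = X" by (simp add: h_def generated_class_eq_iff)
        then show "X \<in> h ` A" using x by blast
      qed
    qed
    then show ?thesis using False by simp
  qed
  finally have eq: "card (generated_classes A R') = card (if (a, b) \<in> generated_equiv A R
      then generated_class A R ` A else generated_class A R ` A - {generated_class A R b})" .
  show ?thesis
  proof (cases "(a, b) \<in> generated_equiv A R")
    case True
    then show ?thesis using eq by (simp add: R'_def generated_classes_image)
  next
    case False
    have "card (generated_class A R ` A) > 0" using assms by (auto simp: card_gt_0_iff)
    moreover have "card (generated_classes A R') = card (generated_class A R ` A) - 1"
      using eq False assms by simp
    ultimately show ?thesis using False
      unfolding R'_def[symmetric] generated_classes_image[of A R] by simp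
  qed
qed

text \<open>Every step of a chain leaving \<open>x\<close> has an end in the class of
  \<open>x\<close>, so pairs away from that class cannot influence it. This gives the locality of
  circles under a marker change.\<close>

lemma generated_class_cong:
  assumes "x \<in> A"
    and "\<And>a b. a \<in> generated_class A R x \<Longrightarrow> b \<in> A \<Longrightarrow>
      ((a, b) \<in> R \<longleftrightarrow> (a, b) \<in> R') \<and> ((b, a) \<in> R \<longleftrightarrow> (b, a) \<in> R')"
  shows "generated_class A R' x = generated_class A R x"
proof
  show "generated_class A R' x \<subseteq> generated_class A R x"
  proof
    fix y assume "y \<in> generated_class A R' x"
    then have "(x, y) \<in> generated_equiv A R'" by simp
    then show "y \<in> generated_class A R x"
    proof (induction rule: generated_equiv_induct)
      case (step a b)
      then have "(a, b) \<in> R \<or> (b, a) \<in> R" using assms(2) by blast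
      then have "(a, b) \<in> generated_equiv A R"
        using step generated_equiv_base generated_equiv_sym by metis
      then show ?case using step(1) generated_equiv_trans by (metis Image_singleton_iff)
    qed simp
  qed
  show "generated_class A R x \<subseteq> generated_class A R' x"
  proof
    fix y assume "y \<in> generated_class A R x"
    then have "(x, y) \<in> generated_equiv A R" by simp
    then show "y \<in> generated_class A R' x"
    proof (induction rule: generated_equiv_induct)
      case (step a b)
      then have "(a, b) \<in> R' \<or> (b, a) \<in> R'" using assms(2)[of a b] by auto
      then have "(a, b) \<in> generated_equiv A R'"
        using step generated_equiv_base generated_equiv_sym by metis
      then show ?case using step(1) generated_equiv_trans by (metis Image_singleton_iff)
    qed simp
  qed
qed

lemma even_card_involution:
  assumes "finite X" "\<And>x. x \<in> X \<Longrightarrow> f x \<in> X \<and> f x \<noteq> x \<and> f (f x) = x"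
  shows "even (card X)"
  using assms
proof (induction X rule: finite_psubset_induct)
  case (psubset X)
  show ?case
  proof (cases "X = {}")
    case False
    then obtain x where x: "x \<in> X" by auto
    define Y where "Y = X - {x, f x}"
    have "even (card Y)"
    proof (rule psubset.IH)
      show "Y \<subset> X" using x by (auto simp: Y_def)
      fix y assume "y \<in> Y"
      then show "f y \<in> Y \<and> f y \<noteq> y \<and> f (f y) = y"
        using psubset.prems[of y] psubset.prems[of x] x by (auto simp: Y_def)
    qed
    moreover have "card X = card Y + 2"
    proof -
      have "card {x, f x} = 2" using psubset.prems[OF x] by (auto simp: card_insert_if)
      moreover have "card (Y \<union> {x, f x}) = card Y + card {x, f x}"
        unfolding Y_def using psubset.hyps(1) by (intro card_Un_disjoint) auto
      moreover have "Y \<union> {x, f x} = X" using psubset.prems[OF x] x by (auto simp: Y_def)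
      ultimately show ?thesis by simp
    qed
    ultimately show ?thesis by simp
  qed simp
qed

section \<open>The circles of an alternating planar diagram\<close>

locale alternating_map =
  fixes E :: diagram
  assumes mate: "d \<in> darts E \<Longrightarrow> mate E d \<in> darts E \<and> mate E d \<noteq> d \<and> mate E (mate E d) = d"
    and planar: "int (ncross E) - 2 * int (ncross E) + int (card (faces E)) = 2 * int (card (graph_components E))"
    and alt: "alternating E"
begin

text \<open>A state is given here by its set \<open>H\<close> of negative markers.\<close>

definition arc :: "nat set \<Rightarrow> dart \<Rightarrow> dart" where
  "arc H d = (case d of (c, p) \<Rightarrow>
     (c, if (c \<notin> H) = over E c then 3 - p else if even p then p + 1 else p - 1))"

definition arcs :: "nat set \<Rightarrow> (dart \<times> dart) set" where
  "arcs H = {(d, mate E d) | d. d \<in> darts E} \<union> {(d, arc H d) | d. d \<in> darts E}"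

text \<open>The discs bounded by the circles of the positive state, with bands attached at the crossings in \<open>H\<close>.\<close>

definition glued_arcs :: "nat set \<Rightarrow> (dart \<times> dart) set" where
  "glued_arcs H = arcs {} \<union> {((c, 0), (c, 2)) | c. c \<in> H}"

abbreviation joined :: "nat set \<Rightarrow> dart \<Rightarrow> dart \<Rightarrow> bool" where
  "joined H d d' \<equiv> (d, d') \<in> generated_equiv (darts E) (arcs H)"

abbreviation glued :: "nat set \<Rightarrow> dart \<Rightarrow> dart \<Rightarrow> bool" where
  "glued H d d' \<equiv> (d, d') \<in> generated_equiv (darts E) (glued_arcs H)"

definition ncircles :: "nat set \<Rightarrow> nat" where
  "ncircles H = card (generated_classes (darts E) (arcs H))"

definition nglued :: "nat set \<Rightarrow> nat" where
  "nglued H = card (generated_classes (darts E) (glued_arcs H))"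

lemma finite_darts: "finite (darts E)"
  by (simp add: darts_def)

lemma dart_cases:
  assumes "d \<in> darts E"
  obtains c where "c < ncross E" "d = (c, 0)" | c where "c < ncross E" "d = (c, 1)"
    | c where "c < ncross E" "d = (c, 2)" | c where "c < ncross E" "d = (c, 3)"
proof -
  obtain c p where cp: "d = (c, p)" by (cases d)
  then have "c < ncross E" "p < 4" using assms by (auto simp: darts_def)
  moreover from this(2) have "p = 0 \<or> p = 1 \<or> p = 2 \<or> p = 3" by auto
  ultimately show thesis using that cp by blast
qed

lemma dart_iff [simp]: "(c, p) \<in> darts E \<longleftrightarrow> c < ncross E \<and> p < 4"
  by (auto simp: darts_def)

lemma arc: "d \<in> darts E \<Longrightarrow> arc H d \<in> darts E \<and> arc H d \<noteq> d \<and> arc H (arc H d) = d"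
  by (erule dart_cases) (auto simp: arc_def)

lemma fst_arc [simp]: "fst (arc H d) = fst d"
  by (simp add: arc_def split: prod.split)

lemma arc_cong: "(fst d \<in> H \<longleftrightarrow> fst d \<in> H') \<Longrightarrow> arc H d = arc H' d"
  by (cases d) (auto simp: arc_def)

lemma arcs_iff: "(a, b) \<in> arcs H \<longleftrightarrow> a \<in> darts E \<and> (b = mate E a \<or> b = arc H a)"
  unfolding arcs_def by blast

lemma glued_arcs_mono: "H \<subseteq> H' \<Longrightarrow> glued_arcs H \<subseteq> glued_arcs H'"
  unfolding glued_arcs_def by blast

lemma arcs_empty_subset: "arcs {} \<subseteq> glued_arcs H"
  unfolding glued_arcs_def by blast

lemma joined_mate: "d \<in> darts E \<Longrightarrow> joined H d (mate E d)"
  using mate by (intro generated_equiv_base) (simp_all add: arcs_iff)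

lemma joined_arc: "d \<in> darts E \<Longrightarrow> joined H d (arc H d)"
  using arc by (intro generated_equiv_base) (simp_all add: arcs_iff)

lemma joined_at_crossing:
  assumes "v < ncross E"
  shows "joined H (v, 0) (v, if (v \<notin> H) = over E v then 3 else 1)"
    and "joined H (v, 2) (v, if (v \<notin> H) = over E v then 1 else 3)"
  using joined_arc[of "(v, 0)" H] joined_arc[of "(v, 2)" H] assms
  by (auto simp: arc_def split: if_splits)

text \<open>Without the arcs at \<open>v\<close>, the circles fall into closed circles and paths, and so the
  four darts at \<open>v\<close> are paired up.\<close>

lemma joined_or_joined_insert:
  assumes v: "v < ncross E" "v \<notin> H"
  shows "joined H (v, 0) (v, 2) \<or> joined (insert v H) (v, 0) (v, 2)"
proof (rule ccontr)
  assume not: "\<not> ?thesis"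
  \<comment> \<open>With the arcs at \<open>v\<close> removed, \<open>X\<close> is the path that
    starts at \<open>(v, 0)\<close>. If it ended nowhere else at \<open>v\<close>, then
    \<open>mate\<close> would pair off \<open>X\<close>, while the arcs would pair off
    \<open>X\<close> without \<open>(v, 0)\<close>; the parities are incompatible.\<close>
  define R where "R = {(a, b). a \<in> darts E \<and> (b = mate E a \<or> b = arc H a \<and> fst a \<noteq> v)}"
  define X where "X = {d \<in> darts E. ((v, 0), d) \<in> generated_equiv (darts E) R}"
  have RH: "joined H d d'" "joined (insert v H) d d'" if "(d, d') \<in> generated_equiv (darts E) R" for d d'
    using that arc_cong[of _ H "insert v H"]
    by (fastforce elim!: generated_equiv_mono simp del: dart_iff simp: R_def arcs_iff)+
  have base: "d' \<in> X" if "d \<in> X" "(d, d') \<in> R" "d' \<in> darts E" for d d'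
    using that generated_equiv_trans[of "(v, 0)" d "darts E" R d'] generated_equiv_base[of d d' R "darts E"]
    by (auto simp: X_def)
  have fin: "finite X" by (simp add: X_def finite_darts)
  have "even (card X)"
  proof (rule even_card_involution[OF fin])
    fix d assume d: "d \<in> X"
    then have "d \<in> darts E" by (simp add: X_def)
    then show "mate E d \<in> X \<and> mate E d \<noteq> d \<and> mate E (mate E d) = d"
      using base[OF d, of "mate E d"] mate by (auto simp: R_def)
  qed
  \<comment> \<open>In one of the two states \<open>(v, 2)\<close> shares an arc with
    \<open>(v, 1)\<close>, in the other with \<open>(v, 3)\<close>. A path from
    \<open>(v, 0)\<close> to any of these darts avoids the arcs at \<open>v\<close>, hence exists in
    both states and joins \<open>(v, 0)\<close> to \<open>(v, 2)\<close> in one of them.\<close>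
  have notX: "(v, q) \<notin> X" if "joined H (v, 2) (v, q) \<or> joined (insert v H) (v, 2) (v, q)" for q
  proof
    assume "(v, q) \<in> X"
    then have "joined H (v, 0) (v, q)" "joined (insert v H) (v, 0) (v, q)"
      using RH by (simp_all add: X_def)
    then show False using that not generated_equiv_sym generated_equiv_trans by metis
  qed
  have "(v, 1) \<notin> X" "(v, 2) \<notin> X" "(v, 3) \<notin> X"
    using notX joined_at_crossing(2)[OF v(1), of H] joined_at_crossing(2)[OF v(1), of "insert v H"] v(2)
    by (simp_all split: if_splits)
  then have Xv: "d = (v, 0)" if "d \<in> X" "fst d = v" for d
  proof -
    have "d \<in> darts E" using that by (simp add: X_def)
    then show ?thesis using that \<open>(v, 1) \<notin> X\<close> \<open>(v, 2) \<notin> X\<close> \<open>(v, 3) \<notin> X\<close>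
      by (cases rule: dart_cases) auto
  qed
  have X0: "(v, 0) \<in> X" using v by (simp add: X_def)
  have "even (card (X - {(v, 0)}))"
  proof (rule even_card_involution)
    fix d assume d: "d \<in> X - {(v, 0)}"
    then have dE: "d \<in> darts E" by (simp add: X_def)
    have "fst d \<noteq> v" using Xv[of d] d by blast
    moreover from this have "arc H d \<in> X"
      using base[of d "arc H d"] d dE arc[OF dE, of H] by (simp add: R_def)
    moreover have "arc H d \<noteq> (v, 0)" using calculation(1) fst_arc[of H d] by (metis fst_conv)
    ultimately show "arc H d \<in> X - {(v, 0)} \<and> arc H d \<noteq> d \<and> arc H (arc H d) = d"
      using arc[OF dE, of H] by blast
  qed (simp add: fin)
  then show False using \<open>even (card X)\<close> card.remove[OF fin X0] by simp
qed

text \<open>As soon as \<open>(v, 0)\<close> and \<open>(v, 2)\<close> are identified, either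
  smoothing at \<open>v\<close> makes all four darts there equivalent, so the marker at
  \<open>v\<close> no longer matters.\<close>

lemma equiv_insert_arcs_le:
  assumes v: "v < ncross E" and H: "H - {v} = H' - {v}"
    and "(d, d') \<in> generated_equiv (darts E) (insert ((v, 0), (v, 2)) (arcs H))"
  shows "(d, d') \<in> generated_equiv (darts E) (insert ((v, 0), (v, 2)) (arcs H'))" (is "_ \<in> ?E")
  using assms(3)
proof (rule generated_equiv_le)
  have j: "joined H' d d' \<Longrightarrow> (d, d') \<in> ?E" for d d'
    by (erule generated_equiv_mono) auto
  have 02: "((v, 0), (v, 2)) \<in> ?E" using v by (intro generated_equiv_base) auto
  have at_v: "((v, 0), (v, p)) \<in> ?E" if "p < 4" for p
  proof -
    have "p = 0 \<or> p = 1 \<or> p = 2 \<or> p = 3" using that by auto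
    moreover have "((v, 0), (v, 1)) \<in> ?E \<and> ((v, 0), (v, 3)) \<in> ?E"
      using j[OF joined_at_crossing(1)[OF v]] generated_equiv_trans[OF 02 j[OF joined_at_crossing(2)[OF v]]]
      by (auto split: if_splits)
    ultimately show ?thesis using 02 by auto
  qed
  fix a b assume ab: "(a, b) \<in> insert ((v, 0), (v, 2)) (arcs H)" "a \<in> darts E" "b \<in> darts E"
  show "(a, b) \<in> ?E"
  proof (cases "fst a = v \<and> fst b = v")
    case True
    then obtain p q where "a = (v, p)" "b = (v, q)" by (cases a, cases b) auto
    then show ?thesis
      using generated_equiv_trans[OF generated_equiv_sym[OF at_v[of p]] at_v[of q]] ab(2,3) by simp
  next
    case False
    then have "(a, b) \<in> arcs H" using ab by auto
    moreover have "arc H a = arc H' a" if "fst a \<noteq> v"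
    proof (rule arc_cong)
      show "fst a \<in> H \<longleftrightarrow> fst a \<in> H'" using that H by blast
    qed
    ultimately have "b = mate E a \<or> b = arc H' a"
      using False fst_arc[of H a] by (metis arcs_iff)
    then show ?thesis using ab joined_mate[of a H'] joined_arc[of a H'] j by blast
  qed
qed

text \<open>Both circle counts are compared with the same quotient, in which the four darts at
  \<open>v\<close> are identified.\<close>

lemma ncircles_insert:
  assumes "v < ncross E" "v \<notin> H"
  shows "int (ncircles (insert v H)) - (if joined (insert v H) (v, 0) (v, 2) then 0 else 1) =
    int (ncircles H) - (if joined H (v, 0) (v, 2) then 0 else 1)"
proof -
  have "generated_equiv (darts E) (insert ((v, 0), (v, 2)) (arcs (insert v H))) =
      generated_equiv (darts E) (insert ((v, 0), (v, 2)) (arcs H))"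
    using equiv_insert_arcs_le[of v H "insert v H"] equiv_insert_arcs_le[of v "insert v H" H] assms by auto
  then have "generated_classes (darts E) (insert ((v, 0), (v, 2)) (arcs (insert v H))) =
      generated_classes (darts E) (insert ((v, 0), (v, 2)) (arcs H))"
    by (simp add: generated_classes_eq)
  then show ?thesis
    using card_generated_classes_insert[OF finite_darts, of "(v, 0)" "(v, 2)" "arcs H"]
      card_generated_classes_insert[OF finite_darts, of "(v, 0)" "(v, 2)" "arcs (insert v H)"] assms
    by (simp add: ncircles_def)
qed

lemma nglued_insert:
  assumes "v < ncross E"
  shows "nglued H = nglued (insert v H) + (if glued H (v, 0) (v, 2) then 0 else 1)"
proof -
  have "glued_arcs (insert v H) = insert ((v, 0), (v, 2)) (glued_arcs H)"
    unfolding glued_arcs_def by blast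
  then show ?thesis
    using card_generated_classes_insert[OF finite_darts, of "(v, 0)" "(v, 2)" "glued_arcs H"] assms
    by (simp add: nglued_def)
qed

lemma glued_mono: "glued H d d' \<Longrightarrow> H \<subseteq> H' \<Longrightarrow> glued H' d d'"
  by (erule generated_equiv_mono) (rule glued_arcs_mono)

lemma joined_empty_glued: "joined {} d d' \<Longrightarrow> glued H d d'"
  by (erule generated_equiv_mono) (rule arcs_empty_subset)

lemma glued_at_crossing:
  assumes v: "v < ncross E" "v \<in> H" and "p < 4" "q < 4"
  shows "glued H (v, p) (v, q)"
proof -
  have "((v, 0), (v, 2)) \<in> glued_arcs H" unfolding glued_arcs_def using v(2) by blast
  then have 02: "glued H (v, 0) (v, 2)" using v(1) by (intro generated_equiv_base) simp_all
  have "glued H (v, 0) (v, p)" if "p < 4" for p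
  proof -
    have "p = 0 \<or> p = 1 \<or> p = 2 \<or> p = 3" using that by auto
    moreover have "glued H (v, 0) (v, 1) \<and> glued H (v, 0) (v, 3)"
      using joined_empty_glued[OF joined_at_crossing(1)[OF v(1)], of H]
        generated_equiv_trans[OF 02 joined_empty_glued[OF joined_at_crossing(2)[OF v(1)]]]
      by (auto split: if_splits)
    ultimately show ?thesis using 02 by auto
  qed
  then have "glued H (v, 0) (v, p)" "glued H (v, 0) (v, q)" using assms by simp_all
  then show ?thesis by (rule generated_equiv_trans[OF generated_equiv_sym])
qed

text \<open>A boundary circle of the surface lies in one component. The only arcs not already
  present on the discs are at crossings of \<open>H\<close>, where the band connects all four
  darts.\<close>

lemma joined_glued:
  assumes "joined H d d'" shows "glued H d d'"
  using assms
proof (rule generated_equiv_le)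
  fix a b assume ab: "(a, b) \<in> arcs H" "a \<in> darts E" "b \<in> darts E"
  show "glued H a b"
  proof (cases "b = arc H a \<and> fst a \<in> H")
    case True
    obtain c p where a: "a = (c, p)" by (cases a)
    moreover have "fst b = c" using True a by simp
    then obtain q where "b = (c, q)" by (cases b) auto
    moreover have "c \<in> H" using True a by simp
    ultimately show ?thesis using glued_at_crossing[of c H p q] ab by simp
  next
    case False
    then have "b = mate E a \<or> b = arc {} a" using ab arc_cong[of a H "{}"]
      by (auto simp: arcs_iff)
    then show ?thesis using joined_mate[of a "{}"] joined_arc[of a "{}"] ab joined_empty_glued by blast
  qed
qed

text \<open>The Euler genus of that surface: its boundary has \<open>ncircles H\<close> components.\<close>

definition genus :: "nat set \<Rightarrow> int" where
  "genus H = 2 * int (nglued H) - int (ncircles {}) + int (card H) - int (ncircles H)"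

text \<open>The surface has Euler characteristic \<open>ncircles {} - card H\<close>; capping its
  \<open>ncircles H\<close> boundary circles and subtracting from twice the number of components
  gives \<open>genus H\<close>. A new band contributes 1, and the indicators record the change in
  boundary circles and components.\<close>

lemma genus_insert:
  assumes "v < ncross E" "v \<notin> H" "finite H"
  shows "genus (insert v H) = genus H + 1 -
      (if joined (insert v H) (v, 0) (v, 2) then 0 else 1) + (if joined H (v, 0) (v, 2) then 0 else 1)
      - 2 * (if glued H (v, 0) (v, 2) then 0 else 1)"
proof -
  have "int (nglued H) = int (nglued (insert v H)) + (if glued H (v, 0) (v, 2) then 0 else 1)"
    using nglued_insert[OF assms(1), of H] by simp
  moreover have "card (insert v H) = card H + 1" using assms by simp
  ultimately show ?thesis using ncircles_insert[OF assms(1,2)] unfolding genus_def by linarith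
qed

text \<open>If both ends of the band are on one boundary circle, they are on one component, and at
  most one circle is gained. Otherwise the parity argument says that the two circles become one,
  which compensates for the possible loss of a component.\<close>

lemma genus_mono_insert:
  assumes "v < ncross E" "v \<notin> H" "finite H"
  shows "genus H \<le> genus (insert v H)"
proof (cases "joined H (v, 0) (v, 2)")
  case True
  then show ?thesis using genus_insert[OF assms] joined_glued[OF True] by simp
next
  case False
  then show ?thesis using genus_insert[OF assms] joined_or_joined_insert[OF assms(1,2)] by simp
qed

lemma genus_mono:
  assumes "H \<subseteq> H'" "H' \<subseteq> {..<ncross E}"
  shows "genus H \<le> genus H'"
proof -
  have fin: "finite H'" using assms finite_subset by blast
  have "genus H \<le> genus (H \<union> X)" if "finite X" "X \<subseteq> H'" for X
    using that
  proof (induction X)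
    case (insert x X)
    have "genus (H \<union> X) \<le> genus (insert x (H \<union> X))"
    proof (cases "x \<in> H \<union> X")
      case False
      then show ?thesis using insert assms fin by (intro genus_mono_insert) (auto intro: finite_subset)
    qed (simp add: insert_absorb)
    then show ?case using insert by simp
  qed simp
  from this[of H'] show ?thesis using assms fin by (simp add: Un_absorb1)
qed

lemma genus_empty: "genus {} = 0"
  by (simp add: genus_def nglued_def ncircles_def glued_arcs_def)


section \<open>Planarity: components, faces and the two extreme states of an alternating
  diagram\<close>

lemma fst_dart: "d \<in> darts E \<Longrightarrow> fst d < ncross E"
  by (auto simp: darts_def)

text \<open>With a band at every crossing, all darts at a crossing are connected, and
  \<open>mate\<close> connects the crossings along the edges of the graph.\<close>

lemma nglued_all: "nglued {..<ncross E} = card (graph_components E)"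
proof -
  define R where "R = {(fst d, fst (mate E d)) | d. d \<in> darts E}"
  let ?N = "{..<ncross E}"
  have "nglued ?N = card ((\<lambda>d. generated_class ?N R (fst d)) ` darts E)"
    unfolding nglued_def
  proof (rule card_generated_classes)
    fix x y assume x: "x \<in> darts E" and y: "y \<in> darts E"
    show "glued ?N x y \<longleftrightarrow> generated_class ?N R (fst x) = generated_class ?N R (fst y)"
    proof
      assume "glued ?N x y"
      then show "generated_class ?N R (fst x) = generated_class ?N R (fst y)"
      proof (rule generated_equiv_invariant)
        fix a b assume ab: "(a, b) \<in> glued_arcs ?N" "a \<in> darts E" "b \<in> darts E"
        show "generated_class ?N R (fst a) = generated_class ?N R (fst b)"
        proof (cases "b = mate E a")
          case True
          have "(fst a, fst b) \<in> R" unfolding R_def using ab(2) True by blast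
          then have "(fst a, fst b) \<in> generated_equiv ?N R"
            by (rule generated_equiv_base) (use ab fst_dart in auto)
          then show ?thesis by (simp only: generated_class_eq_iff)
        next
          case False
          have "(a, b) \<in> arcs {} \<or> fst a = fst b" using ab(1) unfolding glued_arcs_def by auto
          then have "fst a = fst b" using False by (metis arcs_iff fst_arc)
          then show ?thesis by simp
        qed
      qed
    next
      assume "generated_class ?N R (fst x) = generated_class ?N R (fst y)"
      then have xy: "(fst x, fst y) \<in> generated_equiv ?N R" by (simp only: generated_class_eq_iff)
      have to0: "glued ?N (c, p) (c, q)" if "c < ncross E" "p < 4" "q < 4" for c p q
        using glued_at_crossing[of c ?N p q] that by simp
      have adjacent: "glued ?N (fst d, 0) (fst (mate E d), 0)" if "d \<in> darts E" for d
      proof -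
        have "glued ?N (fst d, 0) d" using to0[of "fst d" 0 "snd d"] that by (cases d) simp
        moreover have "glued ?N d (mate E d)" using joined_mate[OF that] joined_glued by blast
        moreover have "glued ?N (mate E d) (fst (mate E d), 0)"
          using to0[of "fst (mate E d)" "snd (mate E d)" 0] mate[OF that] by (cases "mate E d") simp
        ultimately show ?thesis by (meson generated_equiv_trans)
      qed
      have "glued ?N (fst x, 0) (fst y, 0)"
        using xy
      proof (induction rule: generated_equiv_induct)
        case (step a b)
        have "glued ?N (a, 0) (b, 0)"
        proof (cases "(a, b) \<in> R")
          case True
          then show ?thesis using adjacent unfolding R_def by blast
        next
          case False
          then have "(b, a) \<in> R" using step by blast
          then have "glued ?N (b, 0) (a, 0)"
            using adjacent unfolding R_def by blast
          then show ?thesis by (rule generated_equiv_sym)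
        qed
        then show ?case using step(1) by (rule generated_equiv_trans[rotated])
      qed simp
      moreover have "glued ?N x (fst x, 0)" using to0[of "fst x" "snd x" 0] x by (cases x) simp
      moreover have "glued ?N (fst y, 0) y" using to0[of "fst y" 0 "snd y"] y by (cases y) simp
      ultimately show "glued ?N x y" by (meson generated_equiv_trans)
    qed
  qed
  also have "(\<lambda>d. generated_class ?N R (fst d)) ` darts E = generated_class ?N R ` (fst ` darts E)"
    by (simp only: image_image)
  also have "fst ` darts E = ?N" by (simp add: darts_def lessThan_empty_iff)
  finally show ?thesis
    unfolding graph_components_def generated_classes_image R_def .
qed

lemma over_dart_mate: "d \<in> darts E \<Longrightarrow> over_dart E (mate E d) \<longleftrightarrow> \<not> over_dart E d"
  using alt unfolding alternating_def by blast

lemma over_dart_arc: "d \<in> darts E \<Longrightarrow> over_dart E (arc H d) \<longleftrightarrow> \<not> over_dart E d"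
  by (erule dart_cases) (auto simp: over_dart_def arc_def)

text \<open>In an alternating diagram, the circles of the two extreme states are the boundaries of the faces:
  those of the negative state follow the faces with their corners on over-darts.\<close>

definition state_of_side :: "bool \<Rightarrow> nat set" where
  "state_of_side b = (if b then {..<ncross E} else {})"

text \<open>Turning from position \<open>q\<close> to \<open>q - 1\<close> is following the arc that
  cuts off this corner. Which of the two smoothings contains that arc depends on whether the
  arriving dart is over, and alternation expresses this through \<open>d\<close>.\<close>

lemma next_corner_eq:
  assumes "d \<in> darts E"
  shows "next_corner E d = arc (state_of_side (over_dart E d)) (mate E d)"
proof -
  have m: "mate E d \<in> darts E" "over_dart E (mate E d) \<longleftrightarrow> \<not> over_dart E d"
    using assms mate over_dart_mate by auto
  from m(1) show ?thesis
    by (cases rule: dart_cases)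
      (use m in \<open>auto simp: next_corner_def arc_def over_dart_def state_of_side_def\<close>)
qed

lemma next_corner_darts: "d \<in> darts E \<Longrightarrow> next_corner E d \<in> darts E"
  using mate[of d] arc[of "mate E d"] by (simp add: next_corner_eq)

lemma over_dart_next_corner: "d \<in> darts E \<Longrightarrow> over_dart E (next_corner E d) = over_dart E d"
  using mate[of d] over_dart_arc[of "mate E d"] over_dart_mate[of d] by (simp add: next_corner_eq)

abbreviation corners :: "(dart \<times> dart) set" where
  "corners \<equiv> {(d, next_corner E d) | d. d \<in> darts E}"

lemma corners_iff: "(a, b) \<in> corners \<longleftrightarrow> a \<in> darts E \<and> b = next_corner E a"
  by blast

lemma ncircles_side:
  "ncircles (state_of_side b) = card (generated_class (darts E) corners ` {d \<in> darts E. over_dart E d = b})"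
proof -
  let ?H = "state_of_side b"
  let ?C = "generated_class (darts E) corners"
  \<comment> \<open>Alternation puts exactly one dart of each edge on side \<open>b\<close>.
    Replacing every dart by this representative turns the walk along a circle into the walk around a
    face, possibly in the reverse direction.\<close>
  define r where "r d = (if over_dart E d = b then d else mate E d)" for d
  have r: "r d \<in> darts E" "over_dart E (r d) = b" "joined ?H d (r d)" if "d \<in> darts E" for d
    using that mate[OF that] over_dart_mate[OF that] joined_mate[OF that] by (auto simp: r_def)
  have next_class: "?C d = ?C (next_corner E d)" if "d \<in> darts E" for d
  proof -
    have "(d, next_corner E d) \<in> generated_equiv (darts E) corners"
      by (rule generated_equiv_base) (use that next_corner_darts in \<open>simp_all only: corners_iff\<close>)
    then show ?thesis by (simp only: generated_class_eq_iff)
  qed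
  have "ncircles ?H = card ((\<lambda>d. ?C (r d)) ` darts E)"
    unfolding ncircles_def
  proof (rule card_generated_classes)
    fix x y assume x: "x \<in> darts E" and y: "y \<in> darts E"
    show "joined ?H x y \<longleftrightarrow> ?C (r x) = ?C (r y)"
    proof
      assume "joined ?H x y"
      then show "?C (r x) = ?C (r y)"
      proof (rule generated_equiv_invariant)
        fix a a' assume a: "(a, a') \<in> arcs ?H" "a \<in> darts E" "a' \<in> darts E"
        show "?C (r a) = ?C (r a')"
        proof (cases "a' = mate E a")
          case True
          then have "r a = r a'" using over_dart_mate[OF a(2)] mate[OF a(2)] by (auto simp: r_def)
          then show ?thesis by simp
        next
          case False
          then have a': "a' = arc ?H a" using a by (simp add: arcs_iff)
          show ?thesis
          proof (cases "over_dart E a = b")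
            case True
            then have "over_dart E a' \<noteq> b" using a' over_dart_arc[OF a(2), of ?H] True by simp
            then have ra: "r a = a" "r a' = mate E a'" using True by (simp_all add: r_def)
            have "next_corner E (mate E a') = arc ?H a'"
              using next_corner_eq[of "mate E a'"] mate[OF a(3)] over_dart_mate[OF a(3)] \<open>over_dart E a' \<noteq> b\<close>
              by simp
            also have "\<dots> = a" using a' arc[OF a(2)] by simp
            finally show ?thesis using next_class[of "mate E a'"] mate[OF a(3)] ra by simp
          next
            case False
            then have "over_dart E a' = b" using a' over_dart_arc[OF a(2), of ?H] False by simp
            then have ra: "r a = mate E a" "r a' = a'" using False by (simp_all add: r_def)
            have "next_corner E (mate E a) = arc ?H a"
              using next_corner_eq[of "mate E a"] mate[OF a(2)] over_dart_mate[OF a(2)] False by simp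
            then show ?thesis using next_class[of "mate E a"] mate[OF a(2)] ra a' by simp
          qed
        qed
      qed
    next
      assume "?C (r x) = ?C (r y)"
      then have "(r x, r y) \<in> generated_equiv (darts E) corners" by (simp only: generated_class_eq_iff)
      then have "joined ?H (r x) (r y) \<and> over_dart E (r y) = b"
      proof (induction rule: generated_equiv_induct)
        case refl
        then show ?case using r[OF x] by simp
      next
        case (step a a')
        have nx: "joined ?H d (next_corner E d)" if "d \<in> darts E" "over_dart E d = b" for d
          using next_corner_eq[of d] that joined_mate[of d ?H] joined_arc[of "mate E d" ?H] mate[of d]
            generated_equiv_trans[of d "mate E d"] by simp
        from step(4) show ?case
        proof
          assume "(a, a') \<in> corners"
          then have "a' = next_corner E a" by blast
          then show ?thesis using nx[of a] over_dart_next_corner[of a] step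
            generated_equiv_trans[of "r x" a _ _ a'] by simp
        next
          assume "(a', a) \<in> corners"
          then have a: "a = next_corner E a'" by blast
          then have "over_dart E a' = b" using over_dart_next_corner[of a'] step by simp
          then have "joined ?H a a'" using nx[of a'] a step generated_equiv_sym by metis
          then show ?thesis using \<open>over_dart E a' = b\<close> step generated_equiv_trans[of "r x" a _ _ a'] by simp
        qed
      qed
      then show "joined ?H x y"
        using r(3)[OF x] generated_equiv_sym[OF r(3)[OF y]] generated_equiv_trans by metis
    qed
  qed
  also have "(\<lambda>d. ?C (r d)) ` darts E = ?C ` (r ` darts E)" by (simp only: image_image)
  also have "r ` darts E = {d \<in> darts E. over_dart E d = b}"
  proof
    show "r ` darts E \<subseteq> {d \<in> darts E. over_dart E d = b}" using r by auto
    show "{d \<in> darts E. over_dart E d = b} \<subseteq> r ` darts E"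
      by (rule subsetI, rule image_eqI) (auto simp: r_def)
  qed
  finally show ?thesis .
qed

lemma card_faces: "card (faces E) = ncircles {} + ncircles {..<ncross E}"
proof -
  let ?C = "generated_class (darts E) corners"
  define F where "F b = ?C ` {d \<in> darts E. over_dart E d = b}" for b
  have "faces E = F True \<union> F False"
    unfolding faces_def generated_classes_image F_def by blast
  moreover have "F True \<inter> F False = {}"
  proof (rule ccontr)
    assume "F True \<inter> F False \<noteq> {}"
    then obtain d d' where d: "d \<in> darts E" "over_dart E d = True" "d' \<in> darts E" "over_dart E d' = False"
      "?C d = ?C d'" unfolding F_def by blast
    then have "(d, d') \<in> generated_equiv (darts E) corners" by (simp only: generated_class_eq_iff)
    then have "over_dart E d = over_dart E d'"
    proof (rule generated_equiv_invariant)
      fix a b assume "(a, b) \<in> corners"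
      then have "a \<in> darts E" "b = next_corner E a" by blast+
      then show "over_dart E a = over_dart E b" using over_dart_next_corner[of a] by simp
    qed
    then show False using d by simp
  qed
  moreover have "finite (F b)" for b by (simp add: F_def finite_darts)
  ultimately have "card (faces E) = card (F True) + card (F False)"
    by (simp add: card_Un_disjoint)
  then show ?thesis
    using ncircles_side[of True] ncircles_side[of False] by (simp add: F_def state_of_side_def)
qed

lemma genus_eq_0:
  assumes "H \<subseteq> {..<ncross E}"
  shows "genus H = 0"
proof -
  \<comment> \<open>The faces are counted by the circles of the two extreme states together, so
    Euler's formula for the diagram is literally this equation.\<close>
  have "genus {..<ncross E} = 0"
    using planar card_faces nglued_all unfolding genus_def by simp
  then show ?thesis
    using genus_mono[of "{}" H] genus_mono[of H "{..<ncross E}"] assms genus_empty by auto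
qed

text \<open>The genus stays 0 when the band at \<open>v\<close> is attached, which leaves two
  possibilities: the band has its ends on one boundary circle and splits it, or it connects two
  components and merges their circles. The gain is that \<open>glued\<close> is monotone in
  \<open>H\<close>, whereas \<open>joined\<close> has no such property in general.\<close>

lemma joined_iff_glued:
  assumes "v < ncross E" "v \<notin> H" "H \<subseteq> {..<ncross E}"
  shows "joined H (v, 0) (v, 2) \<longleftrightarrow> glued H (v, 0) (v, 2)"
    and "joined (insert v H) (v, 0) (v, 2) \<longleftrightarrow> \<not> glued H (v, 0) (v, 2)"
proof -
  have "finite H" using assms(3) finite_subset by blast
  then have *: "1 - (if joined (insert v H) (v, 0) (v, 2) then 0 else 1) + (if joined H (v, 0) (v, 2) then 0 else 1)
      - 2 * (if glued H (v, 0) (v, 2) then 0 else 1) = (0 :: int)"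
    using genus_insert[OF assms(1,2)] genus_eq_0[of H] genus_eq_0[of "insert v H"] assms by simp
  show "joined H (v, 0) (v, 2) \<longleftrightarrow> glued H (v, 0) (v, 2)"
    using * by (cases "joined H (v, 0) (v, 2)"; cases "joined (insert v H) (v, 0) (v, 2)";
      cases "glued H (v, 0) (v, 2)"; simp)
  show "joined (insert v H) (v, 0) (v, 2) \<longleftrightarrow> \<not> glued H (v, 0) (v, 2)"
    using * by (cases "joined H (v, 0) (v, 2)"; cases "joined (insert v H) (v, 0) (v, 2)";
      cases "glued H (v, 0) (v, 2)"; simp)
qed

end

section \<open>The cube of resolutions of an almost alternating diagram\<close>

definition touching :: "diagram \<Rightarrow> state \<Rightarrow> nat \<Rightarrow> circle set" where
  "touching D s v = {C \<in> circles D s. touches C v}"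

locale almost_alternating_diagram =
  fixes D :: diagram and K :: "nat set"
  assumes link: "link_diagram D" and K: "K \<subseteq> {..<ncross D}"
    and alternating: "alternating (change_crossings K D)"
begin

section \<open>Circles of the diagram, read in the alternating diagram\<close>

lemma change_crossings_simps [simp]:
  "ncross (change_crossings K D) = ncross D" "mate (change_crossings K D) = mate D"
  "darts (change_crossings K D) = darts D" "faces (change_crossings K D) = faces D"
  "graph_components (change_crossings K D) = graph_components D"
  "over (change_crossings K D) c = (if c \<in> K then \<not> over D c else over D c)"
  by (simp_all add: change_crossings_def darts_def faces_def graph_components_def next_corner_def)

sublocale alternating_map "change_crossings K D"
  using link alternating by unfold_locales (auto simp: link_diagram_def simp del: mem_Sigma_iff)

text \<open>The crossings with a negative marker, when the marker is read in the alternating diagram.\<close>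

definition negative :: "state \<Rightarrow> nat set" where
  "negative s = {c. c < ncross D \<and> (s c = 1 \<longleftrightarrow> c \<in> K)}"

text \<open>Changing a crossing in \<open>K\<close> exchanges its two smoothings; the definition of
  \<open>negative\<close> exchanges the markers there, which undoes this.\<close>

lemma smooth_eq_arc: "d \<in> darts D \<Longrightarrow> smooth D s d = arc (negative s) d"
  by (auto simp: smooth_def arc_def negative_def darts_def split: prod.splits)

lemma circles_eq:
  "circles D s = Inl ` generated_classes (darts D) (arcs (negative s)) \<union> Inr ` {..<loops D}"
proof -
  have "{(d, mate D d) | d. d \<in> darts D} \<union> {(d, smooth D s d) | d. d \<in> darts D} = arcs (negative s)"
    unfolding arcs_def change_crossings_simps using smooth_eq_arc by (metis (no_types, lifting))
  then show ?thesis by (simp add: circles_def)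
qed

lemma finite_circles: "finite (circles D s)"
  unfolding circles_eq
  using finite_generated_classes[OF finite_darts] by (intro finite_UnI finite_imageI) simp_all

lemma negative_upd:
  assumes "v < ncross D"
  shows "negative (s(v := e)) - {v} = negative s - {v}"
  by (auto simp: negative_def)

lemma Inl_circles_iff:
  "Inl X \<in> circles D s \<longleftrightarrow> (\<exists>d \<in> darts D. X = generated_class (darts D) (arcs (negative s)) d)"
  unfolding circles_eq generated_classes_image by auto

lemma class_subset_darts: "d \<in> darts D \<Longrightarrow> generated_class (darts D) (arcs H) d \<subseteq> darts D"
proof
  fix x assume d: "d \<in> darts D" and "x \<in> generated_class (darts D) (arcs H) d"
  then have "(d, x) \<in> generated_equiv (darts D) (arcs H)" by simp
  then show "x \<in> darts D" using d by (rule generated_equiv_closed)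
qed

text \<open>All darts of \<open>C\<close> lie at crossings other than \<open>v\<close>, where the
  smoothing is unchanged, so the class is preserved by locality.\<close>

lemma circles_upd:
  assumes v: "v < ncross D" and C: "C \<in> circles D s" "\<not> touches C v"
  shows "C \<in> circles D (s(v := e))"
proof (cases C)
  case (Inl X)
  then obtain d where d: "d \<in> darts D" "X = generated_class (darts D) (arcs (negative s)) d"
    using C Inl_circles_iff by auto
  have "generated_class (darts D) (arcs (negative (s(v := e)))) d = X"
    unfolding d(2)
  proof (rule generated_class_cong[OF d(1)])
    fix a b assume a: "a \<in> generated_class (darts D) (arcs (negative s)) d" and b: "b \<in> darts D"
    have "fst a \<noteq> v"
    proof
      assume "fst a = v"
      then have "(v, snd a) \<in> X" using a d(2) by (cases a) simp
      then show False using C(2) Inl by (auto simp: touches_def)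
    qed
    moreover have arc: "arc (negative (s(v := e))) x = arc (negative s) x" if "fst x \<noteq> v" for x
      by (rule arc_cong) (use that negative_upd[OF v, of s e] in blast)
    moreover have "fst b = fst a" if "a = arc H b" for H
      using that by simp
    ultimately show "((a, b) \<in> arcs (negative s) \<longleftrightarrow> (a, b) \<in> arcs (negative (s(v := e)))) \<and>
        ((b, a) \<in> arcs (negative s) \<longleftrightarrow> (b, a) \<in> arcs (negative (s(v := e))))"
      unfolding arcs_iff change_crossings_simps by metis
  qed
  then show ?thesis unfolding Inl Inl_circles_iff using d(1) by blast
next
  case (Inr n)
  then show ?thesis using C by (auto simp: circles_eq)
qed

text \<open>For either marker, one of \<open>(v, 1)\<close> and \<open>(v, 3)\<close> shares an arc
  with \<open>(v, 0)\<close> and the other with \<open>(v, 2)\<close>, so these two darts represent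
  all circles at \<open>v\<close>.\<close>

lemma touching_eq:
  assumes "v < ncross D"
  shows "touching D s v = (\<lambda>p. Inl (generated_class (darts D) (arcs (negative s)) (v, p))) ` {0, 2}"
proof -
  let ?C = "\<lambda>p. generated_class (darts D) (arcs (negative s)) (v, p)"
  have p: "?C p = ?C 0 \<or> ?C p = ?C 2" if "p < 4" for p
  proof -
    have "p = 0 \<or> p = 1 \<or> p = 2 \<or> p = 3" using that by auto
    moreover obtain q where "?C 0 = ?C q" "?C 2 = ?C (4 - q)" "q = 1 \<or> q = 3"
      unfolding generated_class_eq_iff
      using joined_at_crossing[of v "negative s"] assms
      by (cases "(v \<notin> negative s) = over (change_crossings K D) v")
        (simp_all only: change_crossings_simps(1,3) if_True if_False, force+)
    ultimately show ?thesis by (elim disjE) simp_all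
  qed
  show ?thesis
  proof
    show "touching D s v \<subseteq> (\<lambda>p. Inl (?C p)) ` {0, 2}"
    proof
      fix C assume "C \<in> touching D s v"
      then obtain X q where X: "C = Inl X" "C \<in> circles D s" "(v, q) \<in> X"
        by (auto simp: touching_def touches_def)
      then obtain d where d: "d \<in> darts D" "X = generated_class (darts D) (arcs (negative s)) d"
        using Inl_circles_iff by auto
      then have "(v, q) \<in> darts D" using X class_subset_darts by blast
      moreover have "X = ?C q" using X(3) unfolding d(2) by (rule generated_class_eqI)
      ultimately show "C \<in> (\<lambda>p. Inl (?C p)) ` {0, 2}" using p[of q] X(1) by (auto simp: darts_def)
    qed
    have "Inl (?C p) \<in> touching D s v" if "p < 4" for p
    proof -
      have "(v, p) \<in> darts D" using assms that by (simp add: darts_def)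
      then have "Inl (?C p) \<in> circles D s" unfolding Inl_circles_iff by blast
      moreover have "(v, p) \<in> ?C p" by simp
      ultimately show ?thesis unfolding touching_def touches_def by blast
    qed
    then show "(\<lambda>p. Inl (?C p)) ` {0, 2} \<subseteq> touching D s v" by auto
  qed
qed

lemma card_touching:
  assumes "v < ncross D"
  shows "card (touching D s v) = (if joined (negative s) (v, 0) (v, 2) then 1 else 2)"
  unfolding touching_eq[OF assms] using generated_class_eq_iff[of "darts D" "arcs (negative s)" "(v, 0)" "(v, 2)"]
  by (auto simp: card_insert_if simp del: Image_singleton_iff)

lemma circles_disjoint:
  assumes "C \<in> circles D s" "C' \<in> circles D s" "C = Inl X" "C' = Inl X'" "d \<in> X" "d \<in> X'"
  shows "C = C'"
proof -
  have "Y = generated_class (darts D) (arcs (negative s)) d" if "Inl Y \<in> circles D s" "d \<in> Y" for Y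
    using that generated_class_eqI unfolding Inl_circles_iff by metis
  from this[of X] this[of X'] show ?thesis using assms by simp
qed

lemma touching_upd:
  assumes v: "v < ncross D" and w: "w < ncross D"
    and not: "\<And>C. C \<in> touching D s w \<Longrightarrow> \<not> touches C v"
  shows "touching D (s(v := e)) w = touching D s w"
proof
  show sub: "touching D s w \<subseteq> touching D (s(v := e)) w"
    using circles_upd[OF v] not by (auto simp: touching_def)
  show "touching D (s(v := e)) w \<subseteq> touching D s w"
  proof
    fix C assume C: "C \<in> touching D (s(v := e)) w"
    then obtain X p where X: "C = Inl X" "(w, p) \<in> X" "C \<in> circles D (s(v := e))"
      by (auto simp: touching_def touches_def)
    then obtain d where d: "d \<in> darts D" "X = generated_class (darts D) (arcs (negative (s(v := e)))) d"
      using Inl_circles_iff by auto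
    then have wp: "(w, p) \<in> darts D" using X class_subset_darts by blast
    let ?C = "Inl (generated_class (darts D) (arcs (negative s)) (w, p)) :: circle"
    have "?C \<in> circles D s" using wp unfolding Inl_circles_iff by blast
    moreover have "(w, p) \<in> generated_class (darts D) (arcs (negative s)) (w, p)" by simp
    ultimately have "?C \<in> touching D s w" unfolding touching_def touches_def by blast
    moreover from this have "?C \<in> circles D (s(v := e))" using sub by (auto simp: touching_def)
    then have "C = ?C" by (rule circles_disjoint[OF X(3) _ X(1) refl X(2)]) simp
    ultimately show "C \<in> touching D s w" by simp
  qed
qed

lemma negative_upd_cases:
  assumes "v < ncross D" "s v \<in> {1, -1}"
  shows "(v \<notin> negative s \<and> negative (s(v := - s v)) = insert v (negative s)) \<or>
     (v \<notin> negative (s(v := - s v)) \<and> negative s = insert v (negative (s(v := - s v))))"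
  using assms by (auto simp: negative_def)

lemma negative_subset: "negative s \<subseteq> {..<ncross D}"
  by (auto simp: negative_def)

lemma card_touching_flip:
  assumes "v < ncross D" "s v \<in> {1, -1}"
  shows "card (touching D s v) + card (touching D (s(v := - s v)) v) = 3"
  using negative_upd_cases[of v s, OF assms]
proof
  assume "v \<notin> negative s \<and> negative (s(v := - s v)) = insert v (negative s)"
  then show ?thesis
    using joined_iff_glued[of v "negative s"] negative_subset assms by (simp add: card_touching)
next
  assume "v \<notin> negative (s(v := - s v)) \<and> negative s = insert v (negative (s(v := - s v)))"
  then show ?thesis
    using joined_iff_glued[of v "negative (s(v := - s v))"] negative_subset assms
    by (simp add: card_touching)
qed

text \<open>Outside \<open>K\<close>, passing from \<open>s\<close> to \<open>s'\<close> turns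
  markers negative and so enlarges \<open>negative\<close>; there the monotonicity of
  \<open>glued\<close> applies. Inside \<open>K\<close> the effect would be the opposite, which is
  why the markers in \<open>K\<close> have to agree.\<close>

lemma split_mono:
  assumes v: "v < ncross D" "v \<notin> K" "s v = 1" "s' v = 1"
    and K: "\<And>c. c \<in> K \<Longrightarrow> s c = s' c" and le: "\<And>c. c < ncross D \<Longrightarrow> s' c = 1 \<Longrightarrow> s c = 1"
    and split: "card (touching D s v) = 1"
  shows "card (touching D s' v) = 1"
proof -
  have notin: "v \<notin> negative s" "v \<notin> negative s'" using v by (auto simp: negative_def)
  have "negative s \<subseteq> negative s'" using K le by (auto simp: negative_def)
  then show ?thesis
    using split joined_iff_glued(1)[of v, OF _ notin(1)] joined_iff_glued(1)[of v, OF _ notin(2)]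
      negative_subset v glued_mono by (auto simp: card_touching split: if_splits)
qed

end

section \<open>The differential squares to zero\<close>

lemma sum_signs:
  fixes f :: "'a \<Rightarrow> int"
  assumes "finite A" "\<And>x. x \<in> A \<Longrightarrow> f x \<in> {1, -1}"
  shows "\<bar>sum f A\<bar> \<le> int (card A)" "even (sum f A + int (card A))"
proof -
  have "\<bar>sum f A\<bar> \<le> int (card A) \<and> even (sum f A + int (card A))"
    using assms
  proof (induction A rule: finite_induct)
    case (insert x A)
    then have "f x = 1 \<or> f x = -1" by blast
    moreover have "\<bar>sum f A\<bar> \<le> int (card A) \<and> even (sum f A + int (card A))"
      using insert by blast
    ultimately show ?case using insert(1,2) by (elim disjE) auto
  qed simp
  then show "\<bar>sum f A\<bar> \<le> int (card A)" "even (sum f A + int (card A))" by auto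
qed

definition signings :: "'a set \<Rightarrow> int \<Rightarrow> ('a \<Rightarrow> int) set" where
  "signings U r = {\<kappa> \<in> U \<rightarrow>\<^sub>E {1, -1}. sum \<kappa> U = r}"

lemma card_signings_0: "card (signings {} r) = (if r = 0 then 1 else 0)"
  by (auto simp: signings_def)

lemma card_signings_1:
  assumes "card U = 1" "\<bar>r\<bar> = 1"
  shows "card (signings U r) = 1"
proof -
  obtain u where U: "U = {u}" using assms(1) card_1_singletonE by blast
  have "signings U r = {\<lambda>x \<in> U. r}"
    using assms(2) by (auto simp: signings_def U PiE_def extensional_def fun_eq_iff)
  then show ?thesis by simp
qed

lemma card_signings_2:
  assumes "card U = 2"
  shows "card (signings U 0) = 2"
proof -
  obtain a b where U: "U = {a, b}" "a \<noteq> b" using assms card_2_iff by metis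
  define f where "f e = (\<lambda>x \<in> U. if x = a then e else - e)" for e :: int
  have "signings U 0 = {f 1, f (-1)}"
  proof
    show "{f 1, f (-1)} \<subseteq> signings U 0" using U by (auto simp: signings_def f_def)
    show "signings U 0 \<subseteq> {f 1, f (-1)}"
    proof
      fix g assume g: "g \<in> signings U 0"
      then have "g b = - g a" "g a = 1 \<or> g a = -1" using U by (auto simp: signings_def)
      moreover have "g = f (g a)"
        using g U calculation(1) by (auto simp: signings_def f_def PiE_def extensional_def fun_eq_iff)
      ultimately show "g \<in> {f 1, f (-1)}" by auto
    qed
  qed
  moreover have "f 1 \<noteq> f (-1)" using U by (auto simp: f_def fun_eq_iff)
  ultimately show ?thesis by simp
qed

lemma state_value: "s \<in> states D \<Longrightarrow> c < ncross D \<Longrightarrow> s c = 1 \<or> s c = -1"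
  by (auto simp: states_def PiE_def Pi_def)

lemma states_upd: "s \<in> states D \<Longrightarrow> v < ncross D \<Longrightarrow> e = 1 \<or> e = -1 \<Longrightarrow> s(v := e) \<in> states D"
  by (auto simp: states_def PiE_def Pi_def extensional_def)

lemma sigma_upd: "v < ncross D \<Longrightarrow> sigma D (s(v := e)) = sigma D s - s v + e"
  by (simp add: sigma_def sum.remove[of "{..<ncross D}" v])

lemma states_eqI: "s \<in> states D \<Longrightarrow> s' \<in> states D \<Longrightarrow> (\<And>c. c < ncross D \<Longrightarrow> s c = s' c) \<Longrightarrow> s = s'"
  unfolding states_def by (rule PiE_ext) auto

definition steps_at :: "diagram \<Rightarrow> nat \<Rightarrow> enhanced_state \<Rightarrow> enhanced_state \<Rightarrow> bool" where
  "steps_at D v S S' \<longleftrightarrow> v < ncross D \<and> fst S v = 1 \<and> fst S' = (fst S)(v := -1) \<and>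
     (\<forall>C \<in> circles D (fst S) - touching D (fst S) v. snd S C = snd S' C)"

lemma incident_at_unique: "incident_at D v S S' \<Longrightarrow> incident_at D w S S' \<Longrightarrow> v = w"
  by (auto simp: incident_at_def)

lemma coefficient_incident:
  assumes "incident_at D v S S'"
  shows "coefficient D S S' = (-1) ^ neg_after D v S"
proof -
  have "v < ncross D" using assms by (auto simp: incident_at_def)
  then have "coefficient D S S' = (\<Sum>w \<in> {v}. if incident_at D w S S' then (-1) ^ neg_after D w S else 0)"
    unfolding coefficient_def using incident_at_unique[OF assms]
    by (intro sum.mono_neutral_right) auto
  then show ?thesis using assms by simp
qed

lemma steps_at_incident: "steps_at D v S S' \<Longrightarrow> incident_at D v S S'"
  by (auto simp: steps_at_def incident_at_def touching_def)

lemma generators_states: "S \<in> generators D i j \<Longrightarrow> fst S \<in> states D"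
  by (auto simp: generators_def enhanced_states_def)

text \<open>The drop of \<open>sigma\<close> by 2 forces the single changed marker to go from 1 to
  -1.\<close>

lemma coefficient_steps:
  assumes S: "S \<in> generators D i j" and S': "S' \<in> generators D (i - 2) j" and c: "coefficient D S S' \<noteq> 0"
  obtains v where "steps_at D v S S'"
proof -
  obtain v where v: "v < ncross D" "incident_at D v S S'"
    using c unfolding coefficient_def by (auto elim: sum.not_neutral_contains_not_neutral split: if_splits)
  have s: "fst S \<in> states D" "fst S' \<in> states D" using S S' generators_states by auto
  have diff: "fst S w = fst S' w" if "w < ncross D" "w \<noteq> v" for w
    using v(2) that unfolding incident_at_def by blast
  have "fst S' = (fst S)(v := fst S' v)"
    using s states_upd[OF s(1) v(1)] state_value[OF s(2) v(1)] diff by (intro states_eqI) auto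
  moreover from this have "sigma D (fst S') = sigma D (fst S) - fst S v + fst S' v"
    using sigma_upd[OF v(1), of "fst S" "fst S' v"] by simp
  moreover have "sigma D (fst S') = sigma D (fst S) - 2" using S S' by (auto simp: generators_def)
  ultimately have "fst S v = 1" "fst S' = (fst S)(v := -1)"
    using state_value[OF s(1) v(1)] state_value[OF s(2) v(1)] by auto
  then have "steps_at D v S S'"
    using v by (auto simp: steps_at_def incident_at_def touching_def)
  then show thesis by (rule that)
qed

lemma coefficient_nonzero_iff:
  assumes "S \<in> generators D i j" "S' \<in> generators D (i - 2) j"
  shows "coefficient D S S' \<noteq> 0 \<longleftrightarrow> (\<exists>v. steps_at D v S S')"
  using coefficient_steps[OF assms] coefficient_incident[OF steps_at_incident] by (metis power_not_zero zero_neq_neg_one)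

lemma neg_after_upd:
  assumes "v < ncross D" "fst S v = 1" "fst S' = (fst S)(v := -1)"
  shows "neg_after D w S' = neg_after D w S + (if w < v then 1 else 0)"
proof -
  let ?X = "\<lambda>S. {x. w < x \<and> x < ncross D \<and> fst S x = -1}"
  have fin: "finite (?X S)" by simp
  have "?X S' = (if w < v then insert v (?X S) else ?X S)" using assms by auto
  moreover have "v \<notin> ?X S" using assms by simp
  ultimately show ?thesis using fin by (simp add: neg_after_def)
qed

context almost_alternating_diagram
begin

section \<open>Counting the intermediate states of two marker changes\<close>

lemma untouched_eq:
  assumes "v < ncross D"
  shows "circles D (s(v := e)) - touching D (s(v := e)) v = circles D s - touching D s v"
proof -
  have "C \<in> circles D (s(v := e))" if "C \<in> circles D s" "\<not> touches C v" for C s e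
    using circles_upd[OF assms] that by blast
  from this[of _ s e] this[of _ "s(v := e)" "s v"] show ?thesis
    by (auto simp: touching_def)
qed

lemma finite_touching: "finite (touching D s v)"
  using finite_circles by (simp add: touching_def)

lemma touching_subset: "touching D s v \<subseteq> circles D s"
  by (auto simp: touching_def)

lemma enhanced_iff:
  "S \<in> enhanced_states D \<longleftrightarrow> fst S \<in> states D \<and> snd S \<in> circles D (fst S) \<rightarrow>\<^sub>E {1, -1}"
  by (cases S) (simp add: enhanced_states_def)

lemma circle_sign: "S \<in> enhanced_states D \<Longrightarrow> C \<in> circles D (fst S) \<Longrightarrow> snd S C \<in> {1, -1}"
  by (auto simp: enhanced_iff PiE_def Pi_def)

lemma tau_split: "tau D S = sum (snd S) (circles D (fst S) - touching D (fst S) v) + sum (snd S) (touching D (fst S) v)"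
  unfolding tau_def using finite_circles touching_subset by (rule sum.subset_diff[rotated])

text \<open>Since \<open>sigma\<close> falls by 2, the degree \<open>j\<close> is preserved exactly
  when \<open>tau\<close> rises by 1, and the circles away from \<open>v\<close> contribute equally
  on both sides.\<close>

lemma steps_at_generators_iff:
  assumes S: "S \<in> generators D i j" and S': "S' \<in> enhanced_states D" and step: "steps_at D v S S'"
  shows "S' \<in> generators D (i - 2) j \<longleftrightarrow>
    sum (snd S') (touching D (fst S') v) = sum (snd S) (touching D (fst S) v) + 1"
proof -
  have v: "v < ncross D" "fst S v = 1" and s': "fst S' = (fst S)(v := -1)"
    using step by (auto simp: steps_at_def)
  have "circles D (fst S') - touching D (fst S') v = circles D (fst S) - touching D (fst S) v"
    unfolding s' by (rule untouched_eq[OF v(1)])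
  moreover have "sum (snd S') (circles D (fst S) - touching D (fst S) v) =
      sum (snd S) (circles D (fst S) - touching D (fst S) v)"
    using step by (intro sum.cong) (auto simp: steps_at_def)
  ultimately have "tau D S' - tau D S =
      sum (snd S') (touching D (fst S') v) - sum (snd S) (touching D (fst S) v)"
    using tau_split[of S v] tau_split[of S' v] by simp
  moreover have "sigma D (fst S') = i - 2"
    using sigma_upd[OF v(1), of "fst S" "-1"] v s' S by (simp add: generators_def)
  ultimately show ?thesis using S S' by (auto simp: generators_def)
qed

definition mids :: "nat \<Rightarrow> nat \<Rightarrow> enhanced_state \<Rightarrow> enhanced_state \<Rightarrow> int \<Rightarrow> int \<Rightarrow> enhanced_state set" where
  "mids v w S S'' i j = {S' \<in> generators D (i - 2) j. steps_at D v S S' \<and> steps_at D w S' S''}"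

text \<open>An intermediate state is determined by its signs on the set \<open>U\<close> of circles touching both crossings,
  and homogeneity only fixes the sum of these signs.\<close>

lemma mids_count:
  fixes v w :: nat and S S'' :: enhanced_state
  defines "s \<equiv> fst S" and "s1 \<equiv> (fst S)(v := -1)" and "s2 \<equiv> fst S''"
  defines "U \<equiv> touching D s1 v \<inter> touching D s1 w"
  defines "r \<equiv> sum (snd S) (touching D s v) + 1 - sum (snd S'') (touching D s1 v - U)"
  assumes S: "S \<in> generators D i j" and S'': "S'' \<in> generators D (i - 4) j"
    and vw: "v < ncross D" "w < ncross D" "v \<noteq> w" "fst S v = 1" "fst S w = 1"
    and s2: "fst S'' = (fst S)(v := -1, w := -1)"
    and agree: "\<And>C. C \<in> circles D (fst S) \<Longrightarrow> \<not> touches C v \<Longrightarrow> \<not> touches C w \<Longrightarrow> snd S C = snd S'' C"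
  shows "card (mids v w S S'' i j) = card (signings U r)"
    and "r = sum (snd S'') (touching D s2 w) - 1 - sum (snd S) (touching D s1 w - U)"
    and "\<bar>r\<bar> \<le> 2 - int (card U)" and "even (r + int (card U))"
    and "card (touching D s v \<union> touching D s w) + card (touching D s2 v \<union> touching D s2 w) + 2 * card U = 6"
proof -
  have s1w: "s1(w := -1) = s2" using s2 by (simp add: s1_def s2_def)
  have un_v: "circles D s1 - touching D s1 v = circles D s - touching D s v"
    unfolding s1_def s_def by (rule untouched_eq[OF vw(1)])
  have un_w: "circles D s2 - touching D s2 w = circles D s1 - touching D s1 w"
    unfolding s1w[symmetric] by (rule untouched_eq[OF vw(2)])
  have enh: "S \<in> enhanced_states D" "S'' \<in> enhanced_states D" using S S'' by (auto simp: generators_def)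
  have st: "s \<in> states D" "s1 \<in> states D"
    using enh(1) states_upd[of s D v "-1"] vw by (auto simp: enhanced_iff s_def s1_def)
  have sgn: "snd S C \<in> {1, -1}" if "C \<in> circles D s" for C using circle_sign[OF enh(1)] that by (simp add: s_def)
  have sgn'': "snd S'' C \<in> {1, -1}" if "C \<in> circles D s2" for C using circle_sign[OF enh(2)] that by (simp add: s2_def)
  have fin: "finite U" "finite (touching D t x)" for t x using finite_touching by (auto simp: U_def)
  define Z where "Z = {C \<in> circles D s. \<not> touches C v \<and> \<not> touches C w}"
  have A1: "touching D s1 v - U \<subseteq> circles D s2 - touching D s2 w"
    unfolding un_w by (auto simp: U_def touching_def)
  have B1: "touching D s1 w - U \<subseteq> circles D s - touching D s v"
    unfolding un_v[symmetric] by (auto simp: U_def touching_def)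
  have Bs: "touching D s w - touching D s v = touching D s1 w - U"
    using un_v by (auto simp: U_def touching_def)
  have As: "touching D s2 v - touching D s2 w = touching D s1 v - U"
    using un_w by (auto simp: U_def touching_def)
  have cs: "circles D s - touching D s v = (touching D s1 w - U) \<union> Z"
    using Bs by (auto simp: touching_def Z_def)
  have cs2: "circles D s2 - touching D s2 w = (touching D s1 v - U) \<union> Z"
    using As un_v un_w by (auto simp: touching_def Z_def)
  have tauS: "tau D S = sum (snd S) (touching D s v) + sum (snd S) (touching D s1 w - U) + sum (snd S) Z"
  proof -
    have "sum (snd S) (circles D s - touching D s v) = sum (snd S) (touching D s1 w - U) + sum (snd S) Z"
      unfolding cs using finite_touching finite_circles
      by (intro sum.union_disjoint) (auto simp: Z_def touching_def)
    then show ?thesis using tau_split[of S v] by (simp add: s_def)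
  qed
  have tauS'': "tau D S'' = sum (snd S'') (touching D s2 w) + sum (snd S'') (touching D s1 v - U) + sum (snd S'') Z"
  proof -
    have "sum (snd S'') (circles D s2 - touching D s2 w) = sum (snd S'') (touching D s1 v - U) + sum (snd S'') Z"
      unfolding cs2 using finite_touching finite_circles
      by (intro sum.union_disjoint) (auto simp: Z_def touching_def)
    then show ?thesis using tau_split[of S'' w] by (simp add: s2_def)
  qed
  have "sum (snd S'') Z = sum (snd S) Z"
    using agree by (intro sum.cong) (auto simp: Z_def s_def)
  moreover have "tau D S'' = tau D S + 2" using S S'' by (auto simp: generators_def)
  ultimately show r2: "r = sum (snd S'') (touching D s2 w) - 1 - sum (snd S) (touching D s1 w - U)"
    using tauS tauS'' by (simp add: r_def)
  have "s1 v = -1" "s w = 1" "s v = 1" "s1 w = 1" using vw by (auto simp: s1_def s_def)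
  then have c: "card (touching D s v) + card (touching D s1 v) = 3"
      "card (touching D s1 w) + card (touching D s2 w) = 3"
    using card_touching_flip[of v s] card_touching_flip[of w s1] vw s1w by (auto simp: s1_def s_def)
  have cU: "card (touching D s1 v - U) = card (touching D s1 v) - card U" "card U \<le> card (touching D s1 v)"
      "card (touching D s1 w - U) = card (touching D s1 w) - card U" "card U \<le> card (touching D s1 w)"
    using fin finite_touching by (auto simp: U_def card_Diff_subset intro!: card_mono)
  have in_s: "C \<in> circles D s" if "C \<in> touching D s v" for C
    using that by (simp add: touching_def)
  have in_s2: "C \<in> circles D s2" if "C \<in> touching D s2 w" for C
    using that by (simp add: touching_def)
  have A1': "C \<in> circles D s2" if "C \<in> touching D s1 v - U" for C using A1 that by blast
  have B1': "C \<in> circles D s" if "C \<in> touching D s1 w - U" for C using B1 that by blast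
  note b1 = sum_signs[of "touching D s v" "snd S", OF fin(2) sgn[OF in_s]]
  note b2 = sum_signs[of "touching D s1 v - U" "snd S''", OF finite_Diff[OF fin(2)] sgn''[OF A1']]
  note b3 = sum_signs[of "touching D s2 w" "snd S''", OF fin(2) sgn''[OF in_s2]]
  note b4 = sum_signs[of "touching D s1 w - U" "snd S", OF finite_Diff[OF fin(2)] sgn[OF B1']]
  \<comment> \<open>In each of the two formulas for \<open>r\<close>, the sums involve
    \<open>3 - card U\<close> signs in total. The shift by 1 has opposite signs in them, so the
    definition yields the lower estimate and \<open>r2\<close> the upper one.\<close>
  show "\<bar>r\<bar> \<le> 2 - int (card U)"
    using b1(1) b2(1) b3(1) b4(1) c cU r2 unfolding r_def by linarith
  show "even (r + int (card U))"
  proof -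
    have "r + int (card U) = (sum (snd S) (touching D s v) + int (card (touching D s v)))
        - (sum (snd S'') (touching D s1 v - U) + int (card (touching D s1 v - U))) + 4 - 2 * int (card (touching D s v))"
      using c cU unfolding r_def by linarith
    then show ?thesis using b1(2) b2(2) by simp
  qed
  have T: "touching D s v \<union> touching D s w = touching D s v \<union> (touching D s1 w - U)" using Bs by blast
  have "card (touching D s v \<union> touching D s w) = card (touching D s v) + card (touching D s1 w - U)"
    unfolding T by (intro card_Un_disjoint fin finite_Diff) (use B1 in blast)
  moreover have T'': "touching D s2 v \<union> touching D s2 w = touching D s2 w \<union> (touching D s1 v - U)" using As by blast
  have "card (touching D s2 v \<union> touching D s2 w) = card (touching D s2 w) + card (touching D s1 v - U)"
    unfolding T'' by (intro card_Un_disjoint fin finite_Diff) (use A1 in blast)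
  ultimately show "card (touching D s v \<union> touching D s w) + card (touching D s2 v \<union> touching D s2 w) + 2 * card U = 6"
    using c cU by linarith
  \<comment> \<open>Outside \<open>U\<close> every sign is forced: a circle that misses
    \<open>v\<close> still has its sign from \<open>S\<close>, and one that misses \<open>w\<close>
    already has its sign in \<open>S''\<close>.\<close>
  define f where "f \<kappa> = (s1, \<lambda>C \<in> circles D s1. if C \<in> U then \<kappa> C else if touches C v then snd S'' C else snd S C)"
    for \<kappa> :: "circle \<Rightarrow> int"
  have UA: "U \<subseteq> touching D s1 v" "U \<subseteq> circles D s1" by (auto simp: U_def touching_def)
  have f_iff: "f \<kappa> \<in> mids v w S S'' i j \<longleftrightarrow> sum \<kappa> U = r" if \<kappa>: "\<kappa> \<in> U \<rightarrow>\<^sub>E {1, -1}" for \<kappa>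
  proof -
    have val: "snd (f \<kappa>) C = (if C \<in> U then \<kappa> C else if touches C v then snd S'' C else snd S C)"
      if "C \<in> circles D s1" for C using that by (simp add: f_def)
    have "snd (f \<kappa>) C \<in> {1, -1}" if C: "C \<in> circles D s1" for C
    proof -
      consider "C \<in> U" | "C \<notin> U" "touches C v" | "\<not> touches C v" by blast
      then show ?thesis
      proof cases
        case 1
        then show ?thesis using \<kappa> val[OF C] by (auto simp: PiE_def Pi_def)
      next
        case 2
        then have "C \<in> circles D s2" using A1 C by (auto simp: touching_def)
        then show ?thesis using sgn'' val[OF C] 2 by simp
      next
        case 3
        then have "C \<in> circles D s" "C \<notin> U" using un_v C UA by (auto simp: touching_def)
        then show ?thesis using sgn val[OF C] 3 by simp
      qed
    qed
    then have fe: "f \<kappa> \<in> enhanced_states D"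
      using st by (auto simp: enhanced_iff f_def)
    have step1: "steps_at D v S (f \<kappa>)"
      unfolding steps_at_def
    proof (intro conjI ballI)
      fix C assume "C \<in> circles D (fst S) - touching D (fst S) v"
      then have "C \<in> circles D s1 - touching D s1 v" using un_v by (simp add: s_def)
      then show "snd S C = snd (f \<kappa>) C" using val[of C] UA by (auto simp: touching_def)
    qed (use vw in \<open>simp_all add: f_def s1_def\<close>)
    have step2: "steps_at D w (f \<kappa>) S''"
      unfolding steps_at_def
    proof (intro conjI ballI)
      fix C assume "C \<in> circles D (fst (f \<kappa>)) - touching D (fst (f \<kappa>)) w"
      then have C: "C \<in> circles D s1" "\<not> touches C w" by (auto simp: f_def touching_def)
      then have "C \<notin> U" by (auto simp: U_def touching_def)
      moreover have "snd S C = snd S'' C" if "\<not> touches C v"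
        using agree[of C] that C un_v by (auto simp: touching_def s_def)
      ultimately show "snd (f \<kappa>) C = snd S'' C" using val[OF C(1)] by simp
    qed (use vw s2 in \<open>simp_all add: f_def s1_def\<close>)
    have "f \<kappa> \<in> mids v w S S'' i j \<longleftrightarrow> sum (snd (f \<kappa>)) (touching D s1 v) = sum (snd S) (touching D s v) + 1"
      using steps_at_generators_iff[OF S fe step1] step1 step2 by (simp add: mids_def f_def s_def)
    also have "sum (snd (f \<kappa>)) (touching D s1 v) = sum (snd (f \<kappa>)) (touching D s1 v - U) + sum (snd (f \<kappa>)) U"
      using fin(2) UA(1) by (rule sum.subset_diff[rotated])
    also have "sum (snd (f \<kappa>)) (touching D s1 v - U) = sum (snd S'') (touching D s1 v - U)"
      using val by (intro sum.cong) (auto simp: touching_def)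
    also have "sum (snd (f \<kappa>)) U = sum \<kappa> U"
      using val UA(2) by (intro sum.cong) auto
    finally show ?thesis unfolding r_def by linarith
  qed
  have "bij_betw f (signings U r) (mids v w S S'' i j)"
    unfolding bij_betw_def
  proof
    show "inj_on f (signings U r)"
    proof (rule inj_onI)
      fix \<kappa> \<kappa>' assume \<kappa>: "\<kappa> \<in> signings U r" "\<kappa>' \<in> signings U r" "f \<kappa> = f \<kappa>'"
      show "\<kappa> = \<kappa>'"
      proof (rule PiE_ext)
        show "\<kappa> \<in> U \<rightarrow>\<^sub>E {1, -1}" "\<kappa>' \<in> U \<rightarrow>\<^sub>E {1, -1}" using \<kappa> by (simp_all add: signings_def)
        fix C assume "C \<in> U"
        then have "snd (f \<kappa>) C = \<kappa> C" "snd (f \<kappa>') C = \<kappa>' C" using UA by (auto simp: f_def)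
        then show "\<kappa> C = \<kappa>' C" using \<kappa>(3) by simp
      qed
    qed
    show "f ` signings U r = mids v w S S'' i j"
    proof
      show "f ` signings U r \<subseteq> mids v w S S'' i j" using f_iff by (auto simp: signings_def)
      show "mids v w S S'' i j \<subseteq> f ` signings U r"
      proof
        fix S' assume S': "S' \<in> mids v w S S'' i j"
        then have step: "steps_at D v S S'" "steps_at D w S' S''" and e: "S' \<in> enhanced_states D"
          by (auto simp: mids_def generators_def)
        have fs: "fst S' = s1" using step by (simp add: steps_at_def s1_def)
        define \<kappa> where "\<kappa> = restrict (snd S') U"
        have \<kappa>: "\<kappa> \<in> U \<rightarrow>\<^sub>E {1, -1}" using circle_sign[OF e] UA(2) by (auto simp: \<kappa>_def fs)
        have "snd S' = snd (f \<kappa>)"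
        proof (rule extensionalityI)
          show "snd S' \<in> extensional (circles D s1)" using e by (simp add: enhanced_iff fs PiE_def)
          show "snd (f \<kappa>) \<in> extensional (circles D s1)" by (simp add: f_def)
          fix C assume C: "C \<in> circles D s1"
          consider "C \<in> U" | "C \<notin> U" "touches C v" | "\<not> touches C v" by blast
          then show "snd S' C = snd (f \<kappa>) C"
          proof cases
            case 1
            then show ?thesis using C by (simp add: f_def \<kappa>_def)
          next
            case 2
            then have "C \<in> circles D s1 - touching D s1 w" using C by (auto simp: U_def touching_def)
            then have "snd S' C = snd S'' C" using step(2) fs by (simp add: steps_at_def)
            then show ?thesis using C 2 by (simp add: f_def)
          next
            case 3
            then have "C \<in> circles D s - touching D s v" using C un_v by (auto simp: touching_def)
            then have "snd S C = snd S' C" using step(1) by (simp add: steps_at_def s_def)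
            then show ?thesis using C 3 UA by (auto simp: f_def touching_def)
          qed
        qed
        then have "S' = f \<kappa>" using fs by (simp add: f_def prod_eq_iff)
        moreover from this have "\<kappa> \<in> signings U r" using f_iff[OF \<kappa>] \<kappa> S' by (simp add: signings_def)
        ultimately show "S' \<in> f ` signings U r" by blast
      qed
    qed
  qed
  then show "card (mids v w S S'' i j) = card (signings U r)" by (rule bij_betw_same_card[symmetric])
qed


lemma mids_agree:
  assumes "S' \<in> mids v w S S'' i j" "C \<in> circles D (fst S)" "\<not> touches C v" "\<not> touches C w"
  shows "snd S C = snd S'' C"
proof -
  have st: "steps_at D v S S'" "steps_at D w S' S''" using assms(1) by (auto simp: mids_def)
  then have "C \<in> circles D (fst S')" using assms circles_upd by (simp add: steps_at_def)
  then show ?thesis using st assms by (simp add: steps_at_def touching_def)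
qed

text \<open>This replaces a case distinction over all configurations of merging and splitting
  circles. The count adding up to 6 is symmetric in \<open>v\<close> and \<open>w\<close>, so
  \<open>U\<close> and \<open>U'\<close> have equal size. Estimate and parity then leave only sums
  of absolute value 1 for one common circle (one signing) and 0 for two common circles (two
  signings). For no common circle the answer depends on whether the sum is 0, and
  \<open>r' = - r\<close>.\<close>

lemma card_mids_swap:
  assumes S: "S \<in> generators D i j" and S'': "S'' \<in> generators D (i - 4) j"
    and vw: "v < ncross D" "w < ncross D" "v \<noteq> w" "fst S v = 1" "fst S w = 1"
    and s2: "fst S'' = (fst S)(v := -1, w := -1)"
  shows "card (mids v w S S'' i j) = card (mids w v S S'' i j)"
proof (cases "\<forall>C \<in> circles D (fst S). \<not> touches C v \<longrightarrow> \<not> touches C w \<longrightarrow> snd S C = snd S'' C")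
  case False
  then have "mids v w S S'' i j = {}" "mids w v S S'' i j = {}" using mids_agree by blast+
  then show ?thesis by simp
next
  case True
  define s1 where "s1 = (fst S)(v := -1)"
  define s1' where "s1' = (fst S)(w := -1)"
  define U where "U = touching D s1 v \<inter> touching D s1 w"
  define U' where "U' = touching D s1' w \<inter> touching D s1' v"
  define r where "r = sum (snd S) (touching D (fst S) v) + 1 - sum (snd S'') (touching D s1 v - U)"
  define r' where "r' = sum (snd S) (touching D (fst S) w) + 1 - sum (snd S'') (touching D s1' w - U')"
  have s2': "fst S'' = (fst S)(w := -1, v := -1)" using s2 vw(3) by (simp add: fun_upd_twist)
  note c = mids_count[OF S S'' vw s2, folded s1_def, folded U_def, folded r_def]
  note c' = mids_count[OF S S'' vw(2,1) not_sym[OF vw(3)] vw(5,4) s2', folded s1'_def, folded U'_def, folded r'_def]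
  have m: "card (mids v w S S'' i j) = card (signings U r)"
    "r = sum (snd S'') (touching D (fst S'') w) - 1 - sum (snd S) (touching D s1 w - U)"
    "\<bar>r\<bar> \<le> 2 - int (card U)" "even (r + int (card U))"
    "card (touching D (fst S) v \<union> touching D (fst S) w) +
      card (touching D (fst S'') v \<union> touching D (fst S'') w) + 2 * card U = 6"
    by (rule c; use True in blast)+
  have m': "card (mids w v S S'' i j) = card (signings U' r')"
    "\<bar>r'\<bar> \<le> 2 - int (card U')" "even (r' + int (card U'))"
    "card (touching D (fst S) w \<union> touching D (fst S) v) +
      card (touching D (fst S'') w \<union> touching D (fst S'') v) + 2 * card U' = 6"
    by (rule c'; use True in blast)+
  have cU: "card U' = card U" using m(5) m'(4) by (simp add: Un_commute)
  have fin: "finite U" "finite U'" using finite_touching by (auto simp: U_def U'_def)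
  have "card U \<le> 2" using m(3) by linarith
  then consider "card U = 0" | "card U = 1" | "card U = 2" by linarith
  then show ?thesis
  proof cases
    case 1
    then have U: "U = {}" "U' = {}" using fin cU by auto
    have "touching D (s1(v := 1)) w = touching D s1 w"
      using U(1) vw by (intro touching_upd) (auto simp: U_def touching_def)
    moreover have "s1(v := 1) = fst S" using vw(4) by (simp add: s1_def fun_upd_idem)
    moreover have "touching D (s1'(v := -1)) w = touching D s1' w"
      using U(2) vw by (intro touching_upd) (auto simp: U'_def touching_def)
    moreover have "s1'(v := -1) = fst S''" using s2' by (simp add: s1'_def)
    ultimately have "r' = - r" using U m(2) by (simp add: r'_def)
    then show ?thesis using U m(1) m'(1) by (simp add: card_signings_0)
  next
    case c1: 2
    then have "\<bar>r\<bar> = 1" "\<bar>r'\<bar> = 1" using m(3,4) m'(2,3) cU by presburger+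
    then show ?thesis using m(1) m'(1) c1 cU by (simp add: card_signings_1)
  next
    case c2: 3
    then have "r = 0" "r' = 0" using m(3) m'(2) cU by linarith+
    then show ?thesis using m(1) m'(1) c2 cU by (simp add: card_signings_2)
  qed
qed

lemma finite_generators: "finite (generators D i j)"
proof -
  have "finite (states D)" by (auto simp: states_def intro!: finite_PiE)
  moreover have "finite (circles D s \<rightarrow>\<^sub>E {1, -1 :: int})" for s
    using finite_circles by (intro finite_PiE) auto
  ultimately have "finite (enhanced_states D)" unfolding enhanced_states_def by (rule finite_SigmaI)
  then show ?thesis by (rule rev_finite_subset) (auto simp: generators_def)
qed

text \<open>The product of the two incidence signs along the path through \<open>v\<close> first and
  \<open>w\<close> second. The correction by 1 is the marker at \<open>v\<close>, which has become
  negative before the change at \<open>w\<close>.\<close>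

definition mid_sign :: "nat \<Rightarrow> nat \<Rightarrow> enhanced_state \<Rightarrow> int" where
  "mid_sign v w S = (-1) ^ neg_after D v S * (-1) ^ (neg_after D w S + (if w < v then 1 else 0))"

lemma sum_mids:
  "(\<Sum>S' \<in> mids v w S S'' i j. coefficient D S S' * coefficient D S' S'') =
    int (card (mids v w S S'' i j)) * mid_sign v w S"
proof -
  have "coefficient D S S' * coefficient D S' S'' = mid_sign v w S" if "S' \<in> mids v w S S'' i j" for S'
  proof -
    have st: "steps_at D v S S'" "steps_at D w S' S''" using that by (auto simp: mids_def)
    have "neg_after D w S' = neg_after D w S + (if w < v then 1 else 0)"
      using st(1) by (intro neg_after_upd) (auto simp: steps_at_def)
    then show ?thesis
      using st[THEN steps_at_incident, THEN coefficient_incident] by (simp only: mid_sign_def)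
  qed
  then show ?thesis by simp
qed

lemma coefficient_square_zero:
  assumes S: "S \<in> generators D i j" and S'': "S'' \<in> generators D (i - 4) j"
  shows "(\<Sum>S' \<in> generators D (i - 2) j. coefficient D S S' * coefficient D S' S'') = 0"
proof (cases "\<exists>v w. mids v w S S'' i j \<noteq> {}")
  case False
  have "coefficient D S S' * coefficient D S' S'' = 0" if S': "S' \<in> generators D (i - 2) j" for S'
  proof (rule ccontr)
    assume "coefficient D S S' * coefficient D S' S'' \<noteq> 0"
    then obtain v w where "steps_at D v S S'" "steps_at D w S' S''"
      using coefficient_nonzero_iff[OF S S'] coefficient_nonzero_iff[of S' D "i - 2" j S''] S' S'' by auto
    then have "S' \<in> mids v w S S'' i j" using S' by (simp add: mids_def)
    then show False using False by blast
  qed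
  then show ?thesis by (intro sum.neutral ballI)
next
  case True
  then obtain v w S0 where "S0 \<in> mids v w S S'' i j" by blast
  then have st: "steps_at D v S S0" "steps_at D w S0 S''" by (auto simp: mids_def)
  then have vw: "v < ncross D" "w < ncross D" "v \<noteq> w" "fst S v = 1" "fst S w = 1"
    by (auto simp: steps_at_def split: if_splits)
  have s2: "fst S'' = (fst S)(v := -1, w := -1)" using st by (simp add: steps_at_def)
  let ?f = "\<lambda>S'. coefficient D S S' * coefficient D S' S''"
  have "sum ?f (generators D (i - 2) j) = sum ?f (mids v w S S'' i j \<union> mids w v S S'' i j)"
  proof (rule sum.mono_neutral_right[OF finite_generators])
    show "mids v w S S'' i j \<union> mids w v S S'' i j \<subseteq> generators D (i - 2) j" by (auto simp: mids_def)
    show "\<forall>S' \<in> generators D (i - 2) j - (mids v w S S'' i j \<union> mids w v S S'' i j). ?f S' = 0"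
    proof
      fix S' assume S': "S' \<in> generators D (i - 2) j - (mids v w S S'' i j \<union> mids w v S S'' i j)"
      show "?f S' = 0"
      proof (rule ccontr)
        assume "?f S' \<noteq> 0"
        then obtain v' w' where st': "steps_at D v' S S'" "steps_at D w' S' S''"
          using coefficient_nonzero_iff[of S D i j S'] coefficient_nonzero_iff[of S' D "i - 2" j S''] S S' S''
          by auto
        then have eq: "(fst S)(v := -1, w := -1) = (fst S)(v' := -1, w' := -1)"
          and v'w': "fst S v' = 1" "fst S w' = 1" "v' \<noteq> w'"
          using s2 by (auto simp: steps_at_def split: if_splits)
        have "v' \<in> {v, w}" "w' \<in> {v, w}"
          using fun_cong[OF eq, of v'] fun_cong[OF eq, of w'] v'w' by (auto split: if_splits)
        then have "v' = v \<and> w' = w \<or> v' = w \<and> w' = v" using v'w'(3) by auto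
        then show False using st' S' by (auto simp: mids_def)
      qed
    qed
  qed
  also have "\<dots> = sum ?f (mids v w S S'' i j) + sum ?f (mids w v S S'' i j)"
  proof (rule sum.union_disjoint)
    have "finite (mids v w S S'' i j)" for v w
      by (rule finite_subset[OF _ finite_generators]) (auto simp: mids_def)
    then show "finite (mids v w S S'' i j)" "finite (mids w v S S'' i j)" by auto
    have "fst S' v = -1" if "S' \<in> mids v w S S'' i j" for S' using that by (auto simp: mids_def steps_at_def)
    moreover have "fst S' v = 1" if "S' \<in> mids w v S S'' i j" for S'
      using that vw by (auto simp: mids_def steps_at_def)
    ultimately show "mids v w S S'' i j \<inter> mids w v S S'' i j = {}" by fastforce
  qed
  \<comment> \<open>Exchanging the order of the two changes affects the exponent by exactly 1, at
    the smaller of the two crossings, so the equally numerous paths cancel.\<close>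
  also have "\<dots> = 0"
    unfolding sum_mids card_mids_swap[OF S S'' vw s2] using vw(3)
    by (cases "v < w") (auto simp: mid_sign_def not_less)
  finally show ?thesis .
qed

lemma graded: "graded_complex (\<lambda>i. generators D i j) (coefficient D)"
  using finite_generators coefficient_square_zero by unfold_locales

end

section \<open>Subcubes with frozen circles\<close>

definition fill :: "nat set \<Rightarrow> int \<Rightarrow> state \<Rightarrow> state" where
  "fill F e t = (\<lambda>c. if c \<in> F then e else t c)"

lemma fill_upd_same: "v \<in> F \<Longrightarrow> fill (F - {v}) e (t(v := e)) = fill F e t"
  by (auto simp: fill_def)

lemma fill_upd: "v \<in> F \<Longrightarrow> fill (F - {v}) e (t(v := e')) = (fill F e t)(v := e')"
  by (auto simp: fill_def)

lemma fill_states: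
  assumes "t \<in> states D" "F \<subseteq> {..<ncross D}" "e = 1 \<or> e = -1"
  shows "fill F e t \<in> states D"
  using assms by (auto simp: states_def fill_def PiE_def Pi_def extensional_def)

context almost_alternating_diagram
begin

abbreviation exact :: "int \<Rightarrow> int \<Rightarrow> enhanced_state set \<Rightarrow> int \<Rightarrow> bool" where
  "exact j \<equiv> graded_complex.exact_at (\<lambda>i. generators D i j) (coefficient D)"

abbreviation convex_states :: "int \<Rightarrow> enhanced_state set \<Rightarrow> bool" where
  "convex_states j \<equiv> graded_complex.convex_set (\<lambda>i. generators D i j) (coefficient D)"

definition subcube :: "nat set \<Rightarrow> state \<Rightarrow> circle set \<Rightarrow> (circle \<Rightarrow> int) \<Rightarrow> enhanced_state set" where
  "subcube F t Q l = {S \<in> enhanced_states D.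
     (\<forall>c < ncross D. c \<notin> F \<longrightarrow> fst S c = t c) \<and> (\<forall>q \<in> Q. snd S q = l q)}"

text \<open>A circle touching no free crossing is a circle of every state of the subcube, and
  differentials inside the subcube preserve its sign. Only for such circles does prescribing the
  sign give a subquotient complex.\<close>

definition frozen :: "nat set \<Rightarrow> state \<Rightarrow> circle set \<Rightarrow> bool" where
  "frozen F t Q \<longleftrightarrow> F \<subseteq> {..<ncross D} \<and> t \<in> states D \<and> Q \<subseteq> circles D t \<and>
     (\<forall>q \<in> Q. \<forall>v \<in> F. \<not> touches q v)"

lemma circles_agree:
  assumes C: "C \<in> circles D s" "\<And>v. v \<in> F \<Longrightarrow> \<not> touches C v"
    and s: "s \<in> states D" "s' \<in> states D" and F: "F \<subseteq> {..<ncross D}"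
    and eq: "\<And>c. c < ncross D \<Longrightarrow> c \<notin> F \<Longrightarrow> s c = s' c"
  shows "C \<in> circles D s'"
proof -
  define f where "f X = (\<lambda>c. if c \<in> X then s' c else s c)" for X
  have fin: "finite F" using F finite_subset by blast
  then have "C \<in> circles D (f F)"
    using C(2) F
  proof (induction F rule: finite_induct)
    case empty
    then show ?case using C by (simp add: f_def)
  next
    case (insert x X)
    have eq: "f (insert x X) = (f X)(x := s' x)" by (auto simp: f_def)
    have "C \<in> circles D ((f X)(x := s' x))" using insert circles_upd[of x C "f X" "s' x"] by simp
    then show ?case unfolding eq .
  qed
  moreover have "f F = s'"
  proof
    fix c show "f F c = s' c"
      using s eq[of c] by (cases "c < ncross D") (auto simp: f_def states_def PiE_def extensional_def)
  qed
  ultimately show ?thesis by simp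
qed

lemma frozen_circle:
  assumes "frozen F t Q" "q \<in> Q" "S \<in> subcube F t Q l"
  shows "q \<in> circles D (fst S)" "v \<in> F \<Longrightarrow> \<not> touches q v"
proof -
  show "q \<in> circles D (fst S)"
    by (rule circles_agree[of q t F "fst S"]) (use assms in \<open>auto simp: frozen_def subcube_def enhanced_iff\<close>)
qed (use assms in \<open>auto simp: frozen_def\<close>)

lemma frozen_step:
  assumes "frozen F t Q" "q \<in> Q" "S \<in> subcube F t Q l" "steps_at D v S S'" "v \<in> F"
  shows "snd S q = snd S' q"
  using frozen_circle[OF assms(1-3)] assms(4,5) by (auto simp: steps_at_def touching_def)

lemma convex_subcube:
  assumes fr: "frozen F t Q"
  shows "convex_states j (subcube F t Q l)"
  unfolding graded_complex.convex_set_def[OF graded]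
proof (intro allI impI)
  fix i S S' S''
  assume S: "S \<in> subcube F t Q l \<inter> generators D i j" and S': "S' \<in> generators D (i - 2) j"
    and S'': "S'' \<in> subcube F t Q l \<inter> generators D (i - 4) j"
    and c: "coefficient D S S' \<noteq> 0" "coefficient D S' S'' \<noteq> 0"
  obtain v where v: "steps_at D v S S'" using coefficient_steps[of S D i j S'] S S' c by blast
  obtain w where w: "steps_at D w S' S''" using coefficient_steps[of S' D "i - 2" j S''] S' S'' c by auto
  \<comment> \<open>Differentials only lower markers, so a change outside \<open>F\<close> could not
    be undone on the way to \<open>S''\<close>.\<close>
  have "v \<in> F"
  proof (rule ccontr)
    assume "v \<notin> F"
    moreover have "v < ncross D" using v by (simp add: steps_at_def)
    ultimately have "fst S v = t v" "fst S'' v = t v" using S S'' by (simp_all add: subcube_def)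
    then show False using v w by (auto simp: steps_at_def split: if_splits)
  qed
  then have "fst S' c = t c" if "c < ncross D" "c \<notin> F" for c
    using v S that by (auto simp: steps_at_def subcube_def)
  moreover have "snd S' q = l q" if "q \<in> Q" for q
    using frozen_step[OF fr that _ v \<open>v \<in> F\<close>, of l] S that by (simp add: subcube_def)
  ultimately show "S' \<in> subcube F t Q l" using S' by (auto simp: subcube_def generators_def)
qed

lemma coefficient_zeroI:
  assumes "S \<in> generators D i j" "S' \<in> generators D (i - 2) j" "fst S v = -1" "fst S' v = 1"
  shows "coefficient D S S' = 0"
proof (rule ccontr)
  assume "coefficient D S S' \<noteq> 0"
  then obtain w where "steps_at D w S S'" using coefficient_steps[OF assms(1,2)] by blast
  then show False using assms by (auto simp: steps_at_def split: if_splits)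
qed

lemma subcube_split:
  assumes "v \<in> F" "F \<subseteq> {..<ncross D}"
  shows "subcube F t Q l = subcube (F - {v}) (t(v := 1)) Q l \<union> subcube (F - {v}) (t(v := -1)) Q l"
proof -
  have "fst S v = 1 \<or> fst S v = -1" if "S \<in> enhanced_states D" for S
    using that assms state_value[of "fst S" D v] by (auto simp: enhanced_iff)
  then show ?thesis using assms by (auto simp: subcube_def)
qed

lemma subcube_value: "S \<in> subcube (F - {v}) (t(v := e)) Q l \<Longrightarrow> v < ncross D \<Longrightarrow> fst S v = e"
  by (simp add: subcube_def)

lemma frozen_upd:
  assumes "frozen F t Q" "v \<in> F" "e = 1 \<or> e = -1"
  shows "frozen (F - {v}) (t(v := e)) Q"
proof -
  have v: "v < ncross D" using assms by (auto simp: frozen_def)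
  have "q \<in> circles D (t(v := e))" if "q \<in> Q" for q
    using circles_upd[OF v, of q t e] that assms by (auto simp: frozen_def)
  then show ?thesis using assms states_upd[of t D v e] v by (auto simp: frozen_def)
qed

text \<open>The half with marker -1 at \<open>v\<close> is a subcomplex and the half with marker 1
  the quotient.\<close>

lemma exact_subcube_split:
  assumes fr: "frozen F t Q" and v: "v \<in> F"
    and "exact j m (subcube (F - {v}) (t(v := 1)) Q l) i"
    and "exact j m (subcube (F - {v}) (t(v := -1)) Q l) i"
  shows "exact j m (subcube F t Q l) i"
proof -
  have vN: "v < ncross D" "F \<subseteq> {..<ncross D}" using fr v by (auto simp: frozen_def)
  have val: "S \<in> subcube (F - {v}) (t(v := e)) Q l \<Longrightarrow> fst S v = e" for S e
    using subcube_value vN by blast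
  show ?thesis
    unfolding subcube_split[OF v vN(2)]
  proof (rule graded_complex.exact_at_Un[OF graded])
    show "convex_states j (subcube (F - {v}) (t(v := 1)) Q l \<union> subcube (F - {v}) (t(v := - 1)) Q l)"
      unfolding subcube_split[OF v vN(2), symmetric] by (rule convex_subcube[OF fr])
    show "subcube (F - {v}) (t(v := 1)) Q l \<inter> subcube (F - {v}) (t(v := - 1)) Q l = {}"
      using val[of _ 1] val[of _ "-1"] by fastforce
    show "coefficient D S S' = 0"
      if "S \<in> subcube (F - {v}) (t(v := - 1)) Q l \<inter> generators D i j"
        "S' \<in> subcube (F - {v}) (t(v := 1)) Q l \<inter> generators D (i - 2) j" for i S S'
      using that val by (intro coefficient_zeroI[of S i j S' v]) auto
  qed (use assms in auto)
qed

section \<open>The numerical bound of a subcube\<close>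

lemma card_circles_flip:
  assumes "v < ncross D"
  shows "int (card (circles D (s(v := e)))) - int (card (touching D (s(v := e)) v)) =
    int (card (circles D s)) - int (card (touching D s v))"
proof -
  have "card (circles D s) = card (circles D s - touching D s v) + card (touching D s v)" for s
    using card_Diff_subset[OF finite_touching touching_subset, of s v]
      card_mono[OF finite_circles touching_subset, of s v] by simp
  from this[of s] this[of "s(v := e)"] show ?thesis using untouched_eq[OF assms, of s e] by simp
qed

text \<open>The factor \<open>e\<close> treats both bounds at once: \<open>e = 1\<close> gives the upper and \<open>e = -1\<close> the lower one.\<close>

definition bound :: "int \<Rightarrow> nat set \<Rightarrow> state \<Rightarrow> circle set \<Rightarrow> (circle \<Rightarrow> int) \<Rightarrow> int" where
  "bound e F t Q l = 2 * (int (card (circles D (fill F e t))) - int (card Q) + e * sum l Q)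
     - e * sigma D (fill F e t) + 4 * int (card (K \<inter> F))"

lemma card_K_Diff: "F \<subseteq> {..<ncross D} \<Longrightarrow> v \<in> F \<Longrightarrow>
    int (card (K \<inter> (F - {v}))) = int (card (K \<inter> F)) - (if v \<in> K then 1 else 0)"
proof -
  assume F: "F \<subseteq> {..<ncross D}" "v \<in> F"
  then have fin: "finite (K \<inter> F)" by (meson finite_Int finite_lessThan finite_subset)
  have eq: "K \<inter> (F - {v}) = K \<inter> F - {v}" by blast
  show ?thesis
  proof (cases "v \<in> K")
    case True
    then have "card (K \<inter> F) = Suc (card (K \<inter> F - {v}))" using card.remove[OF fin, of v] F by simp
    then show ?thesis using True unfolding eq by simp
  next
    case False
    then show ?thesis unfolding eq by simp
  qed
qed

lemma bound_same:
  assumes "F \<subseteq> {..<ncross D}" "v \<in> F"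
  shows "bound e (F - {v}) (t(v := e)) Q l \<le> bound e F t Q l"
  unfolding bound_def fill_upd_same[OF assms(2)] card_K_Diff[OF assms] by simp

lemma bound_flip:
  assumes "F \<subseteq> {..<ncross D}" "v \<in> F" "e = 1 \<or> e = -1"
  shows "bound e (F - {v}) (t(v := -e)) Q l = bound e F t Q l
    + 2 * (int (card (circles D ((fill F e t)(v := -e)))) - int (card (circles D (fill F e t)))) + 2
    - (if v \<in> K then 4 else 0)"
proof -
  have "sigma D ((fill F e t)(v := -e)) = sigma D (fill F e t) - 2 * e"
    using sigma_upd[of v D "fill F e t" "-e"] assms by (auto simp: fill_def)
  then show ?thesis
    unfolding bound_def fill_upd[OF assms(2)] card_K_Diff[OF assms(1,2)]
    using assms(3) by (auto simp: algebra_simps)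
qed

text \<open>Only the state \<open>t\<close> is left, and the bound is attained by the enhanced state
  with sign \<open>e\<close> on every circle that is not frozen. Beyond it there is no generator at
  all.\<close>

lemma exact_subcube_empty:
  assumes fr: "frozen {} t Q" and e: "e = 1 \<or> e = -1" and b: "e * (j - 2 * i) > bound e {} t Q l"
  shows "exact j m (subcube {} t Q l) i"
proof (rule graded_complex.exact_at_empty[OF graded], rule ccontr)
  assume "subcube {} t Q l \<inter> generators D i j \<noteq> {}"
  then obtain S where S: "S \<in> subcube {} t Q l" "S \<in> generators D i j" by blast
  have enh: "S \<in> enhanced_states D" using S(1) by (simp add: subcube_def)
  have "fst S = t"
    using S(1) fr by (intro states_eqI[of _ D]) (auto simp: subcube_def enhanced_iff frozen_def)
  then have Q: "Q \<subseteq> circles D (fst S)" using fr by (simp add: frozen_def)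
  let ?a = "sum (snd S) (circles D (fst S) - Q)"
  have "\<bar>?a\<bar> \<le> int (card (circles D (fst S) - Q))"
    using circle_sign[OF enh] finite_circles by (intro sum_signs(1)) blast+
  also have "\<dots> = int (card (circles D (fst S))) - int (card Q)"
    using Q card_Diff_subset[OF finite_subset[OF Q finite_circles] Q] card_mono[OF finite_circles Q] by simp
  finally have a: "\<bar>?a\<bar> \<le> int (card (circles D (fst S))) - int (card Q)" .
  have "sum (snd S) Q = sum l Q" using S(1) by (intro sum.cong) (auto simp: subcube_def)
  then have "tau D S = ?a + sum l Q"
    unfolding tau_def using sum.subset_diff[OF Q finite_circles, of "snd S"] by simp
  moreover have "sigma D (fst S) = i" "j - 2 * i = 2 * tau D S - i" using S(2) by (auto simp: generators_def)
  moreover have "fill {} e t = fst S" using \<open>fst S = t\<close> by (simp add: fill_def)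
  ultimately have "e * (2 * (?a + sum l Q) - i) >
      2 * (int (card (circles D (fst S))) - int (card Q) + e * sum l Q) - e * i"
    using b by (simp add: bound_def)
  then have "e * ?a > int (card (circles D (fst S))) - int (card Q)"
    by (simp add: algebra_simps)
  then show False using a e by auto
qed


section \<open>Subcubes all of whose free crossings split\<close>

lemma card_touching_cases: "v < ncross D \<Longrightarrow> card (touching D s v) = 1 \<or> card (touching D s v) = 2"
  by (simp add: card_touching)

text \<open>For \<open>e = 1\<close> the extreme state has the most positive markers, and
  \<open>split_mono\<close> leads from it to \<open>s\<close>. For \<open>e = -1\<close> the
  argument is by contraposition: a merge at \<open>s\<close> is a split at \<open>s(v := 1)\<close>,
  and \<open>split_mono\<close> leads from there down to the extreme state.\<close>

lemma all_split:
  assumes e: "e = 1 \<or> e = -1" and F: "F \<subseteq> {..<ncross D}" "K \<inter> F = {}" and v: "v \<in> F"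
    and t: "t \<in> states D" "s \<in> states D" and agree: "\<And>c. c < ncross D \<Longrightarrow> c \<notin> F \<Longrightarrow> s c = t c"
    and sv: "s v = e" and split: "card (touching D (fill F e t) v) = 1"
  shows "card (touching D s v) = 1"
proof -
  let ?s0 = "fill F e t"
  have vN: "v < ncross D" "v \<notin> K" using v F by auto
  have K': "s c = ?s0 c" if "c \<in> K" for c using that F K agree[of c] by (auto simp: fill_def)
  from e show ?thesis
  proof
    assume e: "e = 1"
    show ?thesis
    proof (rule split_mono[OF vN, of ?s0])
      show "?s0 v = 1" "s v = 1" using v sv e by (simp_all add: fill_def)
      show "?s0 c = 1" if "c < ncross D" "s c = 1" for c using that agree[of c] e by (auto simp: fill_def)
    qed (use K' split in auto)
  next
    assume e: "e = -1"
    show ?thesis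
    proof (rule ccontr)
      assume "card (touching D s v) \<noteq> 1"
      then have "card (touching D (s(v := 1)) v) = 1"
        using card_touching_flip[of v s] card_touching_cases[of v s] vN sv e by auto
      then have "card (touching D (?s0(v := 1)) v) = 1"
      proof (rule split_mono[OF vN, rotated -1])
        show "(s(v := 1)) c = 1" if "c < ncross D" "(?s0(v := 1)) c = 1" for c
          using that agree[of c] e by (auto simp: fill_def split: if_splits)
      qed (use K' in auto)
      moreover have "?s0 v = -1" using v e by (simp add: fill_def)
      ultimately show False using card_touching_flip[of v ?s0] vN split by simp
    qed
  qed
qed

text \<open>The free crossings are changed one after another; by \<open>all_split\<close> each still
  splits when its turn comes, whatever has been changed before.\<close>

lemma card_circles_fill:
  assumes e: "e = 1 \<or> e = -1" and F: "F \<subseteq> {..<ncross D}" "K \<inter> F = {}" and t: "t \<in> states D"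
    and split: "\<And>v. v \<in> F \<Longrightarrow> card (touching D (fill F e t) v) = 1"
  shows "card (circles D (fill F (-e) t)) = card (circles D (fill F e t)) + card F"
proof -
  have "card (circles D (fill X (-e) (fill F e t))) = card (circles D (fill F e t)) + card X"
    if "finite X" "X \<subseteq> F" for X
    using that
  proof (induction X rule: finite_induct)
    case empty
    then show ?case by (simp add: fill_def)
  next
    case (insert x X)
    let ?s = "fill X (-e) (fill F e t)"
    have x: "x \<in> F" "x < ncross D" using insert F by auto
    have st: "?s \<in> states D" using t F e insert by (intro fill_states) auto
    have sx: "?s x = e" using insert x by (simp add: fill_def)
    have "card (touching D ?s x) = 1"
    proof (rule all_split[OF e F x(1) t st _ sx split[OF x(1)]])
      show "?s c = t c" if "c \<notin> F" for c using that insert by (auto simp: fill_def)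
    qed
    moreover have "?s x \<in> {1, -1}" using sx e by auto
    ultimately have "card (touching D (?s(x := -e)) x) = 2"
      using card_touching_flip[of x ?s] x sx by simp
    then have "card (circles D (?s(x := -e))) = card (circles D ?s) + 1"
      using card_circles_flip[OF x(2), of ?s "-e"] \<open>card (touching D ?s x) = 1\<close> by simp
    moreover have "?s(x := -e) = fill (insert x X) (-e) (fill F e t)" by (auto simp: fill_def)
    ultimately show ?case using insert by simp
  qed
  moreover have "fill F (-e) (fill F e t) = fill F (-e) t" by (auto simp: fill_def)
  moreover have "finite F" using F finite_subset by blast
  ultimately show ?thesis by fastforce
qed

text \<open>The circles of the state and the crossings in \<open>F\<close> form a forest.\<close>

lemma exists_leaf:
  assumes e: "e = 1 \<or> e = -1" and F: "F \<subseteq> {..<ncross D}" "K \<inter> F = {}" "F \<noteq> {}" and t: "t \<in> states D"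
    and split: "\<And>v. v \<in> F \<Longrightarrow> card (touching D (fill F e t) v) = 1"
  obtains v q where "v \<in> F" "q \<in> circles D (fill F (-e) t)" "touches q v"
    "\<And>w. w \<in> F - {v} \<Longrightarrow> \<not> touches q w"
proof -
  let ?s0 = "fill F e t" and ?s1 = "fill F (-e) t"
  have fin: "finite F" using F finite_subset by blast
  have st: "?s0 \<in> states D" "?s1 \<in> states D" using t F e by (auto intro: fill_states)
  \<comment> \<open>The vertices of the graph whose edges are the crossings in \<open>F\<close>;
    \<open>n\<close> is the number of edges at a vertex. As an edge has at most two ends, the
    degrees add up to at most \<open>2 * card F\<close>.\<close>
  define Q where "Q = {q \<in> circles D ?s1. \<exists>v \<in> F. touches q v}"
  define n where "n q = card {v \<in> F. touches q v}" for q
  have finQ: "finite Q" using finite_circles by (simp add: Q_def)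
  have two: "card {q \<in> Q. touches q v} \<le> 2" if "v \<in> F" for v
  proof -
    have "{q \<in> Q. touches q v} = touching D ?s1 v" using that by (auto simp: Q_def touching_def)
    then show ?thesis using card_touching_cases[of v ?s1] F that by auto
  qed
  have "(\<Sum>q \<in> Q. n q) = (\<Sum>v \<in> F. card {q \<in> Q. touches q v})"
    unfolding n_def card_eq_sum using finQ fin by (intro sum.swap_restrict)
  also have "\<dots> \<le> (\<Sum>v \<in> F. 2)" using two by (rule sum_mono)
  finally have sum: "(\<Sum>q \<in> Q. n q) \<le> 2 * card F" by simp
  \<comment> \<open>The circles missing \<open>F\<close> survive in \<open>?s0\<close>, which has in
    addition a circle touching \<open>F\<close>. As \<open>?s1\<close> has exactly
    \<open>card F\<close> more circles than \<open>?s0\<close>, the strict inequality gives more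
    vertices than edges, and so a vertex of degree below 2.\<close>
  have "card (circles D ?s1 - Q) < card (circles D ?s0)"
  proof (rule psubset_card_mono[OF finite_circles])
    obtain v where v: "v \<in> F" using F by blast
    then have "v < ncross D" using F by blast
    then have "touching D ?s0 v \<noteq> {}" using card_touching_cases[of v ?s0] by auto
    then obtain C where C: "C \<in> circles D ?s0" "touches C v" by (auto simp: touching_def)
    have "C \<notin> circles D ?s1 - Q" using C v by (auto simp: Q_def)
    moreover have "circles D ?s1 - Q \<subseteq> circles D ?s0"
    proof
      fix q assume "q \<in> circles D ?s1 - Q"
      then show "q \<in> circles D ?s0"
        by (intro circles_agree[of q ?s1 F ?s0]) (use st F in \<open>auto simp: Q_def fill_def\<close>)
    qed
    ultimately show "circles D ?s1 - Q \<subset> circles D ?s0" using C by blast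
  qed
  moreover have "card (circles D ?s1 - Q) = card (circles D ?s1) - card Q"
    by (rule card_Diff_subset[OF finQ]) (auto simp: Q_def)
  ultimately have "card Q > card F"
    using card_circles_fill[OF e F(1,2) t split] by simp
  have "\<exists>q \<in> Q. n q < 2"
  proof (rule ccontr)
    assume "\<not> (\<exists>q \<in> Q. n q < 2)"
    then have "(\<Sum>q \<in> Q. 2) \<le> (\<Sum>q \<in> Q. n q)" by (intro sum_mono) auto
    then show False using sum \<open>card Q > card F\<close> by simp
  qed
  then obtain q where q: "q \<in> Q" "n q < 2" by blast
  then obtain v where v: "v \<in> F" "touches q v" by (auto simp: Q_def)
  have "\<not> touches q w" if "w \<in> F - {v}" for w
  proof
    assume "touches q w"
    then have "{v, w} \<subseteq> {v \<in> F. touches q v}" using v that by auto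
    then have "card {v, w} \<le> n q" unfolding n_def using fin by (intro card_mono) auto
    then show False using q(2) that by simp
  qed
  then show thesis using that[of v q] v q(1) by (auto simp: Q_def)
qed

section \<open>Cancellation at a leaf\<close>

definition linked :: "nat \<Rightarrow> int \<Rightarrow> enhanced_state \<Rightarrow> enhanced_state \<Rightarrow> bool" where
  "linked v e S S' \<longleftrightarrow> fst S' = (fst S)(v := e) \<and>
     (\<forall>C \<in> circles D (fst S) - touching D (fst S) v. snd S C = snd S' C)"

text \<open>\<open>linked\<close> always leads from marker \<open>-e\<close> to marker
  \<open>e\<close>, where a circle is merged, whereas the differential follows this direction for
  \<open>e = -1\<close> and the reverse for \<open>e = 1\<close>. One construction of the matching
  thus serves both signs.\<close>

lemma linked_iff_coefficient:
  assumes v: "v < ncross D" and S: "S \<in> enhanced_states D" "fst S v = - e"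
    and S': "S' \<in> enhanced_states D" "fst S' v = e"
  shows "e = 1 \<Longrightarrow> S' \<in> generators D i j \<Longrightarrow> S \<in> generators D (i - 2) j \<Longrightarrow>
      coefficient D S' S \<noteq> 0 \<longleftrightarrow> linked v e S S'"
    and "e = -1 \<Longrightarrow> S \<in> generators D i j \<Longrightarrow> S' \<in> generators D (i - 2) j \<Longrightarrow>
      coefficient D S S' \<noteq> 0 \<longleftrightarrow> linked v e S S'"
proof -
  have x: "x = v" if "steps_at D x A B" "fst A v \<noteq> fst B v" for x A B
    using that by (auto simp: steps_at_def split: if_splits)
  {
    assume e: "e = 1" and g: "S' \<in> generators D i j" "S \<in> generators D (i - 2) j"
    have "steps_at D v S' S \<longleftrightarrow> linked v e S S'"
    proof -
      have *: "steps_at D v S' S \<longleftrightarrow> fst S = (fst S')(v := -1) \<and>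
          (\<forall>C \<in> circles D (fst S') - touching D (fst S') v. snd S' C = snd S C)"
        using v S'(2) e by (simp add: steps_at_def)
      have **: "fst S = (fst S')(v := -1) \<longleftrightarrow> fst S' = (fst S)(v := e)"
        using S(2) S'(2) e by (auto simp: fun_eq_iff)
      show ?thesis
      proof (cases "fst S' = (fst S)(v := e)")
        case True
        then have "circles D (fst S') - touching D (fst S') v = circles D (fst S) - touching D (fst S) v"
          using untouched_eq[OF v, of "fst S" e] by simp
        then show ?thesis unfolding * ** linked_def by metis
      qed (simp add: * ** linked_def)
    qed
    moreover have "steps_at D v S' S" if "steps_at D x S' S" for x
      using x[OF that] that S(2) S'(2) e by simp
    ultimately show "coefficient D S' S \<noteq> 0 \<longleftrightarrow> linked v e S S'"
      unfolding coefficient_nonzero_iff[OF g] by blast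
  next
    assume e: "e = -1" and g: "S \<in> generators D i j" "S' \<in> generators D (i - 2) j"
    have "steps_at D v S S' \<longleftrightarrow> linked v e S S'"
      using v S(2) e by (simp add: steps_at_def linked_def)
    moreover have "steps_at D v S S'" if "steps_at D x S S'" for x
      using x[OF that] that S(2) S'(2) e by simp
    ultimately show "coefficient D S S' \<noteq> 0 \<longleftrightarrow> linked v e S S'"
      unfolding coefficient_nonzero_iff[OF g] by blast
  }
qed

text \<open>Equal \<open>j\<close> means that \<open>tau\<close> differs by exactly
  \<open>e\<close>, and the circle \<open>q\<close> of sign \<open>e\<close> that disappears
  accounts for all of it. Hence the merged circle carries the sign of \<open>C\<close>, so each of
  the two states determines the other.\<close>

lemma linked_generators:
  assumes v: "v < ncross D" and S: "S \<in> enhanced_states D" "fst S v = - e" and S': "S' \<in> enhanced_states D"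
    and link: "linked v e S S'"
    and T: "touching D (fst S) v = {q, C}" "q \<noteq> C" "touching D (fst S') v = {C'}" and q: "snd S q = e"
  shows "S \<in> generators D i j \<and> S' \<in> generators D (i + 2 * e) j \<longleftrightarrow>
    S \<in> generators D i j \<and> snd S' C' = snd S C"
    and "S \<in> generators D i j \<and> S' \<in> generators D (i + 2 * e) j \<longleftrightarrow>
    S' \<in> generators D (i + 2 * e) j \<and> snd S' C' = snd S C"
proof -
  have s': "fst S' = (fst S)(v := e)" using link by (simp add: linked_def)
  have "sigma D (fst S') = sigma D (fst S) + 2 * e"
    using sigma_upd[OF v, of "fst S" e] S(2) s' by simp
  moreover have "tau D S - tau D S' = e + snd S C - snd S' C'"
  proof -
    have "circles D (fst S') - touching D (fst S') v = circles D (fst S) - touching D (fst S) v"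
      unfolding s' by (rule untouched_eq[OF v])
    moreover have "sum (snd S') (circles D (fst S) - touching D (fst S) v) =
        sum (snd S) (circles D (fst S) - touching D (fst S) v)"
      using link by (intro sum.cong) (auto simp: linked_def)
    ultimately show ?thesis using tau_split[of S v] tau_split[of S' v] T q by simp
  qed
  ultimately show "S \<in> generators D i j \<and> S' \<in> generators D (i + 2 * e) j \<longleftrightarrow>
      S \<in> generators D i j \<and> snd S' C' = snd S C"
    "S \<in> generators D i j \<and> S' \<in> generators D (i + 2 * e) j \<longleftrightarrow>
      S' \<in> generators D (i + 2 * e) j \<and> snd S' C' = snd S C"
    using S(1) S' unfolding generators_def by auto
qed


lemma enhanced_eqI:
  assumes "S \<in> enhanced_states D" "S' \<in> enhanced_states D" "fst S = fst S'"
    and "\<And>C. C \<in> circles D (fst S) \<Longrightarrow> snd S C = snd S' C"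
  shows "S = S'"
proof -
  have "snd S = snd S'"
    by (rule extensionalityI[of _ "circles D (fst S)"]) (use assms in \<open>auto simp: enhanced_iff PiE_def\<close>)
  then show ?thesis using assms(3) by (simp add: prod_eq_iff)
qed

lemma linked_fst: "linked v e S S' \<Longrightarrow> fst S v = - e \<Longrightarrow> fst S = (fst S')(v := - e)"
  unfolding linked_def by (metis fun_upd_triv fun_upd_upd)

lemma merge_exists:
  assumes v: "v < ncross D" and e: "e = 1 \<or> e = -1" and S: "S \<in> enhanced_states D" "fst S v = - e"
    and T: "touching D (fst S) v = {q, C}" "q \<noteq> C" "touching D ((fst S)(v := e)) v = {C'}" and q: "snd S q = e"
    and i: "S \<in> generators D i j"
  shows "\<exists>S'. S' \<in> generators D (i + 2 * e) j \<and> linked v e S S'"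
proof -
  define s' where "s' = (fst S)(v := e)"
  define S' where "S' = (s', \<lambda>X \<in> circles D s'. if touches X v then snd S C else snd S X)"
  have un: "circles D s' - touching D s' v = circles D (fst S) - touching D (fst S) v"
    unfolding s'_def by (rule untouched_eq[OF v])
  have C: "C \<in> circles D (fst S)" using T(1) touching_subset by blast
  have "snd S' X \<in> {1, -1}" if "X \<in> circles D s'" for X
  proof (cases "touches X v")
    case True
    then show ?thesis using that circle_sign[OF S(1) C] by (simp add: S'_def)
  next
    case False
    then have "X \<in> circles D (fst S)" using that un by (auto simp: touching_def)
    then show ?thesis using that False circle_sign[OF S(1)] by (simp add: S'_def)
  qed
  then have enh: "S' \<in> enhanced_states D"
    using S(1) states_upd[OF _ v e] by (auto simp: enhanced_iff S'_def s'_def)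
  have link: "linked v e S S'"
    unfolding linked_def
  proof
    show "fst S' = (fst S)(v := e)" by (simp add: S'_def s'_def)
    show "\<forall>X \<in> circles D (fst S) - touching D (fst S) v. snd S X = snd S' X"
      unfolding un[symmetric] by (auto simp: S'_def touching_def)
  qed
  have "C' \<in> touching D s' v" using T(3) by (simp add: s'_def)
  then have "snd S' C' = snd S C" by (auto simp: S'_def touching_def)
  moreover have "touching D (fst S') v = {C'}" using T(3) by (simp add: S'_def s'_def)
  ultimately have "S' \<in> generators D (i + 2 * e) j"
    using linked_generators(1)[OF v S enh link T(1,2) _ q, of C' i j] i by blast
  then show ?thesis using link by blast
qed

lemma merge_unique:
  assumes v: "v < ncross D" and S: "S \<in> enhanced_states D" "fst S v = - e"
    and T: "touching D (fst S) v = {q, C}" "q \<noteq> C" "touching D ((fst S)(v := e)) v = {C'}" and q: "snd S q = e"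
    and i: "S \<in> generators D i j"
    and 1: "S1 \<in> generators D (i + 2 * e) j" "linked v e S S1"
    and 2: "S2 \<in> generators D (i + 2 * e) j" "linked v e S S2"
  shows "S1 = S2"
proof (rule enhanced_eqI)
  show enh: "S1 \<in> enhanced_states D" "S2 \<in> enhanced_states D" using 1 2 by (auto simp: generators_def)
  have f: "fst S1 = (fst S)(v := e)" "fst S2 = (fst S)(v := e)" using 1 2 by (auto simp: linked_def)
  then show "fst S1 = fst S2" by simp
  have C': "snd S1 C' = snd S C" "snd S2 C' = snd S C"
    using linked_generators(1)[OF v S enh(1) 1(2) T(1,2) _ q, of C' i j]
      linked_generators(1)[OF v S enh(2) 2(2) T(1,2) _ q, of C' i j] f T(3) i 1 2 by auto
  fix X assume X: "X \<in> circles D (fst S1)"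
  show "snd S1 X = snd S2 X"
  proof (cases "X \<in> touching D (fst S1) v")
    case True
    then show ?thesis using f T(3) C' by simp
  next
    case False
    then have "X \<in> circles D (fst S) - touching D (fst S) v"
      using X f untouched_eq[OF v, of "fst S" e] by auto
    then show ?thesis using 1(2) 2(2) by (auto simp: linked_def)
  qed
qed

lemma split_exists:
  assumes v: "v < ncross D" and e: "e = 1 \<or> e = -1" and S': "S' \<in> enhanced_states D" "fst S' v = e"
    and s: "s = (fst S')(v := - e)"
    and T: "touching D s v = {q, C}" "q \<noteq> C" "touching D (fst S') v = {C'}"
    and i: "S' \<in> generators D (i + 2 * e) j"
  shows "\<exists>S. S \<in> generators D i j \<and> linked v e S S' \<and> snd S q = e"
proof -
  define S where "S = (s, \<lambda>X \<in> circles D s. if X = q then e else if touches X v then snd S' C' else snd S' X)"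
  have un: "circles D s - touching D s v = circles D (fst S') - touching D (fst S') v"
    unfolding s by (rule untouched_eq[OF v])
  have C': "C' \<in> circles D (fst S')" using T(3) touching_subset by blast
  have qC: "q \<in> circles D s" "C \<in> circles D s" "touches q v" "touches C v"
    using T(1) by (auto simp: touching_def)
  have "snd S X \<in> {1, -1}" if "X \<in> circles D s" for X
  proof (cases "touches X v")
    case True
    then show ?thesis using that circle_sign[OF S'(1) C'] e by (auto simp: S_def)
  next
    case False
    then have "X \<in> circles D (fst S')" using that un by (auto simp: touching_def)
    then show ?thesis using that False circle_sign[OF S'(1)] e by (auto simp: S_def)
  qed
  moreover have "s \<in> states D" unfolding s using S'(1) states_upd[OF _ v, of "fst S'" "-e"] e
    by (auto simp: enhanced_iff)
  ultimately have enh: "S \<in> enhanced_states D" by (auto simp: enhanced_iff S_def)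
  have link: "linked v e S S'"
    unfolding linked_def
  proof
    show "fst S' = (fst S)(v := e)" using S'(2) by (auto simp: S_def s)
    show "\<forall>X \<in> circles D (fst S) - touching D (fst S) v. snd S X = snd S' X"
      using qC by (auto simp: S_def touching_def)
  qed
  have q: "snd S q = e" using qC by (simp add: S_def)
  have "snd S' C' = snd S C" using qC T(2) by (simp add: S_def)
  moreover have "fst S v = - e" "touching D (fst S) v = {q, C}" using T(1) by (simp_all add: S_def s)
  ultimately have "S \<in> generators D i j"
    using linked_generators(2)[OF v enh _ S'(1) link _ T(2,3) q, of i j] i by blast
  then show ?thesis using link q by blast
qed

lemma split_unique:
  assumes v: "v < ncross D" and S': "S' \<in> enhanced_states D" "fst S' v = e"
    and s: "s = (fst S')(v := - e)"
    and T: "touching D s v = {q, C}" "q \<noteq> C" "touching D (fst S') v = {C'}"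
    and i: "S' \<in> generators D (i + 2 * e) j"
    and 1: "S1 \<in> generators D i j" "linked v e S1 S'" "snd S1 q = e" "fst S1 v = - e"
    and 2: "S2 \<in> generators D i j" "linked v e S2 S'" "snd S2 q = e" "fst S2 v = - e"
  shows "S1 = S2"
proof (rule enhanced_eqI)
  show enh: "S1 \<in> enhanced_states D" "S2 \<in> enhanced_states D" using 1 2 by (auto simp: generators_def)
  have f: "fst S1 = s" "fst S2 = s"
    unfolding s by (rule linked_fst[OF 1(2,4)], rule linked_fst[OF 2(2,4)])
  then show "fst S1 = fst S2" by simp
  have C': "snd S' C' = snd S1 C" "snd S' C' = snd S2 C"
    using linked_generators(2)[OF v enh(1) 1(4) S'(1) 1(2) _ T(2,3) 1(3), of i j]
      linked_generators(2)[OF v enh(2) 2(4) S'(1) 2(2) _ T(2,3) 2(3), of i j] f T(1) i 1(1) 2(1) by auto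
  fix X assume X: "X \<in> circles D (fst S1)"
  show "snd S1 X = snd S2 X"
  proof (cases "X \<in> touching D s v")
    case True
    then show ?thesis using T(1) C' 1(3) 2(3) by auto
  next
    case False
    then show ?thesis using X f 1(2) 2(2) by (auto simp: linked_def)
  qed
qed

text \<open>\<open>P\<close> is the half with marker \<open>e\<close> at \<open>v\<close>, and
  \<open>R x\<close> the part of the other half in which \<open>q\<close> has sign \<open>x\<close>.
  \<open>P\<close> cancels against \<open>R e\<close>, and \<open>R (-e)\<close> is covered by
  \<open>IH\<close>. Since differentials lower markers, \<open>R (-e)\<close> is a subcomplex for
  \<open>e = 1\<close> and a quotient for \<open>e = -1\<close>, which explains the two final
  cases.\<close>

lemma exact_leaf:
  assumes fr: "frozen F t Q" and e: "e = 1 \<or> e = -1" and vF: "v \<in> F"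
    and q: "q \<in> circles D (fill F (-e) t)" "touches q v" "\<And>w. w \<in> F - {v} \<Longrightarrow> \<not> touches q w"
    and split: "\<And>s. s \<in> states D \<Longrightarrow> (\<And>c. c < ncross D \<Longrightarrow> c \<notin> F \<Longrightarrow> s c = t c) \<Longrightarrow> s v = e \<Longrightarrow>
      card (touching D s v) = 1"
    and IH: "exact j m (subcube (F - {v}) (t(v := -e)) (insert q Q) (l(q := -e))) i"
    and frq: "frozen (F - {v}) (t(v := -e)) (insert q Q)"
  shows "exact j m (subcube F t Q l) i"
proof -
  define P where "P = subcube (F - {v}) (t(v := e)) Q l"
  define R where "R x = subcube (F - {v}) (t(v := -e)) (insert q Q) (l(q := x))" for x
  have v: "v < ncross D" and FN: "F \<subseteq> {..<ncross D}" using fr vF by (auto simp: frozen_def)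
  have qQ: "q \<notin> Q" using fr vF q(2) by (auto simp: frozen_def)
  have frP: "frozen (F - {v}) (t(v := e)) Q" by (rule frozen_upd[OF fr vF e])
  have Rq: "q \<in> circles D (fst S)" if "S \<in> R x" for S x
    using frozen_circle(1)[OF frq, of q S "l(q := x)"] that by (simp add: R_def)
  have R: "S \<in> R x \<Longrightarrow> S \<in> enhanced_states D \<and> fst S v = -e \<and> snd S q = x \<and> q \<in> circles D (fst S)
      \<and> S \<in> subcube (F - {v}) (t(v := -e)) Q l" for S x
    using Rq[of S x] v qQ by (auto simp: R_def subcube_def)
  have P: "S \<in> P \<Longrightarrow> S \<in> enhanced_states D \<and> fst S v = e" for S
    using v by (auto simp: P_def subcube_def)
  have RR: "subcube (F - {v}) (t(v := -e)) Q l = R e \<union> R (-e)"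
  proof
    show "R e \<union> R (-e) \<subseteq> subcube (F - {v}) (t(v := -e)) Q l" using R by blast
    show "subcube (F - {v}) (t(v := -e)) Q l \<subseteq> R e \<union> R (-e)"
    proof
      fix S assume S: "S \<in> subcube (F - {v}) (t(v := -e)) Q l"
      have "q \<in> circles D (fst S)"
        by (rule circles_agree[of q "t(v := -e)" "F - {v}"])
          (use frq S FN q(3) in \<open>auto simp: frozen_def subcube_def enhanced_iff\<close>)
      then have "snd S q = e \<or> snd S q = - e"
        using circle_sign[of S q] S e by (auto simp: subcube_def)
      then show "S \<in> R e \<union> R (-e)" using S qQ by (auto simp: R_def subcube_def)
    qed
  qed
  have X: "subcube F t Q l = P \<union> (R e \<union> R (-e))"
    using subcube_split[OF vF FN, of t Q l] e RR unfolding P_def by auto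
  have "S \<notin> R x" if "S \<in> P" for S x using R[of S x] P[OF that] e by auto
  moreover have "S \<notin> R (-e)" if "S \<in> R e" for S using R[of S "-e"] R[OF that] e by auto
  ultimately have disj: "P \<inter> R x = {}" "R e \<inter> R (-e) = {}" for x by blast+
  have conv: "convex_states j (P \<union> (R e \<union> R (-e)))"
    unfolding X[symmetric] by (rule convex_subcube[OF fr])
  \<comment> \<open>Inside the half with marker \<open>-e\<close> at \<open>v\<close>, only
    crossings that \<open>q\<close> does not touch can change. So the sign of \<open>q\<close> is
    constant, and this half is a direct sum of its two parts.\<close>
  have no_RR: "coefficient D S S' = 0"
    if SS: "S \<in> R x \<inter> generators D i j" "S' \<in> R y \<inter> generators D (i - 2) j" "x \<noteq> y" for S S' x y i
  proof (rule ccontr)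
    assume "coefficient D S S' \<noteq> 0"
    then obtain w where w: "steps_at D w S S'" using SS coefficient_steps[of S D i j S'] by blast
    have "w \<in> F - {v}"
    proof (rule ccontr)
      assume "w \<notin> F - {v}"
      moreover have "w < ncross D" using w by (simp add: steps_at_def)
      ultimately have "fst S w = fst S' w" using SS by (simp add: R_def subcube_def)
      moreover have "fst S w = 1" "fst S' w = -1" using w by (simp_all add: steps_at_def)
      ultimately show False by simp
    qed
    then have "snd S q = snd S' q" using frozen_step[OF frq _ _ w, of q "l(q := x)"] SS by (simp add: R_def)
    then show False using R[of S x] R[of S' y] SS by auto
  qed
  have no_up: "coefficient D S S' = 0"
    if "S \<in> generators D i j" "S' \<in> generators D (i - 2) j" "fst S v = -1" "fst S' v = 1" for S S' i
    using that by (rule coefficient_zeroI)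
  have T: "\<exists>C C'. touching D s v = {q, C} \<and> q \<noteq> C \<and> touching D (s(v := e)) v = {C'}"
    if "s \<in> states D" "s v = - e" "q \<in> circles D s" "\<And>c. c < ncross D \<Longrightarrow> c \<notin> F \<Longrightarrow> s c = t c" for s
  proof -
    have "card (touching D (s(v := e)) v) = 1"
      by (rule split) (use that states_upd[OF that(1) v e] vF in auto)
    moreover have "card (touching D s v) + card (touching D (s(v := e)) v) = 3"
      using card_touching_flip[of v s] v that(2) e by auto
    ultimately have "card (touching D s v) = 2" "card (touching D (s(v := e)) v) = 1" by simp_all
    then obtain A B C' where "touching D s v = {A, B}" "A \<noteq> B" "touching D (s(v := e)) v = {C'}"
      by (metis card_1_singletonE card_2_iff)
    moreover have "q \<in> touching D s v" using that(3) q(2) by (simp add: touching_def)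
    ultimately show ?thesis by (metis doubleton_eq_iff insertE singletonD)
  qed
  have PR_in: "S' \<in> P" if "S \<in> R e" "S' \<in> enhanced_states D" "linked v e S S'" for S S'
  proof -
    have "snd S' x = l x" if x: "x \<in> Q" for x
    proof -
      have "x \<in> circles D (fst S)" "\<not> touches x v"
        using frozen_circle[OF frq, of x S] x \<open>S \<in> R e\<close> fr vF by (auto simp: R_def frozen_def)
      then have "snd S x = snd S' x" using \<open>linked v e S S'\<close> by (simp add: linked_def touching_def)
      moreover have "snd S x = l x" using \<open>S \<in> R e\<close> x qQ by (auto simp: R_def subcube_def)
      ultimately show ?thesis by simp
    qed
    then show ?thesis using that by (auto simp: P_def R_def subcube_def linked_def)
  qed
  have RP_in: "S \<in> R e" if "S' \<in> P" "S \<in> enhanced_states D" "linked v e S S'" "snd S q = e" "fst S v = - e" for S S'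
  proof -
    have "snd S x = l x" if x: "x \<in> Q" for x
    proof -
      have "x \<in> circles D (fst S')" "\<not> touches x v"
        using frozen_circle[OF frP, of x S'] x \<open>S' \<in> P\<close> fr vF by (auto simp: P_def frozen_def)
      moreover have "fst S = (fst S')(v := - e)"
        using \<open>linked v e S S'\<close> \<open>fst S v = - e\<close> by (rule linked_fst)
      ultimately have "x \<in> circles D (fst S)" using circles_upd[OF v] by simp
      then have "snd S x = snd S' x"
        using \<open>linked v e S S'\<close> \<open>\<not> touches x v\<close> by (simp add: linked_def touching_def)
      moreover have "snd S' x = l x" using \<open>S' \<in> P\<close> x by (auto simp: P_def subcube_def)
      ultimately show ?thesis by simp
    qed
    then show ?thesis using that qQ by (auto simp: P_def R_def subcube_def linked_def)
  qed
  have matchR: "\<exists>!S'. S' \<in> P \<inter> generators D (i + 2 * e) j \<and> linked v e S S'"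
    if S: "S \<in> R e \<inter> generators D i j" for S i
  proof -
    have S': "S \<in> enhanced_states D" "fst S v = - e" "snd S q = e" "q \<in> circles D (fst S)" using S R[of S e] by auto
    have "fst S \<in> states D" using S' by (simp add: enhanced_iff)
    moreover have "fst S c = t c" if "c < ncross D" "c \<notin> F" for c
      using S that vF by (auto simp: R_def subcube_def split: if_splits)
    ultimately obtain C C' where T: "touching D (fst S) v = {q, C}" "q \<noteq> C"
        "touching D ((fst S)(v := e)) v = {C'}" using T[OF _ S'(2,4)] by blast
    have g: "S \<in> generators D i j" using S by blast
    obtain S0 where S0: "S0 \<in> generators D (i + 2 * e) j" "linked v e S S0"
      using merge_exists[OF v e S'(1,2) T S'(3) g] by blast
    then have "S0 \<in> P" using PR_in[of S S0] S by (auto simp: generators_def)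
    show ?thesis
    proof (rule ex1I[of _ S0])
      fix S1 assume "S1 \<in> P \<inter> generators D (i + 2 * e) j \<and> linked v e S S1"
      then show "S1 = S0" using merge_unique[OF v S'(1,2) T S'(3) g, of S1 S0] S0 by blast
    qed (use S0 \<open>S0 \<in> P\<close> in blast)
  qed
  have matchP: "\<exists>!S. S \<in> R e \<inter> generators D i j \<and> linked v e S S'"
    if S': "S' \<in> P \<inter> generators D (i + 2 * e) j" for S' i
  proof -
    have S: "S' \<in> enhanced_states D" "fst S' v = e" using S' P[of S'] by auto
    define s where "s = (fst S')(v := - e)"
    have st: "s \<in> states D" using S states_upd[OF _ v, of "fst S'" "-e"] e by (auto simp: enhanced_iff s_def)
    have agr: "s c = t c" if "c < ncross D" "c \<notin> F" for c
      using S' that vF by (auto simp: P_def subcube_def s_def)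
    have "q \<in> circles D s"
    proof (rule circles_agree[of q "t(v := -e)" "F - {v}"])
      show "(t(v := - e)) c = s c" if "c < ncross D" "c \<notin> F - {v}" for c
        using agr[of c] that by (auto simp: s_def)
    qed (use frq st FN q(3) in \<open>auto simp: frozen_def\<close>)
    moreover have sv: "s v = - e" "s(v := e) = fst S'" using S(2) by (auto simp: s_def)
    ultimately obtain C C' where T: "touching D s v = {q, C}" "q \<noteq> C" "touching D (fst S') v = {C'}"
      using T[OF st sv(1) _ agr] unfolding sv(2) by blast
    have g: "S' \<in> generators D (i + 2 * e) j" using S' by blast
    obtain S0 where S0: "S0 \<in> generators D i j" "linked v e S0 S'" "snd S0 q = e" "fst S0 v = - e"
    proof -
      obtain S0 where S0: "S0 \<in> generators D i j" "linked v e S0 S'" "snd S0 q = e"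
        using split_exists[OF v e S s_def T g] by blast
      have "S0 \<in> enhanced_states D" using S0(1) by (simp add: generators_def)
      \<comment> \<open>\<open>linked\<close> alone admits a state that already has marker
        \<open>e\<close> at \<open>v\<close>; the difference of \<open>2 * e\<close> in
        \<open>sigma\<close> excludes it.\<close>
      have "fst S0 v = - e"
      proof (rule ccontr)
        assume "fst S0 v \<noteq> - e"
        moreover have "fst S0 v = 1 \<or> fst S0 v = -1"
          using \<open>S0 \<in> enhanced_states D\<close> state_value[of "fst S0" D v] v by (simp add: enhanced_iff)
        ultimately have "fst S0 v = e" using e by auto
        then have "fst S0 = fst S'" using S0(2) by (simp add: linked_def fun_upd_idem)
        moreover have "sigma D (fst S') = sigma D (fst S0) + 2 * e"
          using S0(1) g by (simp add: generators_def)
        ultimately show False using e by auto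
      qed
      then show thesis using that S0 by blast
    qed
    then have "S0 \<in> R e" using RP_in[of S' S0] S' by (auto simp: generators_def)
    show ?thesis
    proof (rule ex1I[of _ S0])
      fix S1 assume "S1 \<in> R e \<inter> generators D i j \<and> linked v e S1 S'"
      then show "S1 = S0"
        using split_unique[OF v S s_def T g, of S1 S0] S0 R[of S1 e] by blast
    qed (use S0 \<open>S0 \<in> R e\<close> in blast)
  qed
  note cz = linked_iff_coefficient[OF v]
  have unit: "\<bar>coefficient D S S'\<bar> = 1"
    if SS: "S \<in> generators D i j" "S' \<in> generators D (i - 2) j" "coefficient D S S' \<noteq> 0" for S S' i
  proof -
    obtain w where "steps_at D w S S'" using coefficient_steps[OF SS] by blast
    from coefficient_incident[OF steps_at_incident[OF this]] show ?thesis by (simp add: power_abs)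
  qed
  from e show ?thesis
  proof
    assume e: "e = 1"
    have zero: "coefficient D S S' = 0"
      if "S \<in> R x \<inter> generators D i j" "S' \<in> P \<inter> generators D (i - 2) j" for S S' x i
      by (rule no_up[of S i S']) (use that R[of S x] P[of S'] e in auto)
    have zero': "coefficient D S S' = 0"
      if "S \<in> R (-e) \<inter> generators D i j" "S' \<in> (P \<union> R e) \<inter> generators D (i - 2) j" for S S' i
      using zero[of S "-e" i S'] no_RR[of S "-e" i S' e] that e by auto
    have disj': "(P \<union> R e) \<inter> R (-e) = {}" using disj by blast
    have conv': "convex_states j ((P \<union> R e) \<union> R (-e))" using conv by (simp only: Un_assoc)
    have PR: "convex_states j (P \<union> R e)"
      using zero' by (rule graded_complex.convex_set_parts(1)[OF graded conv' disj'])
    have exPR: "exact j m (P \<union> R e) i"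
    proof (rule graded_complex.exact_at_matching[OF graded PR disj(1)])
      show "coefficient D S S' = 0"
        if "S \<in> R e \<inter> generators D i j" "S' \<in> P \<inter> generators D (i - 2) j" for i S S'
        using that by (rule zero)
      have iff: "coefficient D S S' \<noteq> 0 \<longleftrightarrow> linked v e S' S"
        if "S \<in> P \<inter> generators D i j" "S' \<in> R e \<inter> generators D (i - 2) j" for S S' i
        by (rule cz(1)) (use that R[of S' e] P[of S] e in auto)
      show "\<exists>!S'. S' \<in> R e \<inter> generators D (i - 2) j \<and> coefficient D S S' \<noteq> 0"
        if S: "S \<in> P \<inter> generators D i j" for S i
        using matchP[of S "i - 2"] iff[OF S] S e by (simp cong: conj_cong)
      show "\<exists>!S. S \<in> P \<inter> generators D i j \<and> coefficient D S S' \<noteq> 0"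
        if S: "S' \<in> R e \<inter> generators D (i - 2) j" for S' i
        using matchR[of S' "i - 2"] iff[OF _ S] S e by (simp cong: conj_cong)
      show "\<bar>coefficient D S S'\<bar> = 1" if "S \<in> P \<inter> generators D i j"
        "S' \<in> R e \<inter> generators D (i - 2) j" "coefficient D S S' \<noteq> 0" for S S' i
        using that unit[of S i S'] by blast
    qed
    have "exact j m ((P \<union> R e) \<union> R (-e)) i"
      by (rule graded_complex.exact_at_Un[OF graded conv' disj' zero' exPR]) (simp_all only: R_def IH)
    then show ?thesis unfolding X by (simp only: Un_assoc)
  next
    assume e: "e = -1"
    have zero: "coefficient D S S' = 0"
      if "S \<in> P \<inter> generators D i j" "S' \<in> R x \<inter> generators D (i - 2) j" for S S' x i
      by (rule no_up[of S i S']) (use that R[of S' x] P[of S] e in auto)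
    have zero': "coefficient D S S' = 0"
      if "S \<in> (R e \<union> P) \<inter> generators D i j" "S' \<in> R (-e) \<inter> generators D (i - 2) j" for S S' i
      using zero[of S i S' "-e"] no_RR[of S e i S' "-e"] that e by auto
    have disj': "R (-e) \<inter> (R e \<union> P) = {}" "R e \<inter> P = {}" using disj by blast+
    have conv': "convex_states j (R (-e) \<union> (R e \<union> P))" using conv by (simp only: Un_ac)
    have RP: "convex_states j (R e \<union> P)"
      using zero' by (rule graded_complex.convex_set_parts(2)[OF graded conv' disj'(1)])
    have exRP: "exact j m (R e \<union> P) i"
    proof (rule graded_complex.exact_at_matching[OF graded RP disj'(2)])
      show "coefficient D S S' = 0"
        if "S \<in> P \<inter> generators D i j" "S' \<in> R e \<inter> generators D (i - 2) j" for i S S'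
        using that by (rule zero)
      have iff: "coefficient D S S' \<noteq> 0 \<longleftrightarrow> linked v e S S'"
        if "S \<in> R e \<inter> generators D i j" "S' \<in> P \<inter> generators D (i - 2) j" for S S' i
        by (rule cz(2)) (use that R[of S e] P[of S'] e in auto)
      show "\<exists>!S'. S' \<in> P \<inter> generators D (i - 2) j \<and> coefficient D S S' \<noteq> 0"
        if S: "S \<in> R e \<inter> generators D i j" for S i
        using matchR[of S i] iff[OF S] S e by (simp cong: conj_cong)
      show "\<exists>!S. S \<in> R e \<inter> generators D i j \<and> coefficient D S S' \<noteq> 0"
        if S: "S' \<in> P \<inter> generators D (i - 2) j" for S' i
        using matchP[of S' i] iff[OF _ S] S e by (simp cong: conj_cong)
      show "\<bar>coefficient D S S'\<bar> = 1" if "S \<in> R e \<inter> generators D i j"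
        "S' \<in> P \<inter> generators D (i - 2) j" "coefficient D S S' \<noteq> 0" for S S' i
        using that unit[of S i S'] by blast
    qed
    have "exact j m (R (-e) \<union> (R e \<union> P)) i"
      by (rule graded_complex.exact_at_Un[OF graded conv' disj'(1) zero' _ exRP]) (simp_all only: R_def IH)
    then show ?thesis unfolding X by (simp only: Un_ac)
  qed
qed


section \<open>The induction on the number of free crossings\<close>

lemma exact_subcube:
  assumes "frozen F t Q" and e: "e = 1 \<or> e = -1" and "e * (j - 2 * i) > bound e F t Q l"
  shows "exact j m (subcube F t Q l) i"
  using assms(1,3)
proof (induction "card F" arbitrary: F t Q l rule: less_induct)
  case less
  note fr = less.prems(1) and b = less.prems(2)
  have F: "F \<subseteq> {..<ncross D}" and t: "t \<in> states D" using fr by (auto simp: frozen_def)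
  have fin: "finite F" using F finite_subset by blast
  let ?s = "fill F e t"
  have IH: "exact j m (subcube (F - {v}) t' Q' l') i"
    if "v \<in> F" "frozen (F - {v}) t' Q'" "bound e (F - {v}) t' Q' l' \<le> bound e F t Q l" for v t' Q' l'
  proof (rule less.hyps)
    show "card (F - {v}) < card F" using fin that(1) by (rule card_Diff1_less)
  qed (use that b in auto)
  have \<Delta>: "int (card (circles D (?s(v := -e)))) - int (card (circles D ?s)) = 3 - 2 * int (card (touching D ?s v))"
    if "v \<in> F" for v
  proof -
    have "v < ncross D" "?s v = e" using that F by (auto simp: fill_def)
    then show ?thesis
      using card_circles_flip[of v ?s "-e"] card_touching_flip[of v ?s] e by auto
  qed
  show ?case
  proof (cases "\<exists>v \<in> F. v \<in> K \<or> card (touching D ?s v) = 2")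
    case True
    then obtain v where v: "v \<in> F" "v \<in> K \<or> card (touching D ?s v) = 2" by blast
    have vN: "v < ncross D" using v F by blast
    \<comment> \<open>The 8 is \<open>2 * 3 + 2\<close>: the number of circles changes by 3 minus
      twice the number at \<open>v\<close>, and \<open>sigma\<close> contributes 2. A merge thus
      costs nothing, and a split at a crossing of \<open>K\<close> costs 4, which its allowance
      covers.\<close>
    have "bound e (F - {v}) (t(v := -e)) Q l =
        bound e F t Q l + 8 - 4 * int (card (touching D ?s v)) - (if v \<in> K then 4 else 0)"
      unfolding bound_flip[OF F v(1) e] \<Delta>[OF v(1)] by simp
    moreover have "int (card (touching D ?s v)) \<ge> 1" using card_touching_cases[OF vN, of ?s] by linarith
    ultimately have le: "bound e (F - {v}) (t(v := -e)) Q l \<le> bound e F t Q l"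
      using v(2) by (cases "v \<in> K") simp_all
    have e': "-e = 1 \<or> -e = -1" using e by linarith
    have "exact j m (subcube (F - {v}) (t(v := -e)) Q l) i"
      by (rule IH[OF v(1) frozen_upd[OF fr v(1) e'] le])
    moreover have "exact j m (subcube (F - {v}) (t(v := e)) Q l) i"
      by (rule IH[OF v(1) frozen_upd[OF fr v(1) e] bound_same[OF F v(1)]])
    ultimately show ?thesis using e by (intro exact_subcube_split[OF fr v(1)]) (elim disjE; simp)+
  next
    case False
    then have KF: "K \<inter> F = {}" by blast
    have split: "card (touching D ?s v) = 1" if "v \<in> F" for v
      using False that card_touching_cases[of v ?s] F by blast
    show ?thesis
    proof (cases "F = {}")
      case True
      then show ?thesis using fr b by (simp add: exact_subcube_empty[OF _ e])
    next
      case False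
      obtain v q where v: "v \<in> F" and q: "q \<in> circles D (fill F (-e) t)" "touches q v"
        "\<And>w. w \<in> F - {v} \<Longrightarrow> \<not> touches q w"
        using exists_leaf[OF e F KF False t split] by blast
      have vK: "v \<notin> K" using v KF by blast
      have qQ: "q \<notin> Q" using fr v q(2) by (auto simp: frozen_def)
      have frv: "frozen (F - {v}) (t(v := -e)) Q" using e by (intro frozen_upd[OF fr v]) linarith
      have "q \<in> circles D (t(v := -e))"
      proof (rule circles_agree[where F = "F - {v}", OF q(1)])
        show "\<not> touches q w" if "w \<in> F - {v}" for w using that by (rule q(3))
        show "fill F (-e) t \<in> states D" using t F e by (intro fill_states) auto
        show "t(v := -e) \<in> states D" "F - {v} \<subseteq> {..<ncross D}" using frv by (simp_all add: frozen_def)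
        show "fill F (-e) t c = (t(v := -e)) c" if "c \<notin> F - {v}" for c
          by (cases "c = v") (use that v in \<open>simp_all add: fill_def\<close>)
      qed
      then have frq: "frozen (F - {v}) (t(v := -e)) (insert q Q)"
        using frv q(3) unfolding frozen_def by blast
      have "finite Q" using fr finite_subset[OF _ finite_circles] unfolding frozen_def by blast
      moreover have "sum (l(q := -e)) Q = sum l Q" using qQ by (intro sum.cong) auto
      ultimately have card: "card (insert q Q) = card Q + 1"
        and sum: "sum (l(q := -e)) (insert q Q) = - e + sum l Q"
        using qQ by simp_all
      \<comment> \<open>Freezing \<open>q\<close> with sign \<open>-e\<close> lowers the bound by 2
        for the circle that is no longer free and by 2 for its sign. Together this is exactly the 4
        by which the split raises it.\<close>
      have "bound e (F - {v}) (t(v := -e)) (insert q Q) (l(q := -e)) =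
          bound e (F - {v}) (t(v := -e)) Q l - 2 - 2 * (e * e)"
        unfolding bound_def card sum by (simp add: algebra_simps)
      also have "e * e = 1" using e by auto
      also have "bound e (F - {v}) (t(v := -e)) Q l - 2 - 2 * 1 = bound e F t Q l"
        unfolding bound_flip[OF F v e] \<Delta>[OF v] split[OF v] using vK by simp
      finally have rest: "exact j m (subcube (F - {v}) (t(v := -e)) (insert q Q) (l(q := -e))) i"
        by (intro IH[OF v frq] eq_refl)
      show ?thesis
      proof (rule exact_leaf[OF fr e v q _ rest frq])
        fix s assume "s \<in> states D" "\<And>c. c < ncross D \<Longrightarrow> c \<notin> F \<Longrightarrow> s c = t c" "s v = e"
        then show "card (touching D s v) = 1" by (rule all_split[OF e F KF v t _ _ _ split[OF v]])
      qed
    qed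
  qed
qed

lemma exact_enhanced_states:
  assumes e: "e = 1 \<and> s = s_plus D \<or> e = -1 \<and> s = s_minus D"
    and "e * (j - 2 * i) > 2 * int (card (circles D s)) - int (ncross D) + 4 * int (card K)"
  shows "exact j m (enhanced_states D) i"
proof -
  let ?N = "{..<ncross D}"
  have e': "e = 1 \<or> e = -1" using e by blast
  have "frozen ?N (s_plus D) {}" by (auto simp: frozen_def s_plus_def states_def)
  moreover have s: "fill ?N e (s_plus D) = s" using e by (auto simp: fill_def s_plus_def s_minus_def)
  have "sigma D s = e * int (ncross D)" using e by (auto simp: sigma_def s_plus_def s_minus_def)
  then have "bound e ?N (s_plus D) {} l = 2 * int (card (circles D s)) - int (ncross D) + 4 * int (card K)" for l
    using K e' by (auto simp: bound_def s Int_absorb2)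
  ultimately have "exact j m (subcube ?N (s_plus D) {} (\<lambda>_. 0)) i"
    using assms(2) by (intro exact_subcube[OF _ e']) simp_all
  moreover have "subcube ?N (s_plus D) {} (\<lambda>_. 0) = enhanced_states D" by (auto simp: subcube_def)
  ultimately show ?thesis by simp
qed

end

section \<open>Homology\<close>

lemma lookup_sum_frag_of:
  assumes "finite A"
  shows "Poly_Mapping.lookup (\<Sum>x \<in> A. frag_cmul (f x) (frag_of x)) y = (if y \<in> A then f y else 0)"
  using assms by (induction A rule: finite_induct) (auto simp: lookup_add)

lemma torsion_trivial_group:
  assumes "trivial_group G"
  shows "torsion_subgroup G = {\<one>\<^bsub>G\<^esub>}"
proof -
  interpret group G using assms by (simp add: trivial_group_def)
  have "carrier G = {\<one>\<^bsub>G\<^esub>}" using assms by (simp add: trivial_group_def)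
  then show ?thesis unfolding torsion_subgroup_def by (auto intro!: exI[of _ 1])
qed

context almost_alternating_diagram
begin

section \<open>From exactness of the based complex to the homology groups\<close>

lemma exact_at_generators:
  assumes "exact j m (enhanced_states D) i"
    and "\<And>S'. S' \<in> generators D (i - 2) j \<Longrightarrow> m dvd (\<Sum>S \<in> generators D i j. z S * coefficient D S S')"
  obtains y where "\<And>S. S \<in> generators D i j \<Longrightarrow>
    m dvd z S - (\<Sum>S' \<in> generators D (i + 2) j. y S' * coefficient D S' S)"
proof -
  have E: "enhanced_states D \<inter> generators D i j = generators D i j" for i
    by (auto simp: generators_def)
  show thesis
    using assms that
    unfolding graded_complex.exact_at_def[OF graded] graded_complex.bd_def[OF graded] E by blast
qed

lemma lookup_differential:
  assumes "Poly_Mapping.keys z \<subseteq> generators D i j"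
  shows "Poly_Mapping.lookup (differential D i j z) S' = (if S' \<in> generators D (i - 2) j
    then \<Sum>S \<in> generators D i j. Poly_Mapping.lookup z S * coefficient D S S' else 0)"
proof -
  have inner: "Poly_Mapping.lookup (\<Sum>S' \<in> generators D (i - 2) j. frag_cmul (coefficient D S S') (frag_of S')) T =
      (if T \<in> generators D (i - 2) j then coefficient D S T else 0)" for S T
    by (rule lookup_sum_frag_of[OF finite_generators])
  have "Poly_Mapping.lookup (differential D i j z) S' = (\<Sum>S \<in> Poly_Mapping.keys z.
      Poly_Mapping.lookup z S * (if S' \<in> generators D (i - 2) j then coefficient D S S' else 0))"
    unfolding differential_def frag_extend_def by (subst lookup_sum) (simp only: lookup_frag_cmul inner)
  also have "\<dots> = (\<Sum>S \<in> generators D i j.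
      Poly_Mapping.lookup z S * (if S' \<in> generators D (i - 2) j then coefficient D S S' else 0))"
    using assms finite_generators by (intro sum.mono_neutral_left) (auto simp: in_keys_iff)
  finally show ?thesis by simp
qed

lemma keys_differential: "Poly_Mapping.keys (differential D i j z) \<subseteq> generators D (i - 2) j"
proof
  fix S assume "S \<in> Poly_Mapping.keys (differential D i j z)"
  then have "S \<in> (\<Union>T \<in> Poly_Mapping.keys z.
      Poly_Mapping.keys (\<Sum>S' \<in> generators D (i - 2) j. frag_cmul (coefficient D T S') (frag_of S')))"
    unfolding differential_def by (rule subsetD[OF keys_frag_extend])
  then show "S \<in> generators D (i - 2) j"
    by (auto simp: in_keys_iff lookup_sum_frag_of[OF finite_generators] split: if_splits)
qed

lemma differential_add: "differential D i j (x + y) = differential D i j x + differential D i j y"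
  by (simp add: differential_def frag_extend_add)

lemma differential_cmul: "differential D i j (frag_cmul c x) = frag_cmul c (differential D i j x)"
  by (simp add: differential_def frag_extend_cmul)

lemma differential_differential:
  assumes "Poly_Mapping.keys y \<subseteq> generators D (i + 2) j"
  shows "differential D i j (differential D (i + 2) j y) = 0"
proof (rule poly_mapping_eqI)
  fix S''
  have k: "Poly_Mapping.keys (differential D (i + 2) j y) \<subseteq> generators D i j"
    using keys_differential[of "i + 2" j y] by simp
  have "(\<Sum>S' \<in> generators D i j. Poly_Mapping.lookup (differential D (i + 2) j y) S' * coefficient D S' S'') = 0"
    if S'': "S'' \<in> generators D (i - 2) j"
  proof -
    have "(\<Sum>S' \<in> generators D i j. Poly_Mapping.lookup (differential D (i + 2) j y) S' * coefficient D S' S'') =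
        (\<Sum>S' \<in> generators D i j. \<Sum>S \<in> generators D (i + 2) j.
          Poly_Mapping.lookup y S * (coefficient D S S' * coefficient D S' S''))"
      by (simp add: lookup_differential[OF assms] sum_distrib_right mult.assoc)
    also have "\<dots> = (\<Sum>S \<in> generators D (i + 2) j.
        Poly_Mapping.lookup y S * (\<Sum>S' \<in> generators D i j. coefficient D S S' * coefficient D S' S''))"
      by (subst sum.swap) (simp add: sum_distrib_left)
    also have "\<dots> = 0"
      using coefficient_square_zero[of _ "i + 2" j S''] S'' by simp
    finally show ?thesis .
  qed
  then show "Poly_Mapping.lookup (differential D i j (differential D (i + 2) j y)) S'' = Poly_Mapping.lookup 0 S''"
    by (simp add: lookup_differential[OF k])
qed

lemma exact_chain:
  assumes ex: "exact j m (enhanced_states D) i" and z: "Poly_Mapping.keys z \<subseteq> generators D i j"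
    and dvd: "\<And>S'. m dvd Poly_Mapping.lookup (differential D i j z) S'"
  obtains y u where "Poly_Mapping.keys y \<subseteq> generators D (i + 2) j" "Poly_Mapping.keys u \<subseteq> generators D i j"
    "z = differential D (i + 2) j y + frag_cmul m u"
proof -
  have "m dvd (\<Sum>S \<in> generators D i j. Poly_Mapping.lookup z S * coefficient D S S')"
    if "S' \<in> generators D (i - 2) j" for S'
    using dvd[of S'] that by (simp add: lookup_differential[OF z])
  then obtain y where y: "\<And>S. S \<in> generators D i j \<Longrightarrow>
      m dvd Poly_Mapping.lookup z S - (\<Sum>S' \<in> generators D (i + 2) j. y S' * coefficient D S' S)"
    using exact_at_generators[OF ex, of "Poly_Mapping.lookup z"] by blast
  define y' where "y' = (\<Sum>S \<in> generators D (i + 2) j. frag_cmul (y S) (frag_of S))"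
  \<comment> \<open>The choice of \<open>y\<close> makes this division by \<open>m\<close> exact on
    every generator; for \<open>m = 0\<close> numerator and quotient are both 0.\<close>
  define u where "u = (\<Sum>S \<in> generators D i j. frag_cmul
    ((Poly_Mapping.lookup z S - Poly_Mapping.lookup (differential D (i + 2) j y') S) div m) (frag_of S))"
  have look: "Poly_Mapping.lookup (\<Sum>S \<in> generators D i j. frag_cmul (f S) (frag_of S)) T =
      (if T \<in> generators D i j then f T else 0)" for f T i
    by (rule lookup_sum_frag_of[OF finite_generators])
  have ky: "Poly_Mapping.keys y' \<subseteq> generators D (i + 2) j"
    by (auto simp: in_keys_iff y'_def look split: if_splits)
  have ku: "Poly_Mapping.keys u \<subseteq> generators D i j"
    by (auto simp: in_keys_iff u_def look split: if_splits)
  have "z = differential D (i + 2) j y' + frag_cmul m u"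
  proof (rule poly_mapping_eqI)
    fix S
    show "Poly_Mapping.lookup z S = Poly_Mapping.lookup (differential D (i + 2) j y' + frag_cmul m u) S"
    proof (cases "S \<in> generators D i j")
      case True
      have "(\<Sum>S' \<in> generators D (i + 2) j. Poly_Mapping.lookup y' S' * coefficient D S' S) =
          (\<Sum>S' \<in> generators D (i + 2) j. y S' * coefficient D S' S)"
        by (rule sum.cong) (simp_all add: y'_def look)
      then have "Poly_Mapping.lookup (differential D (i + 2) j y') S =
          (\<Sum>S' \<in> generators D (i + 2) j. y S' * coefficient D S' S)"
        using True by (simp add: lookup_differential[OF ky])
      then have "m dvd Poly_Mapping.lookup z S - Poly_Mapping.lookup (differential D (i + 2) j y') S"
        using y[OF True] by simp
      then show ?thesis using True by (simp add: lookup_add u_def look)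
    next
      case False
      then have "Poly_Mapping.lookup z S = 0" using z by (auto simp: in_keys_iff)
      then show ?thesis using False by (simp add: lookup_add u_def look lookup_differential[OF ky])
    qed
  qed
  then show thesis using that ky ku by blast
qed

definition cycles :: "int \<Rightarrow> int \<Rightarrow> (enhanced_state \<Rightarrow>\<^sub>0 int) set" where
  "cycles i j = {z. Poly_Mapping.keys z \<subseteq> generators D i j \<and> differential D i j z = 0}"

definition boundaries :: "int \<Rightarrow> int \<Rightarrow> (enhanced_state \<Rightarrow>\<^sub>0 int) set" where
  "boundaries i j = differential D (i + 2) j ` {y. Poly_Mapping.keys y \<subseteq> generators D (i + 2) j}"

lemma boundaries_subset: "boundaries i j \<subseteq> cycles i j"
proof
  fix x assume "x \<in> boundaries i j"
  then obtain y where "Poly_Mapping.keys y \<subseteq> generators D (i + 2) j" "x = differential D (i + 2) j y"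
    by (auto simp: boundaries_def)
  then show "x \<in> cycles i j"
    using differential_differential[of y i j] keys_differential[of "i + 2" j y] by (simp add: cycles_def)
qed

lemma hom_differential: "differential D i j \<in> hom (chain_group D i j) (chain_group D (i - 2) j)"
  using keys_differential by (auto simp: hom_def chain_group_def differential_add)

lemma homology_eq:
  "homology D i j = subgroup_generated (chain_group D i j) (cycles i j) Mod boundaries i j"
  "carrier (subgroup_generated (chain_group D i j) (cycles i j)) = cycles i j"
  "boundaries i j \<lhd> subgroup_generated (chain_group D i j) (cycles i j)"
proof -
  interpret C: comm_group "chain_group D i j"
    unfolding chain_group_def by (rule abelian_free_Abelian_group)
  interpret C2: comm_group "chain_group D (i + 2) j"
    unfolding chain_group_def by (rule abelian_free_Abelian_group)
  interpret d: group_hom "chain_group D i j" "chain_group D (i - 2) j" "differential D i j"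
    using hom_differential by (intro group_hom.intro group_hom_axioms.intro) (auto simp: chain_group_def)
  have ker: "kernel (chain_group D i j) (chain_group D (i - 2) j) (differential D i j) = cycles i j"
    by (auto simp: kernel_def cycles_def chain_group_def)
  have im: "differential D (i + 2) j ` carrier (chain_group D (i + 2) j) = boundaries i j"
    by (simp add: boundaries_def chain_group_def free_Abelian_group_def)
  show "homology D i j = subgroup_generated (chain_group D i j) (cycles i j) Mod boundaries i j"
    unfolding homology_def ker im ..
  have sub: "subgroup (cycles i j) (chain_group D i j)" using d.subgroup_kernel unfolding ker .
  then show car: "carrier (subgroup_generated (chain_group D i j) (cycles i j)) = cycles i j"
    by (rule subgroup.carrier_subgroup_generated_subgroup)
  interpret d2: group_hom "chain_group D (i + 2) j" "chain_group D i j" "differential D (i + 2) j"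
    using hom_differential[of "i + 2" j] by (intro group_hom.intro group_hom_axioms.intro) (auto simp: chain_group_def)
  have "subgroup (boundaries i j) (chain_group D i j)" using d2.img_is_subgroup unfolding im .
  then have "subgroup (boundaries i j) (subgroup_generated (chain_group D i j) (cycles i j))"
    using boundaries_subset by (intro C.subgroup_of_subgroup_generated)
  then show "boundaries i j \<lhd> subgroup_generated (chain_group D i j) (cycles i j)"
    using C.abelian_subgroup_generated C.comm_group_axioms by (intro comm_group.subgroup_imp_normal)
qed

lemma group_homology: "group (homology D i j)"
  unfolding homology_eq(1) using homology_eq(3) by (rule normal.factorgroup_is_group)

text \<open>Modulo 0, divisibility is equality, so the exactness statement is the one over the
  integers.\<close>

lemma trivial_homology:
  assumes "exact j 0 (enhanced_states D) i"
  shows "trivial_group (homology D i j)"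
proof -
  let ?G = "subgroup_generated (chain_group D i j) (cycles i j)"
  interpret normal "boundaries i j" ?G by (rule homology_eq(3))
  have "z \<in> boundaries i j" if "z \<in> cycles i j" for z
  proof -
    have "Poly_Mapping.keys z \<subseteq> generators D i j" "differential D i j z = 0" using that by (auto simp: cycles_def)
    then obtain y where "Poly_Mapping.keys y \<subseteq> generators D (i + 2) j" "z = differential D (i + 2) j y"
      using exact_chain[OF assms, of z] by (metis add.right_neutral dvd_0_right frag_cmul_zero lookup_zero)
    then show ?thesis by (auto simp: boundaries_def)
  qed
  then have "boundaries i j #>\<^bsub>?G\<^esub> z = boundaries i j" if "z \<in> cycles i j" for z
    using coset_join2[OF _ subgroup_axioms] that homology_eq(2) by simp
  then have "carrier (homology D i j) \<subseteq> {\<one>\<^bsub>homology D i j\<^esub>}"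
    unfolding homology_eq(1) carrier_FactGroup homology_eq(2) by auto
  then show ?thesis using group.trivial_group_subset[OF group_homology] by blast
qed

text \<open>The injection of the \<open>n\<close>-torsion into a quotient of the homology mod
  \<open>n\<close> one step higher, on chains: if \<open>n\<close> times \<open>z\<close> is the
  boundary of \<open>y\<close>, then \<open>y\<close> is a cycle mod \<open>n\<close> in degree
  \<open>i + 2\<close>. Exactness there gives \<open>y\<close> as a boundary plus \<open>n\<close>
  times \<open>u\<close>, and cancelling \<open>n\<close> in a free group makes \<open>z\<close> the
  boundary of \<open>u\<close>.\<close>

lemma torsion_free_homology:
  assumes "\<And>m. exact j m (enhanced_states D) (i + 2)"
  shows "torsion_subgroup (homology D i j) = {\<one>\<^bsub>homology D i j\<^esub>}"
proof -
  let ?G = "subgroup_generated (chain_group D i j) (cycles i j)"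
  interpret normal "boundaries i j" ?G by (rule homology_eq(3))
  have "x = \<one>\<^bsub>homology D i j\<^esub>" if x: "x \<in> carrier (homology D i j)" and n: "n > 0"
    "x [^]\<^bsub>homology D i j\<^esub> n = \<one>\<^bsub>homology D i j\<^esub>" for x and n :: nat
  proof -
    obtain z where z: "z \<in> cycles i j" "x = boundaries i j #>\<^bsub>?G\<^esub> z"
      using x unfolding homology_eq(1) carrier_FactGroup homology_eq(2) by blast
    have pow: "z [^]\<^bsub>?G\<^esub> n = frag_cmul (int n) z"
      by (simp add: pow_subgroup_generated chain_group_def)
    have "boundaries i j #>\<^bsub>?G\<^esub> frag_cmul (int n) z = boundaries i j"
      using n(2) FactGroup_pow[of z n] z homology_eq(2) pow unfolding homology_eq(1) by simp
    moreover have "frag_cmul (int n) z \<in> carrier ?G"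
      using nat_pow_closed[of z n] z(1) pow homology_eq(2) by simp
    ultimately have "frag_cmul (int n) z \<in> boundaries i j"
      using coset_join1[OF _ _ subgroup_axioms] subset by blast
    then obtain y where y: "Poly_Mapping.keys y \<subseteq> generators D (i + 2) j"
        "frag_cmul (int n) z = differential D (i + 2) j y" by (auto simp: boundaries_def)
    have "int n dvd Poly_Mapping.lookup (differential D (i + 2) j y) S" for S
      unfolding y(2)[symmetric] by simp
    then obtain w u where wu: "Poly_Mapping.keys w \<subseteq> generators D (i + 2 + 2) j"
        "Poly_Mapping.keys u \<subseteq> generators D (i + 2) j"
        "y = differential D (i + 2 + 2) j w + frag_cmul (int n) u"
      using exact_chain[OF assms y(1)] by metis
    have "frag_cmul (int n) z = frag_cmul (int n) (differential D (i + 2) j u)"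
      using y(2) differential_differential[OF wu(1)] unfolding wu(3)
      by (simp add: differential_add differential_cmul)
    then have "z = differential D (i + 2) j u"
      using n(1) by (intro poly_mapping_eqI) (metis lookup_frag_cmul mult_cancel_left of_nat_0_eq_iff less_irrefl)
    then have "z \<in> boundaries i j" using wu(2) by (auto simp: boundaries_def)
    then show ?thesis
      unfolding z(2) homology_eq(1) one_FactGroup
      using coset_join2[OF _ subgroup_axioms] z(1) homology_eq(2) by simp
  qed
  moreover have "\<one>\<^bsub>homology D i j\<^esub> \<in> torsion_subgroup (homology D i j)"
    using group_homology[of i j] unfolding torsion_subgroup_def
    by (auto intro!: exI[of _ 1] simp: group.is_monoid monoid.nat_pow_one)
  ultimately show ?thesis unfolding torsion_subgroup_def by blast
qed

end

theorem corollaryX5p8: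
  fixes D :: diagram and k :: nat
  assumes "link_diagram D"
    and "non_split D"
    and "almost_alternating k D"
    and "\<not> (\<exists>c. nugatory D c)"
  shows "H_thick D (int k) (int k) \<and> TH_thick D (int k) (int k - 1)"
proof -
  obtain K where KD: "K \<subseteq> {..<ncross D}" "card K = k" "alternating (change_crossings K D)"
    using assms(3) unfolding almost_alternating_def by blast
  interpret almost_alternating_diagram D K
    using assms(1) KD by unfold_locales
  have above: "exact j m (enhanced_states D) i"
    if "j - 2 * i > 2 * int (card (circles D (s_plus D))) - int (ncross D) + 4 * int k" for i j m
    using exact_enhanced_states[where e = 1 and s = "s_plus D" and i = i and j = j] that KD(2) by simp
  have below: "exact j m (enhanced_states D) i"
    if "j - 2 * i < int (ncross D) - 2 * int (card (circles D (s_minus D))) - 4 * int k" for i j m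
    using exact_enhanced_states[where e = "-1" and s = "s_minus D" and i = i and j = j] that KD(2) by simp
  have "trivial_group (homology D i j)" if "\<not> in_band D (int k) (int k) i j" for i j
    using that above below unfolding in_band_def not_le de_Morgan_conj
    by (intro trivial_homology) blast
  moreover have "torsion_subgroup (homology D i j) = {\<one>\<^bsub>homology D i j\<^esub>}"
    if "\<not> in_band D (int k) (int k - 1) i j" for i j
  proof (cases "j - 2 * i > 2 * int (card (circles D (s_plus D))) - int (ncross D) + 4 * int k")
    case True
    show ?thesis by (rule torsion_trivial_group[OF trivial_homology[OF above[OF True]]])
  next
    case False
    \<comment> \<open>Passing from \<open>i\<close> to \<open>i + 2\<close> lowers
      \<open>j - 2 * i\<close> by 4, the amount by which the band with \<open>k - 1\<close> is
      narrower at its lower end than the band with \<open>k\<close>.\<close>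
    then have "j - 2 * (i + 2) < int (ncross D) - 2 * int (card (circles D (s_minus D))) - 4 * int k"
      using that by (auto simp: in_band_def)
    then show ?thesis by (intro torsion_free_homology below)
  qed
  ultimately show ?thesis unfolding H_thick_def TH_thick_def by blast
qed

end
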